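(* For $\theta>0$ define $$s_\theta=\begin{cases}-\frac{\theta}{2}, & \theta\le 1,\\ -\sqrt{\theta}+\frac12, & \theta>1.\end{cases}$$ Then for any $\theta>0$, the holomorphic multiplicative chaos $\mathrm{HMC}_\theta$ is almost surely in $H^s$ for any $s<s_\theta$, and it is almost surely not in $H^s$ for any $s>s_\theta$.
   Context: Let $(\mathcal N_k)_{k\ge1}$ be i.i.d. standard complex normal random variables ($\mathbb{E}\mathcal N_k=0$, $\mathbb{E}\mathcal N_k^2=0$, $\mathbb{E}|\mathcal N_k|^2=1$) and $G^{\mathbb C}(z)=\sum_{k\ge1}\frac{z^k}{\sqrt k}\mathcal N_k$ for $|z|<1$. For $\theta>0$, the holomorphic multiplicative chaos $\mathrm{HMC}_\theta$ is the random distribution on the unit circle defined on trigonometric polynomials $\phi$ (extended harmonically to the unit disc) by $$(\mathrm{HMC}_\theta,\phi)=\lim_{r\to1^-}\frac1{2\pi}\int_0^{2\pi}e^{\sqrt\theta\,G^{\mathbb C}(re^{i\vartheta})}\,\overline{\phi(re^{i\vartheta})}\,d\vartheta .$$ Equivalently, its $n$-th Fourier coefficient $(\mathrm{HMC}_\theta,\vartheta\mapsto e^{in\vartheta})$ is $0$ for $n<0$, and for $n\ge0$ it is $c_n$, the coefficient of $z^n$ in the power series expansion of $e^{\sqrt\theta G^{\mathbb C}(z)}$ at $0$. For $s\in\mathbb R$, the Sobolev space $H^s$ is the space of distributions $f$ on the unit circle with $\|f\|_{H^s}^2=\sum_{n\in\mathbb Z}(1+n^2)^s|\widehat f(n)|^2<\infty$,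 where $\widehat f(n)=(f,\vartheta\mapsto e^{in\vartheta})$ is the $n$-th Fourier coefficient (for integrable $f$, $\widehat f(n)=\frac1{2\pi}\int_0^{2\pi}f(e^{i\vartheta})e^{-in\vartheta}d\vartheta$). *)

theory Defs
  imports "HOL-Probability.Probability"
begin

section \<open>Test functions and distributions on the unit circle\<close>

text \<open>A function on the unit circle is represented by its dependence on the angle \<open>t\<close>.\<close>

definition trig_polys :: "(real \<Rightarrow> complex) set" where
  "trig_polys = {\<phi>. \<exists>(N::nat) (a :: int \<Rightarrow> complex).
     \<phi> = (\<lambda>t. \<Sum>n = - int N..int N. a n * cis (of_int n * t))}"

definition fourier_coeff :: "(real \<Rightarrow> complex) \<Rightarrow> int \<Rightarrow> complex" where
  "fourier_coeff \<phi> n =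
     1 / (2 * of_real pi) * integral {0..2 * pi} (\<lambda>t. \<phi> t * cis (- (of_int n * t)))"

text \<open>
  For a trigonometric polynomial the sum is finite. The harmonic extension of \<open>t \<mapsto> cis (n * t)\<close>
  is \<open>z ^ n\<close> for \<open>n \<ge> 0\<close> and the conjugate of \<open>z ^ (-n)\<close> for \<open>n < 0\<close>.
\<close>
definition harmonic_extension :: "(real \<Rightarrow> complex) \<Rightarrow> complex \<Rightarrow> complex" where
  "harmonic_extension \<phi> z =
     (\<Sum>n | fourier_coeff \<phi> n \<noteq> 0.
        fourier_coeff \<phi> n * (if 0 \<le> n then z ^ nat n else cnj z ^ nat (- n)))"

definition angular_deriv :: "nat \<Rightarrow> (real \<Rightarrow> complex) \<Rightarrow> real \<Rightarrow> complex" where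
  "angular_deriv j = ((\<lambda>f t. vector_derivative f (at t)) ^^ j)"

text \<open>
  Distributions act on test functions conjugate-linearly, in accordance with the pairing
  \<open>(f, \<phi>) = 1 / (2 * pi) * \<integral> f * cnj \<phi>\<close>, and are continuous for the topology of smooth functions.
  Trigonometric polynomials are dense there, so a distribution is determined by its
  values on them; the values of \<open>F\<close> elsewhere are irrelevant.
\<close>
definition circle_distribution :: "((real \<Rightarrow> complex) \<Rightarrow> complex) \<Rightarrow> bool" where
  "circle_distribution F \<longleftrightarrow>
     (\<forall>\<phi>\<in>trig_polys. \<forall>\<psi>\<in>trig_polys. \<forall>a b.
        F (\<lambda>t. a * \<phi> t + b * \<psi> t) = cnj a * F \<phi> + cnj b * F \<psi>) \<and>
     (\<exists>(C::real) (m::nat). \<forall>\<phi>\<in>trig_polys.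
        cmod (F \<phi>) \<le> C * (\<Sum>j\<le>m. SUP t\<in>{0..2 * pi}. cmod (angular_deriv j \<phi> t)))"

definition dist_fourier_coeff :: "((real \<Rightarrow> complex) \<Rightarrow> complex) \<Rightarrow> int \<Rightarrow> complex" where
  "dist_fourier_coeff F n = F (\<lambda>t. cis (of_int n * t))"

definition sobolev :: "real \<Rightarrow> ((real \<Rightarrow> complex) \<Rightarrow> complex) set" where
  "sobolev s = {F. circle_distribution F \<and>
     (\<lambda>n::int. (1 + (of_int n)\<^sup>2) powr s * (cmod (dist_fourier_coeff F n))\<^sup>2) summable_on UNIV}"

section \<open>Holomorphic multiplicative chaos\<close>

text \<open>
  Real and imaginary parts are independent centred Gaussians of variance \<open>1/2\<close>, so that
  \<open>E X = 0\<close>, \<open>E X\<^sup>2 = 0\<close> and \<open>E \<bar>X\<bar>\<^sup>2 = 1\<close>. The second parameter of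
  \<open>normal_density\<close> is the standard deviation.
\<close>
definition std_complex_normal :: "'a measure \<Rightarrow> ('a \<Rightarrow> complex) \<Rightarrow> bool" where
  "std_complex_normal M X \<longleftrightarrow>
     prob_space.indep_var M borel (\<lambda>\<omega>. Re (X \<omega>)) borel (\<lambda>\<omega>. Im (X \<omega>)) \<and>
     distributed M lborel (\<lambda>\<omega>. Re (X \<omega>)) (normal_density 0 (sqrt (1 / 2))) \<and>
     distributed M lborel (\<lambda>\<omega>. Im (X \<omega>)) (normal_density 0 (sqrt (1 / 2)))"

definition gauss_series :: "(nat \<Rightarrow> 'a \<Rightarrow> complex) \<Rightarrow> 'a \<Rightarrow> complex \<Rightarrow> complex" where
  "gauss_series X \<omega> z = (\<Sum>k. z ^ Suc k / of_real (sqrt (real (Suc k))) * X (Suc k) \<omega>)"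

definition HMC :: "real \<Rightarrow> (nat \<Rightarrow> 'a \<Rightarrow> complex) \<Rightarrow> 'a \<Rightarrow> (real \<Rightarrow> complex) \<Rightarrow> complex" where
  "HMC \<theta> X \<omega> \<phi> = Lim (at_left 1) (\<lambda>r::real.
     1 / (2 * of_real pi) * integral {0..2 * pi} (\<lambda>t.
       exp (of_real (sqrt \<theta>) * gauss_series X \<omega> (of_real r * cis t)) *
       cnj (harmonic_extension \<phi> (of_real r * cis t))))"

definition s_crit :: "real \<Rightarrow> real" where
  "s_crit \<theta> = (if \<theta> \<le> 1 then - \<theta> / 2 else - sqrt \<theta> + 1 / 2)"

end

theory Submission
  imports Defs "HOL-Complex_Analysis.Complex_Analysis"
begin

text \<open>
  Write \<open>F\<^sub>g = exp (g * G)\<close> with \<open>g = sqrt \<theta>\<close>, and let the energy of \<open>F\<^sub>g\<close> at radius \<open>r\<close> be its mean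
  square on the circle of radius \<open>r\<close>. By Parseval, Sobolev regularity is equivalent, up to an
  arbitrarily small loss, to a power bound on the energy along \<open>r\<^sup>2 = 1 - 2 ^ -j\<close>. Since the expected
  energy is at most \<open>(1 - r\<^sup>2) powr (-\<theta>)\<close>, Borel-Cantelli settles membership for \<open>\<theta> \<le> 1\<close>. For \<open>\<theta> > 1\<close>
  the case \<open>\<theta> = 1\<close> and the Cauchy-Schwarz inequality bound \<open>\<bar>F\<^sub>1\<bar>\<close> pointwise by roughly \<open>1 / (1 - r)\<close>,
  and \<open>\<bar>F\<^sub>g\<bar>\<^sup>2 = \<bar>F\<^sub>1\<bar>\<^sup>2 * \<bar>F\<^sub>1\<bar> powr (2 * (g - 1))\<close> then has the sharp growth.

  Conversely, for \<open>\<theta> < 1\<close> the energy is not \<open>o((1 - r\<^sup>2) powr (-\<theta>))\<close>: restricting to points where the field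
  stays near its typical value on all dyadic scales makes the second moment comparable with the
  square of the first, so the normalised energy stays away from \<open>0\<close> with probability bounded below,
  and Kolmogorov's zero-one law upgrades this to probability one. For \<open>\<theta> \<ge> 1\<close>, being in \<open>H\<^sup>s\<close> with \<open>s\<close>
  supercritical would bound \<open>\<bar>F\<^sub>g\<bar>\<close> pointwise so well that, for \<open>g\<^sub>0 < g\<^sub>1 < 1\<close> close to \<open>1\<close>, the energy of
  \<open>F\<close> with parameter \<open>g\<^sub>1\<close> would be too small compared with that with parameter \<open>g\<^sub>0\<close>.
\<close>


section \<open>Power series on the unit disc\<close>

text \<open>All parameters share one Gaussian field, and
  \<open>cmod (chaos g x z) = exp (g * Re (gser x z))\<close>, so a pointwise bound at one parameter
  is information about every other. Under the law tilted by the squared modulus at parameter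
  \<open>h\<close>, \<open>Re (gser x z)\<close> is centred at
  \<open>h * ln (1 / (1 - r^2))\<close>. Membership in a supercritical space at
  \<open>g \<ge> 1\<close> caps the field at \<open>k * ln (1 / (1 - r^2))\<close> plus a constant,
  with some \<open>k < 1\<close>, and this starves the energies at parameters between
  \<open>k\<close> and \<open>1\<close>; hence lower bounds are only proved below \<open>1\<close>.
  Passing from mean squares to pointwise bounds costs one power of \<open>1 / (1 - r)\<close> in the
  square, and \<open>1 + 2 * (g - 1) = 2 * g - 1\<close> is \<open>-2\<close> times the critical
  index for \<open>g > 1\<close>. The obstacle to the lower bound: the plain second moment has
  kernel \<open>|t - u| powr (-2 * \<theta>)\<close>, integrable only for
  \<open>\<theta> < 1 / 2\<close>, because frequencies below \<open>1 / |t - u|\<close> are nearly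
  common to both points and count twice. The barrier charges them once, up to a loss
  \<open>2 * g * e\<close> in the exponent.\<close>

lemma trigonometric_series_integral_sums:
  fixes b :: "nat \<Rightarrow> complex" and \<psi> :: "real \<Rightarrow> complex"
  assumes b: "summable (\<lambda>n. cmod (b n))" and \<psi>: "continuous_on {u..v} \<psi>"
  shows "(\<lambda>n. b n * integral {u..v} (\<lambda>t. cis (of_nat n * t) * \<psi> t)) sums
    integral {u..v} (\<lambda>t. (\<Sum>n. b n * cis (of_nat n * t)) * \<psi> t)"
proof -
  have "compact (\<psi> ` {u..v})"
    by (intro compact_continuous_image \<psi>) auto
  then obtain K where K: "\<And>t. t \<in> {u..v} \<Longrightarrow> cmod (\<psi> t) \<le> K"
    using bounded_iff compact_imp_bounded by (metis image_eqI)
  let ?f = "\<lambda>n t. b n * cis (of_nat n * t) * \<psi> t"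
  have lim: "uniform_limit {u..v} (\<lambda>N t. \<Sum>n<N. ?f n t) (\<lambda>t. \<Sum>n. ?f n t) sequentially"
  proof (rule Weierstrass_m_test)
    show "cmod (?f n t) \<le> cmod (b n) * K" if "t \<in> {u..v}" for n t
      using K[OF that] by (simp add: norm_mult mult_left_mono)
    show "summable (\<lambda>n. cmod (b n) * K)"
      using b by (rule summable_mult2)
  qed
  have cont: "continuous_on {u..v} (?f n)" for n
    by (intro continuous_intros \<psi>)
  have int: "?f n integrable_on {u..v}" for n
    using cont by (rule integrable_continuous_real)
  obtain I J where IJ: "\<And>N. ((\<lambda>t. \<Sum>n<N. ?f n t) has_integral I N) {u..v}"
      "((\<lambda>t. \<Sum>n. ?f n t) has_integral J) {u..v}" "I \<longlonglongrightarrow> J"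
    by (rule uniform_limit_integral[OF lim]) (auto intro!: continuous_on_sum cont)
  have eqI: "I N = (\<Sum>n<N. b n * integral {u..v} (\<lambda>t. cis (of_nat n * t) * \<psi> t))" for N
  proof -
    have "I N = integral {u..v} (\<lambda>t. \<Sum>n<N. ?f n t)"
      using IJ(1)[of N] by (rule integral_unique[symmetric])
    also have "\<dots> = (\<Sum>n<N. integral {u..v} (?f n))"
      by (intro integral_sum int) auto
    also have "\<dots> = (\<Sum>n<N. b n * integral {u..v} (\<lambda>t. cis (of_nat n * t) * \<psi> t))"
      by (simp add: mult.assoc)
    finally show ?thesis .
  qed
  have "(\<Sum>n. ?f n t) = (\<Sum>n. b n * cis (of_nat n * t)) * \<psi> t" for t
    by (rule suminf_mult2[symmetric], rule summable_norm_cancel) (simp add: norm_mult b)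
  then have eqJ: "J = integral {u..v} (\<lambda>t. (\<Sum>n. b n * cis (of_nat n * t)) * \<psi> t)"
    using integral_unique[OF IJ(2)] by simp
  show ?thesis
    using IJ(3) unfolding sums_def eqI[abs_def] eqJ .
qed

lemma integral_cis_period:
  "integral {0..2 * pi} (\<lambda>t. cis (of_int n * t)) = (if n = 0 then 2 * of_real pi else 0)"
proof (cases "n = 0")
  case False
  have "((\<lambda>t. cis (of_int n * t)) has_integral
      (cis (of_int n * (2 * pi)) / (\<i> * of_int n) - cis (of_int n * 0) / (\<i> * of_int n))) {0..2 * pi}"
  proof (rule fundamental_theorem_of_calculus)
    fix t :: real
    have "((\<lambda>z. exp (\<i> * of_int n * z) / (\<i> * of_int n)) has_field_derivative
        exp (\<i> * of_int n * of_real t)) (at (of_real t))"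
      using False by (auto intro!: derivative_eq_intros)
    from has_vector_derivative_real_field[OF this]
    show "((\<lambda>t. cis (of_int n * t) / (\<i> * of_int n)) has_vector_derivative cis (of_int n * t))
        (at t within {0..2 * pi})"
      by (simp add: cis_conv_exp mult.assoc)
  qed auto
  moreover have "cis (of_int n * (2 * pi)) = 1"
    using cis_multiple_2pi[of "of_int n"] by (metis Ints_of_int mult.commute)
  ultimately show ?thesis
    using False by (simp add: integral_unique)
qed (simp add: scaleR_conv_of_real)

text \<open>A deterministic condition that holds almost surely and under which the complex analysis
  is done sample by sample. Linear growth is far above the size of Gaussian samples, but keeps the
  radius of convergence at least \<open>1\<close>.\<close>

definition tame :: "(nat \<Rightarrow> complex) \<Rightarrow> bool" where
  "tame x \<longleftrightarrow> (\<exists>C. \<forall>k\<ge>1. cmod (x k) \<le> C * real k)"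

definition gser :: "(nat \<Rightarrow> complex) \<Rightarrow> complex \<Rightarrow> complex" where
  "gser x z = (\<Sum>k. z ^ Suc k / of_real (sqrt (real (Suc k))) * x (Suc k))"

definition chaos :: "real \<Rightarrow> (nat \<Rightarrow> complex) \<Rightarrow> complex \<Rightarrow> complex" where
  "chaos g x z = exp (of_real g * gser x z)"

definition coef :: "real \<Rightarrow> (nat \<Rightarrow> complex) \<Rightarrow> nat \<Rightarrow> complex" where
  "coef g x n = (deriv ^^ n) (chaos g x) 0 / fact n"

definition energy :: "real \<Rightarrow> (nat \<Rightarrow> complex) \<Rightarrow> real \<Rightarrow> real" where
  "energy g x r = integral {0..2 * pi} (\<lambda>t. (cmod (chaos g x (of_real r * cis t)))\<^sup>2) / (2 * pi)"

lemma gser_summable_norm: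
  assumes "tame x" "cmod z < 1"
  shows "summable (\<lambda>k. cmod (z ^ Suc k / of_real (sqrt (real (Suc k))) * x (Suc k)))"
proof -
  obtain C where C: "\<And>k. k \<ge> 1 \<Longrightarrow> cmod (x k) \<le> C * real k"
    using assms by (auto simp: tame_def)
  show ?thesis
  proof (rule summable_comparison_test)
    \<comment> \<open>The majorant is the derivative of the geometric series; one factor
      \<open>cmod z\<close> and the square root are given away.\<close>
    show "summable (\<lambda>k. C * (real (Suc k) * cmod z ^ k))"
      using geometric_deriv_sums[of "cmod z"] assms by (intro summable_mult) (auto simp: sums_iff)
    have "cmod (z ^ Suc k / of_real (sqrt (real (Suc k))) * x (Suc k)) \<le> cmod z ^ k * (C * real (Suc k))" for k
    proof -
      have "cmod (z ^ Suc k / of_real (sqrt (real (Suc k)))) \<le> cmod z ^ k"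
      proof -
        have "cmod z ^ Suc k / sqrt (real (Suc k)) \<le> cmod z ^ Suc k / 1"
          by (intro divide_left_mono) auto
        also have "\<dots> \<le> cmod z ^ k"
          using assms by (simp add: mult_left_le_one_le)
        finally show ?thesis
          by (simp add: norm_divide norm_power norm_mult)
      qed
      then show ?thesis
        using C[of "Suc k"] by (auto simp only: norm_mult intro!: mult_mono) auto
    qed
    then show "\<exists>N. \<forall>k\<ge>N. norm (cmod (z ^ Suc k / of_real (sqrt (real (Suc k))) * x (Suc k)))
        \<le> C * (real (Suc k) * cmod z ^ k)"
      by (simp add: mult_ac)
  qed
qed

lemma gser_sums:
  assumes "tame x" "cmod z < 1"
  shows "(\<lambda>k. z ^ Suc k / of_real (sqrt (real (Suc k))) * x (Suc k)) sums gser x z"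
  unfolding gser_def
  by (rule summable_sums[OF summable_norm_cancel[OF gser_summable_norm[OF assms]]])

lemma gser_holomorphic:
  assumes "tame x"
  shows "gser x holomorphic_on ball 0 1"
proof (rule power_series_holomorphic)
  fix w :: complex
  assume "w \<in> ball 0 1"
  then have "(\<lambda>k. w ^ Suc k / of_real (sqrt (real (Suc k))) * x (Suc k)) sums gser x w"
    using assms by (intro gser_sums) auto
  then have "(\<lambda>k. (\<lambda>n. (if n = 0 then 0 else x n / of_real (sqrt (real n))) * (w - 0) ^ n) (Suc k))
      sums gser x w"
    by (simp add: mult_ac)
  then show "(\<lambda>n. (if n = 0 then 0 else x n / of_real (sqrt (real n))) * (w - 0) ^ n) sums gser x w"
    by (subst (asm) sums_Suc_iff) simp
qed

lemma chaos_holomorphic: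
  assumes "tame x"
  shows "chaos g x holomorphic_on ball 0 1"
  unfolding chaos_def[abs_def] by (intro holomorphic_intros gser_holomorphic assms)

lemma chaos_sums:
  assumes "tame x" "cmod z < 1"
  shows "(\<lambda>n. coef g x n * z ^ n) sums chaos g x z"
  using holomorphic_power_series[OF chaos_holomorphic[OF assms(1), of g], of z] assms(2)
  by (simp add: coef_def)

lemma coef_summable_norm:
  assumes "tame x" "0 \<le> r" "r < 1"
  shows "summable (\<lambda>n. cmod (coef g x n * of_real r ^ n))"
proof -
  obtain R where R: "r < R" "R < 1"
    using assms dense by blast
  then have "summable (\<lambda>n. coef g x n * of_real R ^ n)"
    using chaos_sums[OF assms(1), of "of_real R" g] assms by (auto simp: sums_iff)
  then show ?thesis
    using R assms by (intro powser_insidea) auto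
qed

lemma continuous_on_chaos_circle:
  assumes "tame x" "0 \<le> r" "r < 1"
  shows "continuous_on A (\<lambda>t. chaos g x (of_real r * cis t))"
proof (rule continuous_on_compose2[OF holomorphic_on_imp_continuous_on[OF chaos_holomorphic[OF assms(1)]]])
  show "continuous_on A (\<lambda>t. of_real r * cis t)"
    by (intro continuous_intros)
  show "(\<lambda>t. of_real r * cis t) ` A \<subseteq> ball 0 1"
    using assms by (auto simp: norm_mult)
qed

lemma chaos_circle_eq:
  assumes "tame x" "0 \<le> r" "r < 1"
  shows "chaos g x (of_real r * cis t) = (\<Sum>n. coef g x n * of_real r ^ n * cis (of_nat n * t))"
proof -
  have "(\<lambda>n. coef g x n * (of_real r * cis t) ^ n) sums chaos g x (of_real r * cis t)"
    using assms by (intro chaos_sums) (auto simp: norm_mult)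
  then show ?thesis
    by (simp only: sums_iff power_mult_distrib Complex.DeMoivre mult.assoc)
qed

text \<open>With a character for \<open>\<psi>\<close> this yields the Fourier coefficients on a
  circle, with the conjugated chaos for \<open>\<psi>\<close> it yields Parseval's identity.\<close>

lemma chaos_integral_sums:
  assumes "tame x" "0 \<le> r" "r < 1" "continuous_on {u..v} \<psi>"
  shows "(\<lambda>n. coef g x n * of_real r ^ n * integral {u..v} (\<lambda>t. cis (of_nat n * t) * \<psi> t)) sums
    integral {u..v} (\<lambda>t. chaos g x (of_real r * cis t) * \<psi> t)"
  unfolding chaos_circle_eq[OF assms(1-3), of g]
  by (rule trigonometric_series_integral_sums[where b = "\<lambda>n. coef g x n * of_real r ^ n",
        OF coef_summable_norm[OF assms(1-3)] assms(4)])

lemma chaos_fourier_coeff: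
  assumes "tame x" "0 \<le> r" "r < 1"
  shows "integral {0..2 * pi} (\<lambda>t. chaos g x (of_real r * cis t) * cis (- (of_int m * t))) =
    (if m \<ge> 0 then 2 * of_real pi * coef g x (nat m) * of_real r ^ nat m else 0)"
proof -
  have "(\<lambda>n. coef g x n * of_real r ^ n * integral {0..2 * pi} (\<lambda>t. cis (of_nat n * t) * cis (- (of_int m * t)))) sums
    integral {0..2 * pi} (\<lambda>t. chaos g x (of_real r * cis t) * cis (- (of_int m * t)))"
    by (rule chaos_integral_sums[OF assms]) (intro continuous_intros)
  also have "(\<lambda>n. integral {0..2 * pi} (\<lambda>t. cis (of_nat n * t) * cis (- (of_int m * t)))) =
      (\<lambda>n. if int n = m then 2 * of_real pi else 0)"
  proof
    fix n
    have "cis (of_nat n * t) * cis (- (of_int m * t)) = cis (of_int (int n - m) * t)" for t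
      by (simp add: cis_mult left_diff_distrib)
    then show "integral {0..2 * pi} (\<lambda>t. cis (of_nat n * t) * cis (- (of_int m * t))) =
        (if int n = m then 2 * of_real pi else 0)"
      using integral_cis_period[of "int n - m"] by simp
  qed
  finally show ?thesis
  proof (rule sums_unique2)
    show "(\<lambda>n. coef g x n * of_real r ^ n * (if int n = m then 2 * of_real pi else 0)) sums
      (if m \<ge> 0 then 2 * of_real pi * coef g x (nat m) * of_real r ^ nat m else 0)"
    proof (cases "m \<ge> 0")
      case True
      have "(\<lambda>n. coef g x n * of_real r ^ n * (if int n = m then 2 * of_real pi else 0)) =
        (\<lambda>n. if n = nat m then coef g x n * of_real r ^ n * (2 * of_real pi) else 0)"
        using True by (auto simp: fun_eq_iff)
      then show ?thesis
        using True sums_single[of "nat m" "\<lambda>n. coef g x n * of_real r ^ n * (2 * of_real pi)"]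
        by (simp add: mult_ac)
    next
      case False
      then have "(\<lambda>n. coef g x n * of_real r ^ n * (if int n = m then 2 * of_real pi else 0)) = (\<lambda>n. 0)"
        by auto
      then show ?thesis
        using False by simp
    qed
  qed
qed

text \<open>Parseval's identity: the chaos is paired with its own conjugate, and each integral left
  in the series is a conjugated Fourier coefficient.\<close>

lemma energy_sums:
  assumes "tame x" "0 \<le> r" "r < 1"
  shows "(\<lambda>n. (cmod (coef g x n))\<^sup>2 * r ^ (2 * n)) sums energy g x r"
proof -
  let ?F = "\<lambda>t. chaos g x (of_real r * cis t)"
  have contF: "continuous_on A ?F" for A
    by (intro continuous_on_chaos_circle assms)
  have 1: "(\<lambda>n. coef g x n * of_real r ^ n * integral {0..2 * pi} (\<lambda>t. cis (of_nat n * t) * cnj (?F t))) sums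
      integral {0..2 * pi} (\<lambda>t. ?F t * cnj (?F t))"
    by (rule chaos_integral_sums[OF assms continuous_on_cnj[OF contF]])
  have 2: "integral {0..2 * pi} (\<lambda>t. ?F t * cnj (?F t)) =
      of_real (integral {0..2 * pi} (\<lambda>t. (cmod (?F t))\<^sup>2))"
  proof -
    have "(\<lambda>t. (cmod (?F t))\<^sup>2) integrable_on {0..2 * pi}"
      by (rule integrable_continuous_real[OF continuous_on_power[OF continuous_on_norm[OF contF]]])
    then show ?thesis
      by (subst complex_norm_square[symmetric])
        (intro integral_unique has_integral_of_real integrable_integral)
  qed
  have 3: "integral {0..2 * pi} (\<lambda>t. cis (of_nat n * t) * cnj (?F t)) =
      2 * of_real pi * cnj (coef g x n) * of_real r ^ n" for n
  proof -
    have "integral {0..2 * pi} (\<lambda>t. cis (of_nat n * t) * cnj (?F t)) =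
        cnj (integral {0..2 * pi} (\<lambda>t. ?F t * cis (- (of_int (int n) * t))))"
      unfolding integral_cnj complex_cnj_mult cis_cnj of_int_of_nat_eq minus_minus by (simp only: mult.commute)
    then show "integral {0..2 * pi} (\<lambda>t. cis (of_nat n * t) * cnj (?F t)) =
        2 * of_real pi * cnj (coef g x n) * of_real r ^ n"
      unfolding chaos_fourier_coeff[OF assms] by simp
  qed
  have 4: "coef g x n * of_real r ^ n * (2 * of_real pi * cnj (coef g x n) * of_real r ^ n) =
      complex_of_real (2 * pi * ((cmod (coef g x n))\<^sup>2 * r ^ (2 * n)))" for n
  proof -
    have "complex_of_real (r ^ (2 * n)) = of_real r ^ n * of_real r ^ n"
      by (simp only: of_real_mult of_real_power mult_2 power_add)
    then show "coef g x n * of_real r ^ n * (2 * of_real pi * cnj (coef g x n) * of_real r ^ n) =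
        complex_of_real (2 * pi * ((cmod (coef g x n))\<^sup>2 * r ^ (2 * n)))"
      by (simp only: of_real_mult complex_norm_square of_real_numeral mult_ac)
  qed
  from 1 have "(\<lambda>n. 2 * pi * ((cmod (coef g x n))\<^sup>2 * r ^ (2 * n))) sums
      integral {0..2 * pi} (\<lambda>t. (cmod (?F t))\<^sup>2)"
    unfolding 2 3 4 by (simp only: sums_of_real_iff)
  from sums_divide[OF this, of "2 * pi"] show ?thesis
    by (simp add: energy_def)
qed

section \<open>Pairing with trigonometric polynomials\<close>

definition tpoly :: "nat \<Rightarrow> (int \<Rightarrow> complex) \<Rightarrow> real \<Rightarrow> complex" where
  "tpoly N a t = (\<Sum>n = - int N..int N. a n * cis (of_int n * t))"

lemma trig_polys_tpoly:
  assumes "\<phi> \<in> trig_polys"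
  obtains N a where "\<phi> = tpoly N a"
  using assms unfolding trig_polys_def tpoly_def[abs_def] by blast

lemma continuous_on_tpoly: "continuous_on A (tpoly N a)"
  unfolding tpoly_def[abs_def] by (intro continuous_intros)

lemma fourier_coeff_tpoly:
  "fourier_coeff (tpoly N a) m = (if \<bar>m\<bar> \<le> int N then a m else 0)"
proof -
  have int: "(\<lambda>t. a n * cis (of_int (n - m) * t)) integrable_on {0..2 * pi}" for n
    by (rule integrable_continuous_real) (intro continuous_intros)
  have "integral {0..2 * pi} (\<lambda>t. tpoly N a t * cis (- (of_int m * t))) =
      integral {0..2 * pi} (\<lambda>t. \<Sum>n = - int N..int N. a n * cis (of_int (n - m) * t))"
    by (rule arg_cong[where f = "integral _"])
       (simp add: fun_eq_iff tpoly_def sum_distrib_right mult.assoc cis_mult left_diff_distrib)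
  also have "\<dots> = (\<Sum>n = - int N..int N. integral {0..2 * pi} (\<lambda>t. a n * cis (of_int (n - m) * t)))"
    by (rule integral_sum[OF _ int]) simp
  also have "\<dots> = (\<Sum>n = - int N..int N. if n = m then 2 * of_real pi * a n else 0)"
    by (rule sum.cong[OF refl]) (subst integral_mult_right, subst integral_cis_period, auto)
  also have "\<dots> = (if \<bar>m\<bar> \<le> int N then 2 * of_real pi * a m else 0)"
    by (auto simp: sum.delta)
  finally show ?thesis
    by (simp add: fourier_coeff_def)
qed

lemma harmonic_extension_tpoly:
  "harmonic_extension (tpoly N a) z =
    (\<Sum>n = - int N..int N. a n * (if 0 \<le> n then z ^ nat n else cnj z ^ nat (- n)))"
  unfolding harmonic_extension_def fourier_coeff_tpoly
  by (rule sum.mono_neutral_cong_left) (auto split: if_splits)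

lemma gauss_series_gser: "gauss_series X \<omega> = gser (\<lambda>k. X k \<omega>)"
  by (simp add: fun_eq_iff gauss_series_def gser_def)

lemma chaos_tpoly_integral:
  assumes "tame x" "0 \<le> r" "r < 1"
  shows "integral {0..2 * pi} (\<lambda>t. chaos g x (of_real r * cis t) *
      cnj (harmonic_extension (tpoly N a) (of_real r * cis t))) =
    (\<Sum>n = - int N..int N. cnj (a n) * of_real r ^ nat \<bar>n\<bar> *
      (if n \<ge> 0 then 2 * of_real pi * coef g x (nat n) * of_real r ^ nat n else 0))"
proof -
  let ?F = "\<lambda>t. chaos g x (of_real r * cis t)"
  have radial: "cnj (if 0 \<le> n then (of_real r * cis t) ^ nat n else cnj (of_real r * cis t) ^ nat (- n)) =
      of_real r ^ nat \<bar>n\<bar> * cis (- (of_int n * t))" for n :: int and t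
    by (auto simp: power_mult_distrib Complex.DeMoivre cis_cnj)
  have "integral {0..2 * pi} (\<lambda>t. ?F t * cnj (harmonic_extension (tpoly N a) (of_real r * cis t))) =
      integral {0..2 * pi} (\<lambda>t. \<Sum>n = - int N..int N.
        cnj (a n) * of_real r ^ nat \<bar>n\<bar> * (?F t * cis (- (of_int n * t))))"
    unfolding harmonic_extension_tpoly cnj_sum sum_distrib_left
  proof (intro arg_cong[where f = "integral _"] ext sum.cong refl)
    fix t n
    show "?F t * cnj (a n * (if 0 \<le> n then (of_real r * cis t) ^ nat n else cnj (of_real r * cis t) ^ nat (- n))) =
        cnj (a n) * of_real r ^ nat \<bar>n\<bar> * (?F t * cis (- (of_int n * t)))"
      unfolding complex_cnj_mult[of "a n"] radial by (simp only: mult_ac)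
  qed
  also have "\<dots> = (\<Sum>n = - int N..int N. integral {0..2 * pi} (\<lambda>t.
        cnj (a n) * of_real r ^ nat \<bar>n\<bar> * (?F t * cis (- (of_int n * t)))))"
    by (intro integral_sum integrable_continuous_real)
       (auto intro!: continuous_on_mult continuous_on_const continuous_on_cis continuous_on_minus
          continuous_on_id continuous_on_chaos_circle assms)
  also have "\<dots> = (\<Sum>n = - int N..int N. cnj (a n) * of_real r ^ nat \<bar>n\<bar> *
      (if n \<ge> 0 then 2 * of_real pi * coef g x (nat n) * of_real r ^ nat n else 0))"
    unfolding integral_mult_right chaos_fourier_coeff[OF assms] ..
  finally show ?thesis .
qed

text \<open>Only finitely many coefficients meet a trigonometric polynomial, so on
  \<open>0 < r < 1\<close> the integral is a polynomial in \<open>r\<close>, and the radial limit is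
  its value at \<open>1\<close>.\<close>

lemma HMC_tpoly:
  assumes "tame (\<lambda>k. X k \<omega>)"
  shows "HMC \<theta> X \<omega> (tpoly N a) = (\<Sum>n\<le>N. cnj (a (int n)) * coef (sqrt \<theta>) (\<lambda>k. X k \<omega>) n)"
proof -
  let ?c = "coef (sqrt \<theta>) (\<lambda>k. X k \<omega>)"
  let ?I = "\<lambda>r::real. 1 / (2 * of_real pi) * integral {0..2 * pi} (\<lambda>t.
       exp (of_real (sqrt \<theta>) * gauss_series X \<omega> (of_real r * cis t)) *
       cnj (harmonic_extension (tpoly N a) (of_real r * cis t)))"
  let ?S = "\<lambda>r::real. \<Sum>n = - int N..int N. cnj (a n) * of_real r ^ nat \<bar>n\<bar> *
      (if n \<ge> 0 then ?c (nat n) * of_real r ^ nat n else 0)"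
  have "eventually (\<lambda>r::real. r \<in> {0<..<1}) (at_left 1)"
    by (rule eventually_at_leftI[of 0]) auto
  then have "eventually (\<lambda>r. ?S r = ?I r) (at_left 1)"
  proof eventually_elim
    case (elim r)
    have "?I r = 1 / (2 * of_real pi) * (\<Sum>n = - int N..int N. cnj (a n) * of_real r ^ nat \<bar>n\<bar> *
      (if n \<ge> 0 then 2 * of_real pi * ?c (nat n) * of_real r ^ nat n else 0))"
      using chaos_tpoly_integral[OF assms, of r "sqrt \<theta>" N a] elim
      unfolding chaos_def gauss_series_gser by simp
    also have "\<dots> = ?S r"
      unfolding sum_distrib_left by (rule sum.cong) auto
    finally show ?case by simp
  qed
  moreover have "(?S \<longlongrightarrow> (\<Sum>n = - int N..int N. cnj (a n) * of_real 1 ^ nat \<bar>n\<bar> *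
      (if n \<ge> 0 then ?c (nat n) * of_real 1 ^ nat n else 0))) (at_left 1)"
  proof (rule tendsto_sum)
    fix n
    have "((\<lambda>r. cnj (a n) * of_real r ^ nat \<bar>n\<bar> * (?c (nat n) * of_real r ^ nat n)) \<longlongrightarrow>
        cnj (a n) * of_real 1 ^ nat \<bar>n\<bar> * (?c (nat n) * of_real 1 ^ nat n)) (at_left 1)"
      by (intro tendsto_intros)
    then show "((\<lambda>r. cnj (a n) * of_real r ^ nat \<bar>n\<bar> * (if n \<ge> 0 then ?c (nat n) * of_real r ^ nat n else 0)) \<longlongrightarrow>
        cnj (a n) * of_real 1 ^ nat \<bar>n\<bar> * (if n \<ge> 0 then ?c (nat n) * of_real 1 ^ nat n else 0)) (at_left 1)"
      by (cases "n \<ge> 0") simp_all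
  qed
  ultimately have "(?I \<longlongrightarrow> (\<Sum>n = - int N..int N. cnj (a n) * of_real 1 ^ nat \<bar>n\<bar> *
      (if n \<ge> 0 then ?c (nat n) * of_real 1 ^ nat n else 0))) (at_left 1)"
    by (rule Lim_transform_eventually[rotated])
  then have "HMC \<theta> X \<omega> (tpoly N a) = (\<Sum>n = - int N..int N. cnj (a n) * of_real 1 ^ nat \<bar>n\<bar> *
      (if n \<ge> 0 then ?c (nat n) * of_real 1 ^ nat n else 0))"
    unfolding HMC_def by (intro tendsto_Lim) auto
  also have "\<dots> = (\<Sum>n\<in>int ` {..N}. cnj (a n) * ?c (nat n))"
  proof (rule sum.mono_neutral_cong_right)
    show "int ` {..N} \<subseteq> {- int N..int N}"
      by auto
    show "\<forall>n\<in>{- int N..int N} - int ` {..N}. cnj (a n) * of_real 1 ^ nat \<bar>n\<bar> *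
      (if n \<ge> 0 then ?c (nat n) * of_real 1 ^ nat n else 0) = 0"
    proof
      fix n
      assume "n \<in> {- int N..int N} - int ` {..N}"
      then have "\<not> n \<ge> 0"
        using image_iff[of n int "{..N}"] by (auto dest: bspec[of _ _ "nat n"])
      then show "cnj (a n) * of_real 1 ^ nat \<bar>n\<bar> *
        (if n \<ge> 0 then ?c (nat n) * of_real 1 ^ nat n else 0) = 0"
        by simp
    qed
  qed auto
  also have "\<dots> = (\<Sum>n\<le>N. cnj (a (int n)) * ?c n)"
    by (subst sum.reindex) auto
  finally show ?thesis .
qed

lemma dist_fourier_coeff_HMC:
  assumes "tame (\<lambda>k. X k \<omega>)"
  shows "dist_fourier_coeff (HMC \<theta> X \<omega>) m =
    (if m \<ge> 0 then coef (sqrt \<theta>) (\<lambda>k. X k \<omega>) (nat m) else 0)"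
proof -
  let ?c = "coef (sqrt \<theta>) (\<lambda>k. X k \<omega>)"
  let ?a = "\<lambda>n. if n = m then 1 else 0 :: complex"
  have eq: "(\<lambda>t. cis (of_int m * t)) = tpoly (nat \<bar>m\<bar>) ?a"
  proof
    fix t
    have "tpoly (nat \<bar>m\<bar>) ?a t =
        (\<Sum>n = - int (nat \<bar>m\<bar>)..int (nat \<bar>m\<bar>). if n = m then cis (of_int n * t) else 0)"
      unfolding tpoly_def by (rule sum.cong) auto
    then show "cis (of_int m * t) = tpoly (nat \<bar>m\<bar>) ?a t"
      unfolding sum.delta[OF finite_atLeastAtMost_int] by auto
  qed
  have "dist_fourier_coeff (HMC \<theta> X \<omega>) m = (\<Sum>n\<le>nat \<bar>m\<bar>. cnj (?a (int n)) * ?c n)"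
    unfolding dist_fourier_coeff_def eq by (rule HMC_tpoly) fact
  also have "\<dots> = (\<Sum>n\<le>nat \<bar>m\<bar>. if n = nat m then (if m \<ge> 0 then ?c n else 0) else 0)"
    by (rule sum.cong) auto
  also have "\<dots> = (if m \<ge> 0 then ?c (nat m) else 0)"
    by (auto simp: sum.delta)
  finally show ?thesis .
qed

lemma angular_deriv_tpoly:
  "angular_deriv j (tpoly N a) = tpoly N (\<lambda>n. (\<i> * of_int n) ^ j * a n)"
proof (induction j)
  case (Suc j)
  have "vector_derivative (tpoly N b) (at t) = tpoly N (\<lambda>n. \<i> * of_int n * b n) t" for b t
  proof (rule vector_derivative_at)
    have "((\<lambda>t. b n * cis (of_int n * t)) has_vector_derivative \<i> * of_int n * b n * cis (of_int n * t)) (at t)" for n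
    proof -
      have "((\<lambda>z. b n * exp (\<i> * of_int n * z)) has_field_derivative
          b n * (\<i> * of_int n * exp (\<i> * of_int n * of_real t))) (at (of_real t))"
        by (auto intro!: derivative_eq_intros)
      from has_vector_derivative_real_field[OF this] show ?thesis
        by (simp add: cis_conv_exp mult_ac)
    qed
    then show "(tpoly N b has_vector_derivative tpoly N (\<lambda>n. \<i> * of_int n * b n) t) (at t)"
      unfolding tpoly_def[abs_def] by (rule has_vector_derivative_sum)
  qed
  moreover have "angular_deriv (Suc j) (tpoly N a) = (\<lambda>t. vector_derivative (angular_deriv j (tpoly N a)) (at t))"
    by (simp add: angular_deriv_def)
  ultimately have "angular_deriv (Suc j) (tpoly N a) = tpoly N (\<lambda>n. \<i> * of_int n * ((\<i> * of_int n) ^ j * a n))"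
    unfolding Suc.IH by (simp add: fun_eq_iff)
  then show ?case
    by (simp add: mult_ac)
qed (simp add: angular_deriv_def)

lemma bdd_above_cmod_tpoly: "bdd_above ((\<lambda>t. cmod (tpoly N a t)) ` {u..v})"
  by (intro bounded_imp_bdd_above compact_imp_bounded compact_continuous_image
      continuous_on_norm continuous_on_tpoly) auto

lemma cmod_fourier_coeff_tpoly_le:
  "cmod (fourier_coeff (tpoly N a) n) \<le> (SUP t\<in>{0..2 * pi}. cmod (tpoly N a t))"
proof -
  let ?S = "SUP t\<in>{0..2 * pi}. cmod (tpoly N a t)"
  have "cmod (integral {0..2 * pi} (\<lambda>t. tpoly N a t * cis (- (of_int n * t)))) \<le> ?S * (2 * pi - 0)"
  proof (rule integral_bound)
    show "continuous_on {0..2 * pi} (\<lambda>t. tpoly N a t * cis (- (of_int n * t)))"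
      by (intro continuous_intros continuous_on_tpoly)
    show "cmod (tpoly N a t * cis (- (of_int n * t))) \<le> ?S" if "t \<in> {0..2 * pi}" for t
      using cSUP_upper[OF that bdd_above_cmod_tpoly] by (simp add: norm_mult)
  qed auto
  then show ?thesis
    by (simp add: fourier_coeff_def norm_mult norm_divide divide_simps mult_ac)
qed

lemma tpoly_extend:
  assumes "N \<le> M"
  shows "tpoly N a = tpoly M (\<lambda>n. if \<bar>n\<bar> \<le> int N then a n else 0)"
  unfolding tpoly_def[abs_def]
  by (intro ext sum.mono_neutral_cong_left) (use assms in auto)

lemma one_plus_power_le: "(1 + x) ^ m \<le> 2 ^ m * (1 + x ^ m)" if "x \<ge> 0" for x :: real
proof (cases "x \<le> 1")
  case True
  then have "(1 + x) ^ m \<le> 2 ^ m * 1"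
    using that by (simp add: power_mono)
  also have "\<dots> \<le> 2 ^ m * (1 + x ^ m)"
    using that by (intro mult_left_mono) auto
  finally show ?thesis .
next
  case False
  then have "(1 + x) ^ m \<le> (2 * x) ^ m"
    using that by (intro power_mono) auto
  also have "\<dots> \<le> 2 ^ m * (1 + x ^ m)"
    by (simp add: power_mult_distrib)
  finally show ?thesis .
qed

text \<open>Control of \<open>p + 2\<close> derivatives of the test function makes its Fourier
  coefficients decay like \<open>1 / (1 + n) ^ (p + 2)\<close>. This absorbs the growth
  \<open>(1 + n) ^ p\<close> and leaves the summable \<open>1 / (1 + n)^2\<close>.\<close>

lemma circle_distribution_HMC:
  assumes x: "tame (\<lambda>k. X k \<omega>)"
    and c: "\<And>n. cmod (coef (sqrt \<theta>) (\<lambda>k. X k \<omega>) n) \<le> C * (1 + real n) ^ p"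
  shows "circle_distribution (HMC \<theta> X \<omega>)"
  unfolding circle_distribution_def
proof (intro conjI ballI allI exI)
  let ?c = "coef (sqrt \<theta>) (\<lambda>k. X k \<omega>)"
  note HMC = HMC_tpoly[where X = X and \<omega> = \<omega> and \<theta> = \<theta>, OF x]
  fix \<phi> \<psi> a b
  assume "\<phi> \<in> trig_polys" "\<psi> \<in> trig_polys"
  then obtain N u N' v where "\<phi> = tpoly N u" "\<psi> = tpoly N' v"
    by (metis trig_polys_tpoly)
  then obtain M u' v' where eq: "\<phi> = tpoly M u'" "\<psi> = tpoly M v'"
    using tpoly_extend[of N "max N N'"] tpoly_extend[of N' "max N N'"] by (metis max.cobounded1 max.cobounded2)
  have "(\<lambda>t. a * \<phi> t + b * \<psi> t) = tpoly M (\<lambda>n. a * u' n + b * v' n)"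
    by (simp add: eq tpoly_def fun_eq_iff sum_distrib_left sum.distrib algebra_simps)
  then show "HMC \<theta> X \<omega> (\<lambda>t. a * \<phi> t + b * \<psi> t) = cnj a * HMC \<theta> X \<omega> \<phi> + cnj b * HMC \<theta> X \<omega> \<psi>"
    unfolding eq HMC by (simp add: HMC sum_distrib_left sum.distrib algebra_simps)
next
  let ?c = "coef (sqrt \<theta>) (\<lambda>k. X k \<omega>)"
  let ?m = "p + 2"
  let ?D = "2 ^ ?m * C * (\<Sum>n. 1 / (1 + real n)\<^sup>2)"
  fix \<phi>
  assume "\<phi> \<in> trig_polys"
  then obtain N a where \<phi>: "\<phi> = tpoly N a"
    by (metis trig_polys_tpoly)
  let ?sup = "\<lambda>j. SUP t\<in>{0..2 * pi}. cmod (angular_deriv j \<phi> t)"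
  let ?S = "\<Sum>j\<le>?m. ?sup j"
  have C0: "C \<ge> 0"
    using c[of 0] by (simp add: order_trans[OF norm_ge_zero])
  have sup: "cmod ((\<i> * of_int n) ^ j * a n) \<le> ?sup j" if "\<bar>n\<bar> \<le> int N" for n j
    using cmod_fourier_coeff_tpoly_le[of N "\<lambda>n. (\<i> * of_int n) ^ j * a n" n] that
    by (simp add: \<phi> angular_deriv_tpoly fourier_coeff_tpoly)
  have sup0: "0 \<le> ?sup j" for j
    using sup[of 0 j] by (simp add: order_trans[OF norm_ge_zero])
  \<comment> \<open>The orders \<open>0\<close> and \<open>?m\<close> already control
    \<open>1 + n ^ ?m\<close>; the other terms of the norm are nonnegative.\<close>
  have a: "cmod (a (int n)) * (1 + real n ^ ?m) \<le> ?S" if "n \<le> N" for n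
  proof -
    have "cmod (a (int n)) * (1 + real n ^ ?m) \<le> ?sup 0 + ?sup ?m"
      using sup[of "int n" 0] sup[of "int n" ?m] that
      by (simp add: norm_mult norm_power distrib_left mult_ac)
    also have "\<dots> = (\<Sum>j\<in>{0, ?m}. ?sup j)"
      by simp
    also have "\<dots> \<le> ?S"
      by (rule sum_mono2) (auto intro: sup0)
    finally show ?thesis .
  qed
  have S0: "0 \<le> ?S"
    by (intro sum_nonneg sup0)
  have summand: "cmod (cnj (a (int n)) * ?c n) \<le> ?S * (2 ^ ?m * C) * (1 / (1 + real n)\<^sup>2)" if "n \<le> N" for n
  proof -
    have "cmod (cnj (a (int n)) * ?c n) * (1 + real n)\<^sup>2 \<le> cmod (a (int n)) * (C * (1 + real n) ^ p) * (1 + real n)\<^sup>2"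
      using c[of n] by (simp add: norm_mult mult_left_mono mult_right_mono)
    also have "\<dots> = cmod (a (int n)) * C * (1 + real n) ^ ?m"
      by (simp add: power_add power2_eq_square mult_ac)
    also have "\<dots> \<le> cmod (a (int n)) * C * (2 ^ ?m * (1 + real n ^ ?m))"
      using C0 by (intro mult_left_mono one_plus_power_le) auto
    also have "\<dots> = (cmod (a (int n)) * (1 + real n ^ ?m)) * (2 ^ ?m * C)"
      by (simp only: mult_ac)
    also have "\<dots> \<le> ?S * (2 ^ ?m * C)"
      using C0 by (intro mult_right_mono a that) auto
    finally show ?thesis
      by (simp add: divide_simps)
  qed
  have sm: "summable (\<lambda>n. 1 / (1 + real n)\<^sup>2)"
    using inverse_power_summable[of 2, where 'a = real] summable_Suc_iff[of "\<lambda>n. inverse ((real n)\<^sup>2)"]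
    by (simp add: divide_inverse add.commute)
  have "cmod (HMC \<theta> X \<omega> \<phi>) \<le> (\<Sum>n\<le>N. cmod (cnj (a (int n)) * ?c n))"
    unfolding \<phi> HMC_tpoly[where X = X and \<omega> = \<omega>, OF x] by (rule norm_sum)
  also have "\<dots> \<le> (\<Sum>n\<le>N. ?S * (2 ^ ?m * C) * (1 / (1 + real n)\<^sup>2))"
    by (intro sum_mono summand) auto
  also have "\<dots> \<le> ?S * (2 ^ ?m * C) * (\<Sum>n. 1 / (1 + real n)\<^sup>2)"
    unfolding sum_distrib_left[symmetric] using S0 C0
    by (intro mult_left_mono sum_le_suminf sm) auto
  finally show "cmod (HMC \<theta> X \<omega> \<phi>) \<le> ?D * ?S"
    by (simp only: mult_ac)
qed

lemma HMC_sobolev_summand_iff: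
  assumes x: "tame (\<lambda>k. X k \<omega>)"
  shows "(\<lambda>n::int. (1 + (of_int n)\<^sup>2) powr s * (cmod (dist_fourier_coeff (HMC \<theta> X \<omega>) n))\<^sup>2) summable_on UNIV
    \<longleftrightarrow> summable (\<lambda>n. (1 + (real n)\<^sup>2) powr s * (cmod (coef (sqrt \<theta>) (\<lambda>k. X k \<omega>) n))\<^sup>2)"
proof -
  let ?f = "\<lambda>n::int. (1 + (of_int n)\<^sup>2) powr s * (cmod (dist_fourier_coeff (HMC \<theta> X \<omega>) n))\<^sup>2"
  have "?f summable_on UNIV \<longleftrightarrow> ?f summable_on range int"
  proof (rule summable_on_cong_neutral)
    fix n :: int
    assume "n \<in> UNIV - range int"
    then have "\<not> n \<ge> 0"
      by (metis DiffD2 nonneg_int_cases rangeI)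
    then show "?f n = 0"
      using dist_fourier_coeff_HMC[where \<theta> = \<theta> and X = X and \<omega> = \<omega>, OF x] by simp
  qed auto
  also have "\<dots> \<longleftrightarrow> (?f \<circ> int) summable_on UNIV"
    by (rule summable_on_reindex) auto
  also have "?f \<circ> int = (\<lambda>n. (1 + (real n)\<^sup>2) powr s * (cmod (coef (sqrt \<theta>) (\<lambda>k. X k \<omega>) n))\<^sup>2)"
    using dist_fourier_coeff_HMC[where \<theta> = \<theta> and X = X and \<omega> = \<omega>, OF x] by (simp add: fun_eq_iff)
  also have "\<dots> summable_on UNIV \<longleftrightarrow> summable (\<lambda>n. (1 + (real n)\<^sup>2) powr s * (cmod (coef (sqrt \<theta>) (\<lambda>k. X k \<omega>) n))\<^sup>2)"
    by (rule summable_on_UNIV_nonneg_real_iff) auto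
  finally show ?thesis .
qed

text \<open>Membership also asks for \<open>circle_distribution\<close>. Summability supplies it:
  each term is at most the sum, so the coefficients grow at most polynomially.\<close>

lemma HMC_in_sobolev_iff:
  assumes x: "tame (\<lambda>k. X k \<omega>)"
  shows "HMC \<theta> X \<omega> \<in> sobolev s \<longleftrightarrow>
    summable (\<lambda>n. (1 + (real n)\<^sup>2) powr s * (cmod (coef (sqrt \<theta>) (\<lambda>k. X k \<omega>) n))\<^sup>2)"
    (is "_ \<longleftrightarrow> summable ?t")
proof -
  have "circle_distribution (HMC \<theta> X \<omega>)" if sm: "summable ?t"
  proof -
    let ?c = "coef (sqrt \<theta>) (\<lambda>k. X k \<omega>)"
    obtain p :: nat where p: "- s \<le> real p"
      using real_arch_simple by blast
    have "cmod (?c n) \<le> sqrt (suminf ?t) * (1 + real n) ^ p" for n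
    proof -
      have b: "1 \<le> 1 + (real n)\<^sup>2" "1 + (real n)\<^sup>2 \<le> (1 + real n)\<^sup>2"
        by (auto simp: power2_eq_square algebra_simps)
      have "?t n \<le> suminf ?t"
        using sum_le_suminf[OF sm, of "{n}"] by simp
      then have "(1 + (real n)\<^sup>2) powr (- s) * ?t n \<le> (1 + (real n)\<^sup>2) powr (- s) * suminf ?t"
        by (rule mult_left_mono) simp
      also have "(1 + (real n)\<^sup>2) powr (- s) * ?t n = (cmod (?c n))\<^sup>2"
        proof -
        have "1 + (real n)\<^sup>2 \<noteq> 0"
          using b(1) by linarith
        then show ?thesis
          by (simp add: mult.assoc[symmetric] powr_add[symmetric])
      qed
      also have "(1 + (real n)\<^sup>2) powr (- s) * suminf ?t \<le> (1 + real n) ^ (2 * p) * suminf ?t"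
      proof (rule mult_right_mono)
        have "(1 + (real n)\<^sup>2) powr (- s) \<le> (1 + (real n)\<^sup>2) powr (real p)"
          by (intro powr_mono p b)
        also have "\<dots> = (1 + (real n)\<^sup>2) ^ p"
          by (rule powr_realpow) (use b in linarith)
        also have "\<dots> \<le> ((1 + real n)\<^sup>2) ^ p"
          by (intro power_mono b) auto
        finally show "(1 + (real n)\<^sup>2) powr (- s) \<le> (1 + real n) ^ (2 * p)"
          by (simp add: power_mult)
      qed (auto intro!: suminf_nonneg sm)
      also have "\<dots> = (sqrt (suminf ?t) * (1 + real n) ^ p)\<^sup>2"
        using suminf_nonneg[OF sm] by (simp add: power_mult_distrib power_mult[symmetric] mult_ac)
      finally show ?thesis
        by (rule power2_le_imp_le) (simp add: suminf_nonneg sm)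
    qed
    then show ?thesis
      by (rule circle_distribution_HMC[where X = X and \<omega> = \<omega>, OF x])
  qed
  then show ?thesis
    using HMC_sobolev_summand_iff[where X = X and \<omega> = \<omega>, OF x] by (auto simp: sobolev_def)
qed

section \<open>Growth of the mean square on circles\<close>

definition rad :: "nat \<Rightarrow> real" where
  "rad j = sqrt (1 - 1 / 2 ^ j)"

text \<open>As \<open>1 - (rad j)^2 = 1 / 2 ^ j\<close>, the bound reads
  \<open>C * (1 - r^2) powr (- b)\<close> at \<open>r = rad j\<close>. Countably many radii keep the
  property measurable and open to Borel-Cantelli.\<close>

definition growth :: "real \<Rightarrow> real \<Rightarrow> (nat \<Rightarrow> complex) \<Rightarrow> bool" where
  "growth g b x \<longleftrightarrow> (\<exists>C. \<forall>j. energy g x (rad j) \<le> C * 2 powr (b * real j))"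

lemma rad_nonneg [simp]: "0 \<le> rad j" and rad_less_1 [simp]: "rad j < 1"
  and rad_power2: "(rad j)\<^sup>2 = 1 - 1 / 2 ^ j"
  by (auto simp: rad_def)

lemma energy_nonneg: "energy g x r \<ge> 0"
proof -
  have "0 \<le> integral {0..2 * pi} (\<lambda>t. (cmod (chaos g x (of_real r * cis t)))\<^sup>2)"
    by (cases "(\<lambda>t. (cmod (chaos g x (of_real r * cis t)))\<^sup>2) integrable_on {0..2 * pi}")
       (auto intro: Henstock_Kurzweil_Integration.integral_nonneg simp: not_integrable_integral)
  then show ?thesis
    by (simp add: energy_def)
qed

lemma energy_rad_sums:
  assumes "tame x"
  shows "(\<lambda>n. (cmod (coef g x n))\<^sup>2 * (1 - 1 / 2 ^ j) ^ n) sums energy g x (rad j)"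
  using energy_sums[OF assms, of "rad j" g] by (simp add: power_mult rad_power2)

lemma powr_le_exp: "y powr b \<le> b powr b * exp y" if "y > 0" "b > 0" for y b :: real
proof -
  have "y / b \<le> exp (y / b)"
    using exp_ge_add_one_self[of "y / b"] by linarith
  then have "(y / b) powr b \<le> exp (y / b) powr b"
    using that by (intro powr_mono2) auto
  also have "\<dots> = exp y"
    using that by (simp add: exp_powr_real)
  finally show ?thesis
    using that by (simp add: powr_divide divide_simps mult_ac)
qed

text \<open>With \<open>\<delta> = 1 / 2 ^ j\<close>, the damping \<open>(1 - \<delta>) ^ n\<close>
  is at most a constant times \<open>exp (- \<delta> * (1 + n))\<close>, hence at most a constant
  times \<open>(\<delta> * (1 + n)) powr (2 * s)\<close>. The energy is thus dominated term by term
  by the Sobolev sum times \<open>\<delta> powr (2 * s)\<close>.\<close>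

lemma growth_of_summable:
  assumes x: "tame x" and s: "s < 0"
    and sm: "summable (\<lambda>n. (1 + (real n)\<^sup>2) powr s * (cmod (coef g x n))\<^sup>2)" (is "summable ?t")
  shows "growth g (- 2 * s) x"
  unfolding growth_def
proof (intro exI allI)
  fix j :: nat
  let ?b = "- 2 * s"
  let ?K = "?b powr ?b * exp 1"
  let ?\<delta> = "1 / 2 ^ j :: real"
  have le: "(cmod (coef g x n))\<^sup>2 * (1 - ?\<delta>) ^ n \<le> ?K * 2 powr (?b * real j) * ?t n" for n
  proof -
    have "(1 - ?\<delta>) ^ n \<le> exp (- ?\<delta>) ^ n"
      using exp_ge_add_one_self[of "- ?\<delta>"] by (intro power_mono) auto
    also have "\<dots> = exp (?\<delta> - ?\<delta> * (1 + real n))"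
      by (simp add: exp_of_nat_mult[symmetric] algebra_simps add_divide_distrib)
    also have "\<dots> \<le> exp (1 - ?\<delta> * (1 + real n))"
      by simp
    finally have 1: "(1 - ?\<delta>) ^ n \<le> exp 1 * exp (- (?\<delta> * (1 + real n)))"
      by (simp add: exp_add[symmetric])
    have "1 + (real n)\<^sup>2 \<le> (1 + real n)\<^sup>2"
      by (simp add: power2_eq_square algebra_simps)
    then have "((1 + real n)\<^sup>2) powr s \<le> (1 + (real n)\<^sup>2) powr s"
      using s by (intro powr_mono2') (auto intro: add_pos_nonneg)
    moreover have "((1 + real n)\<^sup>2) powr s = (1 + real n) powr (- ?b)"
      using powr_powr[of "1 + real n" 2 s] by simp
    ultimately have 2: "(1 + real n) powr (- ?b) \<le> (1 + (real n)\<^sup>2) powr s"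
      by simp
    have "(?\<delta> * (1 + real n)) powr ?b \<le> ?b powr ?b * exp (?\<delta> * (1 + real n))"
      using s by (intro powr_le_exp) auto
    then have "exp (- (?\<delta> * (1 + real n))) * (?\<delta> * (1 + real n)) powr ?b \<le> ?b powr ?b"
      by (simp add: exp_minus field_simps)
    then have "exp (- (?\<delta> * (1 + real n))) * (?\<delta> powr ?b * (1 + real n) powr ?b) \<le> ?b powr ?b"
      by (subst (asm) powr_mult) auto
    moreover have "?\<delta> powr ?b = inverse (2 powr (?b * real j))"
      by (simp add: powr_divide powr_realpow[symmetric] powr_powr mult_ac inverse_eq_divide)
    moreover have "e \<le> B * P * inverse N" if "e * (inverse P * N) \<le> B" "P > 0" "N > 0" for e B P N :: real
      using that by (simp add: field_simps)
    ultimately have 3: "exp (- (?\<delta> * (1 + real n))) \<le> ?b powr ?b * 2 powr (?b * real j) * (1 + real n) powr (- ?b)"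
      unfolding powr_minus[of "1 + real n" ?b] by (simp only:) auto
    have "(1 - ?\<delta>) ^ n \<le> exp 1 * (?b powr ?b * 2 powr (?b * real j) * (1 + real n) powr (- ?b))"
      by (rule order_trans[OF 1 mult_left_mono[OF 3]]) simp
    also have "\<dots> \<le> exp 1 * (?b powr ?b * 2 powr (?b * real j) * (1 + (real n)\<^sup>2) powr s)"
      by (intro mult_left_mono 2) auto
    finally have "(cmod (coef g x n))\<^sup>2 * (1 - ?\<delta>) ^ n \<le>
        (cmod (coef g x n))\<^sup>2 * (exp 1 * (?b powr ?b * 2 powr (?b * real j) * (1 + (real n)\<^sup>2) powr s))"
      by (rule mult_left_mono) simp
    then show ?thesis
      by (simp only: mult_ac)
  qed
  have "energy g x (rad j) \<le> (\<Sum>n. ?K * 2 powr (?b * real j) * ?t n)"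
    using energy_rad_sums[OF x, of g j] le by (intro sums_le[OF _ _ summable_sums] summable_mult sm) auto
  also have "\<dots> = ?K * 2 powr (?b * real j) * suminf ?t"
    by (intro suminf_mult sm)
  finally show "energy g x (rad j) \<le> (?K * suminf ?t) * 2 powr (?b * real j)"
    by (simp only: mult_ac)
qed

text \<open>Bernoulli's inequality at exponent \<open>2 ^ j\<close> gives only \<open>0\<close>; at
  \<open>2 ^ (j - 1)\<close> it gives \<open>1 / 2\<close>, and squaring gives
  \<open>1 / 4\<close>.\<close>

lemma one_minus_inverse_power_ge:
  assumes "j \<ge> 1" "n \<le> 2 ^ j"
  shows "1 / 4 \<le> (1 - 1 / 2 ^ j :: real) ^ n"
proof -
  obtain i where j: "j = Suc i"
    using assms by (cases j) auto
  have "1 + real (2 ^ i) * (- (1 / 2 ^ j)) \<le> (1 + - (1 / 2 ^ j) :: real) ^ (2 ^ i)"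
    by (rule Bernoulli_inequality) simp
  then have "1 / 2 \<le> (1 - 1 / 2 ^ j :: real) ^ (2 ^ i)"
    by (simp add: j)
  then have "(1 / 2)\<^sup>2 \<le> ((1 - 1 / 2 ^ j :: real) ^ (2 ^ i))\<^sup>2"
    by (rule power_mono) simp
  then have "1 / 4 \<le> (1 - 1 / 2 ^ j :: real) ^ (2 ^ j)"
    by (simp add: j power_mult[symmetric] mult.commute power_divide)
  also have "\<dots> \<le> (1 - 1 / 2 ^ j) ^ n"
    using assms by (intro power_decreasing) auto
  finally show ?thesis .
qed

text \<open>Each \<open>n\<close> is charged to a scale \<open>j\<close> with \<open>2 ^ j\<close>
  comparable to \<open>n\<close>, where the damping in the energy is harmless. The energies at
  different scales then add up geometrically, which is where the strict inequality between
  \<open>b\<close> and \<open>- 2 * s\<close> enters.\<close>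

lemma summable_of_growth:
  assumes x: "tame x" and gr: "growth g b x" and b: "b < - 2 * s" and s: "s < 0"
  shows "summable (\<lambda>n. (1 + (real n)\<^sup>2) powr s * (cmod (coef g x n))\<^sup>2)" (is "summable ?t")
proof -
  obtain C where C: "\<And>j. energy g x (rad j) \<le> C * 2 powr (b * real j)"
    using gr by (auto simp: growth_def)
  have C0: "C \<ge> 0"
    using order_trans[OF energy_nonneg C, of 0] by simp
  let ?c = "\<lambda>n. (cmod (coef g x n))\<^sup>2"
  \<comment> \<open>The \<open>4\<close> undoes the damping, bounded below by \<open>1 / 4\<close>;
    the other factor comes from \<open>2 powr (2 * j - 3) \<le> 1 + n^2\<close>.\<close>
  let ?K = "4 * 2 powr (- 3 * s)"
  define q :: real where "q = 2 powr (2 * s + b)"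
  have q: "0 < q" "q < 1"
    using b by (auto simp: q_def intro!: powr_less_one)
  have "\<exists>j. 1 \<le> j \<and> (1 + (real n)\<^sup>2) powr s \<le> ?K * (2 powr (2 * s * real j) * (1 - 1 / 2 ^ j) ^ n)" for n
  proof -
    obtain i where i: "2 ^ i \<le> n + 1" "n + 1 < 2 ^ (i + 1)"
      using ex_power_ivl1[of 2 "n + 1"] by auto
    define j where "j = i + 1"
    have "(1 + (real n)\<^sup>2) powr s \<le> (2 powr (2 * real j - 3)) powr s"
    proof (rule powr_mono2')
      have "2 powr (2 * real j - 3) = (2 ^ i)\<^sup>2 / (2::real)"
        by (simp add: j_def powr_diff powr_add powr_realpow[symmetric] powr_powr field_simps)
      also have "\<dots> \<le> (real (n + 1))\<^sup>2 / 2"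
        using i(1) by (intro divide_right_mono power_mono) (auto dest: of_nat_mono[where 'a = real])
      also have "\<dots> \<le> 1 + (real n)\<^sup>2"
        using zero_le_power2[of "real n - 1"] by (simp add: power2_eq_square algebra_simps)
      finally show "2 powr (2 * real j - 3) \<le> 1 + (real n)\<^sup>2" .
    qed (use s in auto)
    also have "\<dots> = 2 powr (- 3 * s) * 2 powr (2 * s * real j)"
      by (simp add: powr_powr powr_add[symmetric] algebra_simps)
    also have "\<dots> \<le> 2 powr (- 3 * s) * 2 powr (2 * s * real j) * (4 * (1 - 1 / 2 ^ j) ^ n)"
    proof -
      have "1 \<le> 4 * (1 - 1 / 2 ^ j :: real) ^ n"
        using one_minus_inverse_power_ge[of j n] i(2) by (simp add: j_def)
      then show ?thesis
        using mult_left_mono[of 1 _ "2 powr (- 3 * s) * 2 powr (2 * s * real j)"] by simp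
    qed
    finally show ?thesis
      by (intro exI[of _ j]) (simp add: j_def mult_ac)
  qed
  then obtain j where j: "\<And>n. (1 + (real n)\<^sup>2) powr s \<le> ?K * (2 powr (2 * s * real (j n)) * (1 - 1 / 2 ^ j n) ^ n)"
    by metis
  show ?thesis
  proof (rule bounded_imp_summable)
    show "?t n \<ge> 0" for n
      by simp
    fix N
    \<comment> \<open>Many \<open>n\<close> share a scale. Summing over the image counts each scale
      once, so one energy bound serves all its \<open>n\<close> together.\<close>
    let ?A = "j ` {..N}"
    let ?f = "\<lambda>i n. 2 powr (2 * s * real i) * (1 - 1 / 2 ^ i) ^ n"
    have f0: "?f i n \<ge> 0" for i n
      by simp
    have "(\<Sum>n\<le>N. ?t n) \<le> (\<Sum>n\<le>N. ?K * (\<Sum>i\<in>?A. ?f i n) * ?c n)"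
    proof (intro sum_mono mult_right_mono)
      fix n
      assume "n \<in> {..N}"
      then have "?f (j n) n \<le> (\<Sum>i\<in>?A. ?f i n)"
        by (intro member_le_sum f0) auto
      then show "(1 + (real n)\<^sup>2) powr s \<le> ?K * (\<Sum>i\<in>?A. ?f i n)"
        using order_trans[OF j[of n] mult_left_mono] by auto
    qed simp
    also have "\<dots> = (\<Sum>n\<le>N. \<Sum>i\<in>?A. ?K * 2 powr (2 * s * real i) * (?c n * (1 - 1 / 2 ^ i) ^ n))"
      by (simp only: sum_distrib_left sum_distrib_right mult_ac)
    also have "\<dots> = (\<Sum>i\<in>?A. ?K * 2 powr (2 * s * real i) * (\<Sum>n\<le>N. ?c n * (1 - 1 / 2 ^ i) ^ n))"
      by (subst sum.swap) (simp only: sum_distrib_left)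
    also have "\<dots> \<le> (\<Sum>i\<in>?A. ?K * 2 powr (2 * s * real i) * (C * 2 powr (b * real i)))"
    proof (intro sum_mono mult_left_mono)
      fix i
      have "(\<Sum>n\<le>N. ?c n * (1 - 1 / 2 ^ i) ^ n) \<le> energy g x (rad i)"
        using energy_rad_sums[OF x, of g i] unfolding sums_iff
        by (metis (no_types, lifting) finite_atMost sum_le_suminf diff_ge_0_iff_ge divide_le_eq_1_pos
            mult_nonneg_nonneg one_le_numeral one_le_power zero_le_power zero_le_power2 zero_less_numeral zero_less_power)
      also have "\<dots> \<le> C * 2 powr (b * real i)"
        by (rule C)
      finally show "(\<Sum>n\<le>N. ?c n * (1 - 1 / 2 ^ i) ^ n) \<le> C * 2 powr (b * real i)" .
    qed auto
    also have "\<dots> = ?K * C * (\<Sum>i\<in>?A. q ^ i)"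
      unfolding sum_distrib_left
      by (rule sum.cong) (simp_all add: q_def powr_realpow[symmetric] powr_powr powr_add[symmetric] algebra_simps)
    also have "\<dots> \<le> ?K * C * (\<Sum>i. q ^ i)"
      using q C0 by (intro mult_left_mono sum_le_suminf summable_geometric) auto
    finally show "(\<Sum>n\<le>N. ?t n) \<le> ?K * C * (\<Sum>i. q ^ i)" .
  qed
qed

text \<open>Cauchy-Schwarz between two neighbouring circles: the coefficients are measured by the
  energy on the larger one, and the ratio of the radii leaves a geometric series of size
  \<open>2 ^ Suc j\<close>. That series is the \<open>+ 1\<close> in \<open>b + 1\<close>; the
  halving is the square root.\<close>

lemma cmod_chaos_bound:
  assumes x: "tame x" and gr: "growth g b x"
  obtains C where "C > 0" "\<And>j t. cmod (chaos g x (of_real (rad j) * cis t)) \<le> C * 2 powr (real j * (b + 1) / 2)"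
proof -
  obtain C where C: "\<And>j. energy g x (rad j) \<le> C * 2 powr (b * real j)"
    using gr by (auto simp: growth_def)
  have C0: "C \<ge> 0"
    using order_trans[OF energy_nonneg C, of 0] by simp
  \<comment> \<open>\<open>C\<close> may be \<open>0\<close>, whereas a positive constant is
    promised; hence \<open>C + 1\<close>.\<close>
  define D where "D = (C + 1) * 2 powr (b + 1)"
  have D: "D > 0"
    using C0 by (simp add: D_def)
  have "cmod (chaos g x (of_real (rad j) * cis t)) \<le> sqrt D * 2 powr (real j * (b + 1) / 2)" for j t
  proof -
    let ?z = "of_real (rad j) * cis t"
    \<comment> \<open>\<open>p\<close> and \<open>q\<close> are the squared radii of the circles
      \<open>Suc j\<close> and \<open>j\<close>. Their gap is \<open>1 / 2 ^ Suc j\<close>, so the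
      series in \<open>q / p\<close> sums to \<open>p * 2 ^ Suc j\<close>.\<close>
    define p where "p = (1 - 1 / 2 ^ Suc j :: real)"
    define q where "q = (1 - 1 / 2 ^ j :: real)"
    have pq: "0 < p" "0 \<le> q" "q < p"
      using one_less_power[of "2::real" "Suc j"] by (auto simp: p_def q_def field_simps)
    have "cmod (\<Sum>n<N. coef g x n * ?z ^ n) \<le> sqrt D * 2 powr (real j * (b + 1) / 2)" for N
    proof -
      have "cmod (\<Sum>n<N. coef g x n * ?z ^ n) \<le> (\<Sum>n<N. (cmod (coef g x n) * sqrt p ^ n) * sqrt (q / p) ^ n)"
      proof (intro order_trans[OF norm_sum] sum_mono)
        fix n
        have "p * (q / p) = q"
          using pq by simp
        then have "rad j = sqrt p * sqrt (q / p)"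
          by (simp only: rad_def q_def[symmetric] real_sqrt_mult[symmetric])
        then show "cmod (coef g x n * ?z ^ n) \<le> (cmod (coef g x n) * sqrt p ^ n) * sqrt (q / p) ^ n"
          using pq by (simp add: norm_mult norm_power power_mult_distrib)
      qed
      then have "(cmod (\<Sum>n<N. coef g x n * ?z ^ n))\<^sup>2 \<le>
          (\<Sum>n<N. (cmod (coef g x n) * sqrt p ^ n) * sqrt (q / p) ^ n)\<^sup>2"
        by (rule power_mono) simp
      also have "\<dots> \<le> (\<Sum>n<N. (cmod (coef g x n) * sqrt p ^ n)\<^sup>2) * (\<Sum>n<N. (sqrt (q / p) ^ n)\<^sup>2)"
        by (rule Cauchy_Schwarz_ineq_sum)
      also have "\<dots> = (\<Sum>n<N. (cmod (coef g x n))\<^sup>2 * p ^ n) * (\<Sum>n<N. (q / p) ^ n)"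
      proof -
        have "(sqrt y ^ n)\<^sup>2 = y ^ n" if "y \<ge> 0" for y n
          using that by (simp add: power_mult[symmetric] mult.commute[of n] power_mult[of _ 2])
        then show ?thesis
          using pq by (simp add: power_mult_distrib)
      qed
      also have "\<dots> \<le> (C * 2 powr (b * real (Suc j))) * 2 ^ Suc j"
      proof (rule mult_mono)
        have "(\<Sum>n<N. (cmod (coef g x n))\<^sup>2 * p ^ n) \<le> energy g x (rad (Suc j))"
          using energy_rad_sums[OF x, of g "Suc j"] pq unfolding sums_iff p_def[symmetric]
          by (metis (no_types, lifting) finite_lessThan sum_le_suminf
            mult_nonneg_nonneg less_imp_le zero_le_power zero_le_power2)
        also have "\<dots> \<le> C * 2 powr (b * real (Suc j))"
          by (rule C)
        finally show "(\<Sum>n<N. (cmod (coef g x n))\<^sup>2 * p ^ n) \<le> C * 2 powr (b * real (Suc j))" .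
        have "(\<Sum>n<N. (q / p) ^ n) \<le> (\<Sum>n. (q / p) ^ n)"
          using pq by (intro sum_le_suminf summable_geometric) auto
        also have "\<dots> = 1 / (1 - q / p)"
          using pq by (intro suminf_geometric) auto
        also have "\<dots> = p * 2 ^ Suc j"
        proof -
          have "p - q = 1 / 2 ^ Suc j"
            by (simp add: p_def q_def field_simps)
          moreover have "1 / (1 - q / p) = p / (p - q)"
            using pq by (simp add: field_simps)
          ultimately show ?thesis
            by simp
        qed
        also have "\<dots> \<le> 1 * 2 ^ Suc j"
          by (intro mult_right_mono) (auto simp: p_def)
        finally show "(\<Sum>n<N. (q / p) ^ n) \<le> 2 ^ Suc j"
          by simp
      qed (use C0 pq in \<open>auto intro!: sum_nonneg\<close>)
      also have "\<dots> = C * 2 powr (b + 1) * 2 powr (real j * (b + 1))"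
        by (simp add: powr_realpow[symmetric] powr_add[symmetric] algebra_simps flip: power_Suc)
      also have "\<dots> \<le> D * 2 powr (real j * (b + 1))"
        unfolding D_def by (intro mult_right_mono) auto
      also have "\<dots> = (sqrt D * 2 powr (real j * (b + 1) / 2))\<^sup>2"
        using D by (simp add: power_mult_distrib powr_power)
      finally show ?thesis
        by (rule power2_le_imp_le) (use D in auto)
    qed
    moreover have "(\<lambda>N. cmod (\<Sum>n<N. coef g x n * ?z ^ n)) \<longlonglongrightarrow> cmod (chaos g x ?z)"
      using chaos_sums[OF x, of ?z g] by (intro tendsto_norm) (simp add: sums_def norm_mult)
    ultimately show ?thesis
      by (intro LIMSEQ_le_const2) auto
  qed
  then show ?thesis
    using that[of "sqrt D"] D by auto
qed

lemma cmod_chaos: "cmod (chaos g x z) = exp (g * Re (gser x z))"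
  by (simp add: chaos_def)

text \<open>The moduli are exponentials of multiples of the same real field, so the squared modulus
  at \<open>g''\<close> is the one at \<open>g'\<close> times the power
  \<open>2 * (g'' - g') / g\<close> of the modulus at \<open>g\<close>, and the latter is bounded
  pointwise. Regularity uses \<open>g = g' = 1 < g''\<close>; irregularity uses
  \<open>g' < g'' < 1 \<le> g\<close>.\<close>

lemma growth_interpolate:
  assumes x: "tame x" and gr: "growth g b x" "growth g' b' x" and g: "g > 0" "g' \<le> g''"
  shows "growth g'' (b' + (g'' - g') * (b + 1) / g) x"
proof -
  obtain C where C: "C > 0" "\<And>j t. cmod (chaos g x (of_real (rad j) * cis t)) \<le> C * 2 powr (real j * (b + 1) / 2)"
    using cmod_chaos_bound[OF x gr(1)] by blast
  obtain C' where C': "\<And>j. energy g' x (rad j) \<le> C' * 2 powr (b' * real j)"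
    using gr(2) by (auto simp: growth_def)
  define q where "q = 2 * (g'' - g') / g"
  have q: "q \<ge> 0"
    using g by (simp add: q_def)
  show ?thesis
    unfolding growth_def
  proof (intro exI allI)
    fix j
    let ?z = "\<lambda>t. of_real (rad j) * cis t"
    let ?B = "C powr q * 2 powr ((g'' - g') * (b + 1) / g * real j)"
    have le: "(cmod (chaos g'' x (?z t)))\<^sup>2 \<le> ?B * (cmod (chaos g' x (?z t)))\<^sup>2" for t
    proof -
      have "(cmod (chaos g'' x (?z t)))\<^sup>2 = cmod (chaos g x (?z t)) powr q * (cmod (chaos g' x (?z t)))\<^sup>2"
      proof -
        have "2 * (g'' * h) = g * h * q + 2 * (g' * h)" for h
          using g by (simp add: q_def field_simps)
        then show ?thesis
          unfolding cmod_chaos by (simp add: exp_powr_real exp_double[symmetric] exp_add[symmetric])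
      qed
      also have "\<dots> \<le> (C * 2 powr (real j * (b + 1) / 2)) powr q * (cmod (chaos g' x (?z t)))\<^sup>2"
        by (intro mult_right_mono powr_mono2 C q) auto
      also have "(C * 2 powr (real j * (b + 1) / 2)) powr q = ?B"
      proof -
        have "real j * (b + 1) / 2 * q = (g'' - g') * (b + 1) / g * real j"
          using g by (simp add: q_def field_simps)
        then show ?thesis
          using C(1) by (simp add: powr_mult powr_powr)
      qed
      finally show ?thesis .
    qed
    have cont: "continuous_on {0..2 * pi} (\<lambda>t. (cmod (chaos h x (?z t)))\<^sup>2)" for h
      by (intro continuous_on_power continuous_on_norm continuous_on_chaos_circle x) auto
    have "integral {0..2 * pi} (\<lambda>t. (cmod (chaos g'' x (?z t)))\<^sup>2) \<le>
        integral {0..2 * pi} (\<lambda>t. ?B * (cmod (chaos g' x (?z t)))\<^sup>2)"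
      by (intro integral_le integrable_continuous_real cont continuous_on_mult_left le)
    then have "energy g'' x (rad j) \<le> ?B * energy g' x (rad j)"
      by (simp add: energy_def divide_right_mono)
    also have "\<dots> \<le> ?B * (C' * 2 powr (b' * real j))"
      by (intro mult_left_mono C') auto
    also have "\<dots> = (C powr q * C') * (2 powr (b' * real j) * 2 powr ((g'' - g') * (b + 1) / g * real j))"
      by (simp only: mult_ac)
    also have "\<dots> = (C powr q * C') * 2 powr ((b' + (g'' - g') * (b + 1) / g) * real j)"
      by (simp only: distrib_right powr_add)
    finally show "energy g'' x (rad j) \<le> (C powr q * C') * 2 powr ((b' + (g'' - g') * (b + 1) / g) * real j)" .
  qed
qed

section \<open>Exponential moments\<close>

text \<open>Completing the square turns the tilt into a shift of the mean to
  \<open>c / 2\<close>.\<close>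

lemma nn_integral_normal_mgf:
  "(\<integral>\<^sup>+x. ennreal (normal_density 0 (sqrt (1 / 2)) x) * ennreal (exp (c * x)) \<partial>lborel) = ennreal (exp (c\<^sup>2 / 4))"
proof -
  have "normal_density 0 (sqrt (1 / 2)) x * exp (c * x) = exp (c\<^sup>2 / 4) * normal_density (c / 2) (sqrt (1 / 2)) x" for x
    by (simp add: normal_density_def exp_add[symmetric] power2_eq_square algebra_simps)
  then have "(\<integral>\<^sup>+x. ennreal (normal_density 0 (sqrt (1 / 2)) x) * ennreal (exp (c * x)) \<partial>lborel) =
      (\<integral>\<^sup>+x. ennreal (exp (c\<^sup>2 / 4)) * ennreal (normal_density (c / 2) (sqrt (1 / 2)) x) \<partial>lborel)"
    by (simp add: ennreal_mult[symmetric])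
  also have "\<dots> = ennreal (exp (c\<^sup>2 / 4)) * (\<integral>\<^sup>+x. ennreal (normal_density (c / 2) (sqrt (1 / 2)) x) \<partial>lborel)"
    by (rule nn_integral_cmult) simp
  also have "(\<integral>\<^sup>+x. ennreal (normal_density (c / 2) (sqrt (1 / 2)) x) \<partial>lborel) = 1"
    by (subst nn_integral_eq_integral) auto
  finally show ?thesis
    by simp
qed

lemma (in prob_space) nn_integral_exp_Re_std_complex_normal:
  assumes "std_complex_normal M Z"
  shows "(\<integral>\<^sup>+\<omega>. ennreal (exp (Re (a * Z \<omega>))) \<partial>M) = ennreal (exp ((cmod a)\<^sup>2 / 4))"
proof -
  have D: "distributed M lborel (\<lambda>\<omega>. Re (Z \<omega>)) (normal_density 0 (sqrt (1 / 2)))"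
      "distributed M lborel (\<lambda>\<omega>. Im (Z \<omega>)) (normal_density 0 (sqrt (1 / 2)))"
    and I: "indep_var borel (\<lambda>\<omega>. Re (Z \<omega>)) borel (\<lambda>\<omega>. Im (Z \<omega>))"
    using assms by (auto simp: std_complex_normal_def)
  \<comment> \<open>\<open>Re (a * Z) = Re a * Re Z - Im a * Im Z\<close>; the two parts are indexed
    by \<open>bool\<close> because \<open>indep_var\<close> is.\<close>
  define c where "c = case_bool (Re a) (- Im a)"
  define R where "R = case_bool (\<lambda>\<omega>. Re (Z \<omega>)) (\<lambda>\<omega>. Im (Z \<omega>))"
  have cb: "case_bool borel borel = (\<lambda>_. borel)"
    by (auto simp: fun_eq_iff split: bool.splits)
  have "indep_vars (\<lambda>_. borel) R UNIV"
    using I unfolding indep_var_def cb R_def .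
  then have ind: "indep_vars (\<lambda>_. borel) (\<lambda>b \<omega>. ennreal (exp (c b * R b \<omega>))) UNIV"
    by (rule indep_vars_compose2[where Y = "\<lambda>b y. ennreal (exp (c b * y))"]) simp
  have "(\<integral>\<^sup>+\<omega>. ennreal (exp (Re (a * Z \<omega>))) \<partial>M) = (\<integral>\<^sup>+\<omega>. (\<Prod>b\<in>UNIV. ennreal (exp (c b * R b \<omega>))) \<partial>M)"
    by (simp add: c_def R_def UNIV_bool ennreal_mult[symmetric] exp_add[symmetric] algebra_simps)
  also have "\<dots> = (\<Prod>b\<in>UNIV. \<integral>\<^sup>+\<omega>. ennreal (exp (c b * R b \<omega>)) \<partial>M)"
    by (rule indep_vars_nn_integral[OF _ ind]) auto
  also have "\<dots> = (\<Prod>b\<in>UNIV. ennreal (exp ((c b)\<^sup>2 / 4)))"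
  proof (rule prod.cong[OF refl])
    fix b
    have "distributed M lborel (R b) (normal_density 0 (sqrt (1 / 2)))"
      using D by (cases b) (auto simp: R_def)
    from distributed_nn_integral[OF this, of "\<lambda>x. ennreal (exp (c b * x))"]
    show "(\<integral>\<^sup>+\<omega>. ennreal (exp (c b * R b \<omega>)) \<partial>M) = ennreal (exp ((c b)\<^sup>2 / 4))"
      by (simp add: nn_integral_normal_mgf)
  qed
  also have "\<dots> = ennreal (exp ((cmod a)\<^sup>2 / 4))"
    by (simp add: c_def UNIV_bool ennreal_mult[symmetric] exp_add[symmetric] cmod_power2 add_divide_distrib add.commute)
  finally show ?thesis .
qed

text \<open>Borel-Cantelli in the form needed here: the series of the \<open>f j\<close> has finite
  expectation, so it is almost surely finite, and its value bounds every term.\<close>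

lemma (in prob_space) AE_bounded_of_summable_nn_integral:
  fixes f :: "nat \<Rightarrow> 'a \<Rightarrow> ennreal" and b :: "nat \<Rightarrow> real"
  assumes f[measurable]: "\<And>j. f j \<in> borel_measurable M"
    and le: "\<And>j. (\<integral>\<^sup>+\<omega>. f j \<omega> \<partial>M) \<le> ennreal (b j)"
    and b: "\<And>j. 0 \<le> b j" "summable b"
  shows "AE \<omega> in M. \<exists>C::real. 0 \<le> C \<and> (\<forall>j. f j \<omega> \<le> ennreal C)"
proof -
  have "(\<integral>\<^sup>+\<omega>. (\<Sum>j. f j \<omega>) \<partial>M) = (\<Sum>j. \<integral>\<^sup>+\<omega>. f j \<omega> \<partial>M)"
    by (rule nn_integral_suminf) simp
  also have "\<dots> \<le> (\<Sum>j. ennreal (b j))"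
    by (intro suminf_le le) auto
  also have "\<dots> < \<infinity>"
    unfolding suminf_ennreal2[OF b] by simp
  finally have "AE \<omega> in M. (\<Sum>j. f j \<omega>) \<noteq> \<infinity>"
    by (intro nn_integral_PInf_AE) auto
  then show ?thesis
  proof eventually_elim
    case (elim \<omega>)
    then obtain C where C: "0 \<le> C" "(\<Sum>j. f j \<omega>) = ennreal C"
      by (cases "\<Sum>j. f j \<omega>") auto
    have "f j \<omega> \<le> ennreal C" for j
      using sum_le_suminf[of "\<lambda>j. f j \<omega>" "{j}"] C by simp
    then show ?case
      using C by blast
  qed
qed

text \<open>Gaussian moments are computed for these finite sums; Fatou's lemma or dominated
  convergence carries the results over to \<open>gser\<close>.\<close>

definition gpart :: "nat \<Rightarrow> (nat \<Rightarrow> complex) \<Rightarrow> complex \<Rightarrow> complex" where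
  "gpart n x z = (\<Sum>k=1..n. z ^ k / of_real (sqrt (real k)) * x k)"

lemma gpart_tendsto:
  assumes "tame x" "cmod z < 1"
  shows "(\<lambda>n. gpart n x z) \<longlonglongrightarrow> gser x z"
  using gser_sums[OF assms] unfolding sums_def gpart_def
  by (simp add: sum.atLeast1_atMost_eq lessThan_Suc_atMost)

text \<open>For \<open>\<rho> = (cmod z)^2\<close> this is the mean of
  \<open>(cmod (gpart n x z))^2\<close> over independent standard complex normal \<open>x k\<close>.
  It increases to \<open>- ln (1 - \<rho>)\<close>, the source of all powers of
  \<open>1 - r^2\<close>.\<close>

definition logsum :: "real \<Rightarrow> nat \<Rightarrow> real" where
  "logsum \<rho> n = (\<Sum>k=1..n. \<rho> ^ k / real k)"

lemma neg_ln_one_minus_sums: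
  fixes \<rho> :: real
  assumes "0 \<le> \<rho>" "\<rho> < 1"
  shows "(\<lambda>k. \<rho> ^ k / real k) sums (- ln (1 - \<rho>))"
proof -
  have "(\<lambda>k. - ((- (- \<rho>)) ^ k) / of_nat k) sums ln (1 + - \<rho>)"
    using ln_series'[of "- \<rho>"] assms by simp
  then show ?thesis
    using sums_minus by fastforce
qed

lemma logsum_le:
  assumes "0 \<le> \<rho>" "\<rho> < 1"
  shows "logsum \<rho> n \<le> - ln (1 - \<rho>)"
  using neg_ln_one_minus_sums[OF assms] sum_le_suminf[of "\<lambda>k. \<rho> ^ k / real k" "{1..n}"] assms
  by (simp add: logsum_def sums_iff)

section \<open>Independent Gaussian coefficients: exponential moments and almost sure
  tameness\<close>

locale gaussian_coefficients = prob_space M for M :: "'a measure" +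
  fixes X :: "nat \<Rightarrow> 'a \<Rightarrow> complex"
  assumes indep: "indep_vars (\<lambda>_. borel) X {1..}"
    and normal: "\<And>k. k \<ge> 1 \<Longrightarrow> std_complex_normal M (X k)"
begin

abbreviation Xs :: "'a \<Rightarrow> nat \<Rightarrow> complex" where
  "Xs \<omega> \<equiv> \<lambda>k. X k \<omega>"

lemma measurable_X: "k \<ge> 1 \<Longrightarrow> X k \<in> borel_measurable M"
  using indep by (auto simp: indep_vars_def)

text \<open>The one Gaussian computation behind all exponential moments of \<open>gpart\<close>, at
  one point or two and with one truncation or two: each is a choice of the coefficients
  \<open>a\<close>.\<close>

lemma nn_integral_exp_linear:
  assumes "finite I" "I \<subseteq> {1..}"
  shows "(\<integral>\<^sup>+\<omega>. ennreal (exp (\<Sum>k\<in>I. Re (a k * X k \<omega>))) \<partial>M) = ennreal (exp (\<Sum>k\<in>I. (cmod (a k))\<^sup>2 / 4))"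
proof -
  have "indep_vars (\<lambda>_. borel) X I"
    using indep assms(2) by (rule indep_vars_subset)
  then have ind: "indep_vars (\<lambda>_. borel) (\<lambda>k \<omega>. ennreal (exp (Re (a k * X k \<omega>)))) I"
    by (rule indep_vars_compose2[where Y = "\<lambda>k y. ennreal (exp (Re (a k * y)))"]) measurable
  have "(\<integral>\<^sup>+\<omega>. ennreal (exp (\<Sum>k\<in>I. Re (a k * X k \<omega>))) \<partial>M) =
      (\<integral>\<^sup>+\<omega>. (\<Prod>k\<in>I. ennreal (exp (Re (a k * X k \<omega>)))) \<partial>M)"
    using assms(1) by (simp add: exp_sum prod_ennreal)
  also have "\<dots> = (\<Prod>k\<in>I. \<integral>\<^sup>+\<omega>. ennreal (exp (Re (a k * X k \<omega>))) \<partial>M)"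
    by (rule indep_vars_nn_integral[OF assms(1) ind]) auto
  also have "\<dots> = (\<Prod>k\<in>I. ennreal (exp ((cmod (a k))\<^sup>2 / 4)))"
    using assms(2) by (intro prod.cong refl nn_integral_exp_Re_std_complex_normal normal) auto
  also have "\<dots> = ennreal (exp (\<Sum>k\<in>I. (cmod (a k))\<^sup>2 / 4))"
    using assms(1) by (simp add: exp_sum prod_ennreal)
  finally show ?thesis .
qed

text \<open>Exponential moments of \<open>X k\<close> do not depend on \<open>k\<close>. Damped by
  \<open>(1 / 2) ^ j\<close> they are summable, so almost surely the exponentials are at most
  \<open>C * 2 ^ j\<close>, and taking logarithms gives linear growth.\<close>

lemma AE_tame: "AE \<omega> in M. tame (Xs \<omega>)"
proof -
  \<comment> \<open>One-sided exponentials in four directions bound the real and the imaginary part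
    from both sides.\<close>
  define Y where "Y k \<omega> = (\<Sum>a\<in>{1, -1, \<i>, -\<i>}. ennreal (exp (Re (a * X (Suc k) \<omega>))))" for k \<omega>
  note measurable_X[measurable]
  have "AE \<omega> in M. \<exists>C::real. 0 \<le> C \<and> (\<forall>j. Y j \<omega> * ennreal ((1 / 2) ^ j) \<le> ennreal C)"
  proof (rule AE_bounded_of_summable_nn_integral)
    fix j
    show "(\<lambda>\<omega>. Y j \<omega> * ennreal ((1 / 2) ^ j)) \<in> borel_measurable M"
      unfolding Y_def by measurable
    have "(\<integral>\<^sup>+\<omega>. Y j \<omega> * ennreal ((1 / 2) ^ j) \<partial>M) = (\<integral>\<^sup>+\<omega>. Y j \<omega> \<partial>M) * ennreal ((1 / 2) ^ j)"
      unfolding Y_def by (rule nn_integral_multc) measurable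
    also have "(\<integral>\<^sup>+\<omega>. Y j \<omega> \<partial>M) = (\<Sum>a\<in>{1, -1, \<i>, -\<i>}. ennreal (exp ((cmod a)\<^sup>2 / 4)))"
      unfolding Y_def
      by (subst nn_integral_sum, measurable)
         (intro sum.cong refl nn_integral_exp_Re_std_complex_normal normal, simp)
    also have "\<dots> = (\<Sum>a\<in>{1, -1, \<i>, -\<i>}. ennreal (exp (1 / 4)))"
      by (rule sum.cong) auto
    also have "\<dots> \<le> ennreal (4 * exp (1 / 4))"
      by (subst sum_constant) (simp add: ennreal_mult complex_eq_iff card_insert_if)
    finally show "(\<integral>\<^sup>+\<omega>. Y j \<omega> * ennreal ((1 / 2) ^ j) \<partial>M) \<le> ennreal (4 * exp (1 / 4) * (1 / 2) ^ j)"
      by (simp add: ennreal_mult mult_right_mono)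
  qed (auto intro: summable_mult)
  then show ?thesis
  proof eventually_elim
    case (elim \<omega>)
    then obtain C where C: "0 \<le> C" "\<And>j. Y j \<omega> * ennreal ((1 / 2) ^ j) \<le> ennreal C"
      by blast
    have le: "Re (a * X (Suc j) \<omega>) \<le> C + real j" if "a \<in> {1, -1, \<i>, -\<i>}" for a j
    proof -
      have "ennreal (exp (Re (a * X (Suc j) \<omega>))) \<le> Y j \<omega>"
        unfolding Y_def by (rule member_le_sum) (use that in auto)
      then have "ennreal (exp (Re (a * X (Suc j) \<omega>)) * (1 / 2) ^ j) \<le> Y j \<omega> * ennreal ((1 / 2) ^ j)"
        by (simp add: ennreal_mult mult_right_mono)
      also have "\<dots> \<le> ennreal C"
        by (rule C)
      finally have "exp (Re (a * X (Suc j) \<omega>)) * (1 / 2) ^ j \<le> C"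
        using C(1) by simp
      then have "exp (Re (a * X (Suc j) \<omega>)) \<le> C * 2 ^ j"
        by (simp add: power_one_over field_simps)
      also have "\<dots> \<le> exp C * exp 1 ^ j"
      proof (intro mult_mono power_mono)
        show "C \<le> exp C" "2 \<le> exp (1::real)"
          using exp_ge_add_one_self[of C] exp_ge_add_one_self[of 1] by linarith+
      qed auto
      also have "\<dots> = exp (C + real j)"
        by (simp add: exp_add exp_of_nat_mult[symmetric])
      finally show ?thesis
        by simp
    qed
    have "cmod (X k \<omega>) \<le> (2 * C + 2) * real k" if k: "k \<ge> 1" for k
    proof -
      obtain j where j: "k = Suc j"
        using k by (cases k) auto
      have "\<bar>Re (X k \<omega>)\<bar> \<le> C + real j" "\<bar>Im (X k \<omega>)\<bar> \<le> C + real j"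
        using le[of 1 j] le[of "-1" j] le[of \<i> j] le[of "-\<i>" j] by (auto simp: j)
      then have "cmod (X k \<omega>) \<le> 2 * C + 2 * real j"
        using cmod_le[of "X k \<omega>"] by linarith
      also have "\<dots> \<le> (2 * C + 2) * real k"
        using C(1) by (simp add: j algebra_simps)
      finally show ?thesis .
    qed
    then show ?case
      unfolding tame_def by blast
  qed
qed

lemma nn_integral_exp_gpart:
  "(\<integral>\<^sup>+\<omega>. ennreal (exp (c * Re (gpart n (Xs \<omega>) z))) \<partial>M) =
    ennreal (exp (c\<^sup>2 / 4 * logsum ((cmod z)\<^sup>2) n))"
proof -
  have "c * Re (gpart n (Xs \<omega>) z) = (\<Sum>k\<in>{1..n}. Re (of_real c * z ^ k / of_real (sqrt (real k)) * X k \<omega>))" for \<omega>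
    unfolding gpart_def Re_sum sum_distrib_left
  proof (rule sum.cong[OF refl])
    fix k
    have "c * Re w = Re (of_real c * w)" for w
      by simp
    then show "c * Re (z ^ k / of_real (sqrt (real k)) * X k \<omega>) =
        Re (of_real c * z ^ k / of_real (sqrt (real k)) * X k \<omega>)"
      by (simp only: times_divide_eq_right mult.assoc times_divide_eq_left)
  qed
  moreover have "(\<Sum>k\<in>{1..n}. (cmod (of_real c * z ^ k / of_real (sqrt (real k))))\<^sup>2 / 4) = c\<^sup>2 / 4 * logsum ((cmod z)\<^sup>2) n"
    unfolding logsum_def sum_distrib_left
    by (rule sum.cong[OF refl])
       (simp add: norm_mult norm_divide norm_power power_divide power_mult_distrib power_mult[symmetric] mult.commute)
  ultimately show ?thesis
    using nn_integral_exp_linear[of "{1..n}" "\<lambda>k. of_real c * z ^ k / of_real (sqrt (real k))"] by simp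
qed

end

section \<open>Almost sure growth bounds and the zero-one law\<close>

text \<open>The energy without its factor \<open>1 / (2 * pi)\<close>, as an integral in
  \<open>ennreal\<close>: measurability and Fubini then need neither tameness nor
  integrability.\<close>

definition nenergy :: "real \<Rightarrow> (nat \<Rightarrow> complex) \<Rightarrow> real \<Rightarrow> ennreal" where
  "nenergy g y r = (\<integral>\<^sup>+t. ennreal ((cmod (chaos g y (of_real r * cis t)))\<^sup>2) * indicator {0..2 * pi} t \<partial>lborel)"

lemma nenergy_eq:
  assumes "tame y" "0 \<le> r" "r < 1"
  shows "nenergy g y r = ennreal (2 * pi * energy g y r)"
proof -
  let ?f = "\<lambda>t. (cmod (chaos g y (of_real r * cis t)))\<^sup>2"
  have "(?f has_integral integral {0..2 * pi} ?f) {0..2 * pi}"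
    by (intro integrable_integral integrable_continuous_real continuous_on_power continuous_on_norm
        continuous_on_chaos_circle assms)
  then have "nenergy g y r = ennreal (integral {0..2 * pi} ?f)"
    unfolding nenergy_def by (intro nn_integral_has_integral_lebesgue') auto
  then show ?thesis
    by (simp add: energy_def)
qed

text \<open>A natural number as constant turns the existential quantifier into a countable union of
  measurable conditions.\<close>

lemma growth_iff_nenergy:
  assumes "tame y"
  shows "growth g b y \<longleftrightarrow> (\<exists>C::nat. \<forall>j. nenergy g y (rad j) \<le> ennreal (real C * 2 powr (b * real j)))"
proof -
  have eq: "nenergy g y (rad j) \<le> ennreal (real C * 2 powr (b * real j)) \<longleftrightarrow>
      2 * pi * energy g y (rad j) \<le> real C * 2 powr (b * real j)" for C j
    unfolding nenergy_eq[OF assms rad_nonneg rad_less_1] by (rule ennreal_le_iff) simp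
  show ?thesis
    unfolding eq growth_def
  proof (intro iffI; elim exE)
    fix C
    assume C: "\<forall>j. energy g y (rad j) \<le> C * 2 powr (b * real j)"
    obtain D :: nat where D: "2 * pi * C \<le> real D"
      using real_arch_simple by blast
    have "2 * pi * energy g y (rad j) \<le> real D * 2 powr (b * real j)" for j
    proof -
      have "2 * pi * energy g y (rad j) \<le> 2 * pi * (C * 2 powr (b * real j))"
        using C by (intro mult_left_mono) auto
      also have "\<dots> \<le> real D * 2 powr (b * real j)"
        using mult_right_mono[OF D, of "2 powr (b * real j)"] by (simp add: mult_ac)
      finally show ?thesis .
    qed
    then show "\<exists>C::nat. \<forall>j. 2 * pi * energy g y (rad j) \<le> real C * 2 powr (b * real j)"
      by blast
  next
    fix C :: nat
    assume C: "\<forall>j. 2 * pi * energy g y (rad j) \<le> real C * 2 powr (b * real j)"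
    have "energy g y (rad j) \<le> real C / (2 * pi) * 2 powr (b * real j)" for j
      using C[rule_format, of j] by (simp add: field_simps)
    then show "\<exists>C. \<forall>j. energy g y (rad j) \<le> C * 2 powr (b * real j)"
      by blast
  qed
qed

lemma growth_perturb:
  assumes x: "tame x" and y: "tame y"
    and Q: "\<And>z. cmod z < 1 \<Longrightarrow> \<bar>Re (gser x z) - Re (gser y z)\<bar> \<le> Q"
    and gr: "growth g b x"
  shows "growth g b y"
proof -
  obtain C where C: "\<And>j. energy g x (rad j) \<le> C * 2 powr (b * real j)"
    using gr by (auto simp: growth_def)
  let ?B = "exp (2 * \<bar>g\<bar> * Q)"
  have "energy g y (rad j) \<le> ?B * C * 2 powr (b * real j)" for j
  proof -
    let ?z = "\<lambda>t. of_real (rad j) * cis t"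
    have le: "(cmod (chaos g y (?z t)))\<^sup>2 \<le> ?B * (cmod (chaos g x (?z t)))\<^sup>2" for t
    proof -
      have "g * (Re (gser y (?z t)) - Re (gser x (?z t))) \<le> \<bar>g\<bar> * \<bar>Re (gser x (?z t)) - Re (gser y (?z t))\<bar>"
        by (metis abs_ge_self abs_minus_commute abs_mult)
      also have "\<dots> \<le> \<bar>g\<bar> * Q"
        by (intro mult_left_mono Q) (auto simp: norm_mult)
      finally have "2 * (g * Re (gser y (?z t))) \<le> 2 * \<bar>g\<bar> * Q + 2 * (g * Re (gser x (?z t)))"
        by (simp add: algebra_simps)
      then show ?thesis
        unfolding cmod_chaos by (simp add: exp_double[symmetric] exp_add[symmetric])
    qed
    have cont: "continuous_on {0..2 * pi} (\<lambda>t. (cmod (chaos g w (?z t)))\<^sup>2)" if "tame w" for w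
      by (intro continuous_on_power continuous_on_norm continuous_on_chaos_circle that) auto
    have "integral {0..2 * pi} (\<lambda>t. (cmod (chaos g y (?z t)))\<^sup>2) \<le>
        integral {0..2 * pi} (\<lambda>t. ?B * (cmod (chaos g x (?z t)))\<^sup>2)"
      by (intro integral_le integrable_continuous_real cont continuous_on_mult_left le x y)
    then have "energy g y (rad j) \<le> ?B * energy g x (rad j)"
      by (simp add: energy_def divide_right_mono)
    also have "\<dots> \<le> ?B * (C * 2 powr (b * real j))"
      by (intro mult_left_mono C) auto
    finally show ?thesis
      by (simp only: mult.assoc)
  qed
  then show ?thesis
    unfolding growth_def by blast
qed

text \<open>Low coefficients are set to \<open>0\<close> and the others keep their index, so that
  \<open>gser x - gser (tail n x)\<close> is the polynomial \<open>gpart n x\<close> on the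
  disc.\<close>

definition tail :: "nat \<Rightarrow> (nat \<Rightarrow> complex) \<Rightarrow> nat \<Rightarrow> complex" where
  "tail n x k = (if k \<le> n then 0 else x k)"

lemma tame_tail_iff: "tame (tail n x) \<longleftrightarrow> tame x"
proof
  assume "tame x"
  then obtain C where C: "\<And>k. k \<ge> 1 \<Longrightarrow> cmod (x k) \<le> C * real k"
    by (auto simp: tame_def)
  have "cmod (tail n x k) \<le> C * real k" if "k \<ge> 1" for k
    using C[OF that] order_trans[OF norm_ge_zero C[OF that]] by (auto simp: tail_def)
  then show "tame (tail n x)"
    by (auto simp: tame_def)
next
  assume "tame (tail n x)"
  then obtain C where C: "\<And>k. k \<ge> 1 \<Longrightarrow> cmod (tail n x k) \<le> C * real k"
    by (auto simp: tame_def)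
  let ?S = "\<Sum>k\<le>n. cmod (x k)"
  have "cmod (x k) \<le> (\<bar>C\<bar> + ?S) * real k" if k: "k \<ge> 1" for k
  proof (cases "k \<le> n")
    case True
    then have "cmod (x k) \<le> ?S"
      by (intro member_le_sum) auto
    also have "\<dots> \<le> ?S * real k"
      using k mult_left_mono[of 1 "real k" ?S] by (simp add: sum_nonneg)
    also have "\<dots> \<le> (\<bar>C\<bar> + ?S) * real k"
      by (intro mult_right_mono) auto
    finally show ?thesis .
  next
    case False
    then have "cmod (x k) \<le> C * real k"
      using C[OF k] by (simp add: tail_def)
    also have "\<dots> \<le> (\<bar>C\<bar> + ?S) * real k"
      by (intro mult_right_mono add_increasing2 sum_nonneg) auto
    finally show ?thesis .
  qed
  then show "tame x"
    by (auto simp: tame_def)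
qed

lemma gser_tail:
  assumes x: "tame x" and z: "cmod z < 1"
  shows "gser x z = gpart n x z + gser (tail n x) z"
proof -
  have split: "gpart m x z = gpart n x z + gpart m (tail n x) z" if "m \<ge> n" for m
  proof -
    have "gpart m x z = (\<Sum>k=1..m. (if k \<le> n then z ^ k / of_real (sqrt (real k)) * x k else 0) +
        z ^ k / of_real (sqrt (real k)) * tail n x k)"
      unfolding gpart_def by (rule sum.cong) (auto simp: tail_def)
    also have "\<dots> = (\<Sum>k=1..m. if k \<le> n then z ^ k / of_real (sqrt (real k)) * x k else 0) + gpart m (tail n x) z"
      by (simp add: sum.distrib gpart_def)
    also have "(\<Sum>k=1..m. if k \<le> n then z ^ k / of_real (sqrt (real k)) * x k else 0) = gpart n x z"
      unfolding gpart_def by (rule sum.mono_neutral_cong_right) (use that in auto)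
    finally show ?thesis .
  qed
  have "eventually (\<lambda>m. gpart n x z + gpart m (tail n x) z = gpart m x z) sequentially"
    by (rule eventually_sequentiallyI[of n]) (rule split[symmetric])
  moreover have "(\<lambda>m. gpart n x z + gpart m (tail n x) z) \<longlonglongrightarrow> gpart n x z + gser (tail n x) z"
    by (intro tendsto_add tendsto_const gpart_tendsto z) (simp add: tame_tail_iff x)
  ultimately have "(\<lambda>m. gpart m x z) \<longlonglongrightarrow> gpart n x z + gser (tail n x) z"
    by (rule Lim_transform_eventually[rotated])
  with gpart_tendsto[OF x z] show ?thesis
    by (rule LIMSEQ_unique)
qed

text \<open>The removed polynomial is bounded on the disc by the sum of the
  \<open>cmod (x k)\<close>, so the squared moduli change by bounded factors only. This makes
  \<open>growth\<close> a tail property.\<close>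

lemma growth_tail_iff:
  assumes x: "tame x"
  shows "growth g b (tail n x) \<longleftrightarrow> growth g b x"
proof -
  define Q where "Q = (\<Sum>k=1..n. cmod (x k))"
  have "cmod (gpart n x z) \<le> Q" if "cmod z < 1" for z
    unfolding gpart_def Q_def
  proof (intro order_trans[OF norm_sum] sum_mono)
    fix k
    assume k: "k \<in> {1..n}"
    have "cmod z ^ k / sqrt (real k) \<le> 1 / 1"
      using k that by (intro frac_le power_le_one) auto
    then have "cmod z ^ k / sqrt (real k) * cmod (x k) \<le> 1 * cmod (x k)"
      by (intro mult_right_mono) auto
    then show "cmod (z ^ k / of_real (sqrt (real k)) * x k) \<le> cmod (x k)"
      by (simp add: norm_mult norm_divide norm_power)
  qed
  then have Q: "\<bar>Re (gser x z) - Re (gser (tail n x) z)\<bar> \<le> Q" if "cmod z < 1" for z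
    using gser_tail[OF x that, of n] abs_Re_le_cmod[of "gpart n x z"] that by force
  then have Q': "\<bar>Re (gser (tail n x) z) - Re (gser x z)\<bar> \<le> Q" if "cmod z < 1" for z
    using that by (simp add: abs_minus_commute)
  have y: "tame (tail n x)"
    using x by (simp add: tame_tail_iff)
  show ?thesis
    using growth_perturb[OF x y Q] growth_perturb[OF y x Q'] by blast
qed

section \<open>Measurability of the series, the energies and the growth event\<close>

lemma measurable_gser:
  assumes Y: "\<And>k. k \<ge> 1 \<Longrightarrow> Y k \<in> borel_measurable N" and z[measurable]: "z \<in> borel_measurable N"
  shows "(\<lambda>\<omega>. gser (\<lambda>k. Y k \<omega>) (z \<omega>)) \<in> borel_measurable N"
proof -
  have [measurable]: "Y (Suc k) \<in> borel_measurable N" for k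
    by (intro Y) simp
  show ?thesis
    unfolding gser_def by measurable
qed

lemma measurable_gpart:
  assumes Y: "\<And>k. k \<ge> 1 \<Longrightarrow> Y k \<in> borel_measurable N" and z[measurable]: "z \<in> borel_measurable N"
  shows "(\<lambda>\<omega>. gpart n (\<lambda>k. Y k \<omega>) (z \<omega>)) \<in> borel_measurable N"
proof -
  have "(\<lambda>\<omega>. z \<omega> ^ k / of_real (sqrt (real k)) * Y k \<omega>) \<in> borel_measurable N" if "k \<in> {1..n}" for k
  proof -
    have [measurable]: "Y k \<in> borel_measurable N"
      using that by (intro Y) simp
    show ?thesis
      by measurable
  qed
  then show ?thesis
    unfolding gpart_def by (rule borel_measurable_sum)
qed

lemma measurable_cmod_chaos:
  assumes Y: "\<And>k. k \<ge> 1 \<Longrightarrow> Y k \<in> borel_measurable N"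
  shows "(\<lambda>(\<omega>, t). ennreal ((cmod (chaos g (\<lambda>k. Y k \<omega>) (of_real r * cis t)))\<^sup>2)) \<in> borel_measurable (N \<Otimes>\<^sub>M lborel)"
proof -
  have [measurable]: "(\<lambda>p. gser (\<lambda>k. Y k (fst p)) (of_real r * cis (snd p))) \<in> borel_measurable (N \<Otimes>\<^sub>M lborel)"
  proof (rule measurable_gser[where Y = "\<lambda>k p. Y k (fst p)"])
    show "(\<lambda>p. Y k (fst p)) \<in> borel_measurable (N \<Otimes>\<^sub>M lborel)" if "k \<ge> 1" for k
      using Y[OF that] by measurable
    have [measurable]: "cis \<in> borel_measurable borel"
      by (intro borel_measurable_continuous_onI continuous_intros)
    show "(\<lambda>p. of_real r * cis (snd p)) \<in> borel_measurable (N \<Otimes>\<^sub>M lborel)"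
      by measurable
  qed
  show ?thesis
    unfolding chaos_def split_beta by measurable
qed

lemma measurable_nenergy:
  assumes Y: "\<And>k. k \<ge> 1 \<Longrightarrow> Y k \<in> borel_measurable N"
  shows "(\<lambda>\<omega>. nenergy g (\<lambda>k. Y k \<omega>) r) \<in> borel_measurable N"
  unfolding nenergy_def using measurable_cmod_chaos[where Y = Y, OF Y, of g r] by measurable

text \<open>The measure space is arbitrary so that the sigma-algebra generated by the coefficients
  beyond a given index can take the place of \<open>N\<close>.\<close>

lemma sets_tame_growth:
  assumes Y: "\<And>k. k \<ge> 1 \<Longrightarrow> Y k \<in> borel_measurable N"
  shows "{\<omega> \<in> space N. tame (\<lambda>k. Y k \<omega>) \<and> growth g b (\<lambda>k. Y k \<omega>)} \<in> sets N"
proof -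
  have [measurable]: "Y (Suc k) \<in> borel_measurable N" for k
    by (intro Y) simp
  note measurable_nenergy[where Y = Y, OF Y, measurable]
  have tame: "tame y \<longleftrightarrow> (\<exists>C::nat. \<forall>k. cmod (y (Suc k)) \<le> real C * real (Suc k))" for y
  proof
    assume "tame y"
    then obtain C where C: "\<And>k. k \<ge> 1 \<Longrightarrow> cmod (y k) \<le> C * real k"
      by (auto simp: tame_def)
    obtain D :: nat where D: "C \<le> real D"
      using real_arch_simple by blast
    have "cmod (y (Suc k)) \<le> real D * real (Suc k)" for k
      using order_trans[OF C[of "Suc k"] mult_right_mono[OF D]] by simp
    then show "\<exists>C::nat. \<forall>k. cmod (y (Suc k)) \<le> real C * real (Suc k)"
      by blast
  next
    assume "\<exists>C::nat. \<forall>k. cmod (y (Suc k)) \<le> real C * real (Suc k)"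
    then obtain C :: nat where C: "\<And>k. cmod (y (Suc k)) \<le> real C * real (Suc k)"
      by blast
    have "cmod (y k) \<le> real C * real k" if "k \<ge> 1" for k
      using C[of "k - 1"] that by simp
    then show "tame y"
      unfolding tame_def by blast
  qed
  have "{\<omega> \<in> space N. tame (\<lambda>k. Y k \<omega>) \<and> growth g b (\<lambda>k. Y k \<omega>)} =
    {\<omega> \<in> space N. (\<exists>C::nat. \<forall>k. cmod (Y (Suc k) \<omega>) \<le> real C * real (Suc k)) \<and>
      (\<exists>C::nat. \<forall>j. nenergy g (\<lambda>k. Y k \<omega>) (rad j) \<le> ennreal (real C * 2 powr (b * real j)))}"
    using tame growth_iff_nenergy by blast
  also have "\<dots> \<in> sets N"
    by measurable
  finally show ?thesis .
qed

section \<open>Mean energy, almost sure upper growth, and the zero-one law\<close>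

context gaussian_coefficients
begin

text \<open>Fatou's lemma along the truncations; the squared modulus tilts by \<open>2 * g\<close>,
  and \<open>(2 * g)^2 / 4 = g^2\<close> multiplies the variance bound
  \<open>- ln (1 - (cmod z)^2)\<close>.\<close>

lemma nn_integral_chaos_le:
  assumes "cmod z < 1"
  shows "(\<integral>\<^sup>+\<omega>. ennreal ((cmod (chaos g (Xs \<omega>) z))\<^sup>2) \<partial>M) \<le> ennreal ((1 - (cmod z)\<^sup>2) powr (- g\<^sup>2))"
proof -
  have r: "0 \<le> (cmod z)\<^sup>2" "(cmod z)\<^sup>2 < 1"
    using assms by (auto simp: power_less_one_iff abs_square_less_1)
  let ?u = "\<lambda>n \<omega>. ennreal (exp (2 * g * Re (gpart n (Xs \<omega>) z)))"
  have "(\<integral>\<^sup>+\<omega>. ennreal ((cmod (chaos g (Xs \<omega>) z))\<^sup>2) \<partial>M) = (\<integral>\<^sup>+\<omega>. liminf (\<lambda>n. ?u n \<omega>) \<partial>M)"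
  proof (rule nn_integral_cong_AE)
    show "AE \<omega> in M. ennreal ((cmod (chaos g (Xs \<omega>) z))\<^sup>2) = liminf (\<lambda>n. ?u n \<omega>)"
      using AE_tame
    proof eventually_elim
      case (elim \<omega>)
      have "(\<lambda>n. ?u n \<omega>) \<longlonglongrightarrow> ennreal (exp (2 * g * Re (gser (Xs \<omega>) z)))"
        by (intro tendsto_intros gpart_tendsto elim assms)
      then have "liminf (\<lambda>n. ?u n \<omega>) = ennreal (exp (2 * g * Re (gser (Xs \<omega>) z)))"
        by (intro lim_imp_Liminf) auto
      then show ?case
        by (simp add: cmod_chaos exp_double[symmetric] mult.assoc)
    qed
  qed
  also have "\<dots> \<le> liminf (\<lambda>n. \<integral>\<^sup>+\<omega>. ?u n \<omega> \<partial>M)"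
  proof (rule nn_integral_liminf)
    fix n
    have [measurable]: "(\<lambda>\<omega>. gpart n (Xs \<omega>) z) \<in> borel_measurable M"
      by (rule measurable_gpart[where Y = X, OF measurable_X]) auto
    show "?u n \<in> borel_measurable M"
      by measurable
  qed
  also have "\<dots> \<le> ennreal ((1 - (cmod z)\<^sup>2) powr (- g\<^sup>2))"
  proof (rule Liminf_le)
    show "\<forall>\<^sub>F n in sequentially. (\<integral>\<^sup>+\<omega>. ?u n \<omega> \<partial>M) \<le> ennreal ((1 - (cmod z)\<^sup>2) powr (- g\<^sup>2))"
    proof (rule always_eventually, rule allI)
      fix n
      have "g\<^sup>2 * logsum ((cmod z)\<^sup>2) n \<le> g\<^sup>2 * - ln (1 - (cmod z)\<^sup>2)"
        by (intro mult_left_mono logsum_le r) auto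
      then have "exp ((2 * g)\<^sup>2 / 4 * logsum ((cmod z)\<^sup>2) n) \<le> (1 - (cmod z)\<^sup>2) powr (- g\<^sup>2)"
        using r by (simp add: powr_def power_mult_distrib)
      then show "(\<integral>\<^sup>+\<omega>. ?u n \<omega> \<partial>M) \<le> ennreal ((1 - (cmod z)\<^sup>2) powr (- g\<^sup>2))"
        unfolding nn_integral_exp_gpart by (rule ennreal_leI)
    qed
  qed simp
  finally show ?thesis .
qed

lemma nn_integral_nenergy_le:
  assumes "0 \<le> r" "r < 1"
  shows "(\<integral>\<^sup>+\<omega>. nenergy g (Xs \<omega>) r \<partial>M) \<le> ennreal (2 * pi * (1 - r\<^sup>2) powr (- g\<^sup>2))"
proof -
  interpret P: pair_sigma_finite M lborel ..
  note measurable_cmod_chaos[where Y = X, OF measurable_X, of g r, measurable]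
  let ?f = "\<lambda>\<omega> t. ennreal ((cmod (chaos g (Xs \<omega>) (of_real r * cis t)))\<^sup>2)"
  have "(\<integral>\<^sup>+\<omega>. nenergy g (Xs \<omega>) r \<partial>M) = (\<integral>\<^sup>+t. \<integral>\<^sup>+\<omega>. ?f \<omega> t * indicator {0..2 * pi} t \<partial>M \<partial>lborel)"
    unfolding nenergy_def by (rule P.Fubini'[symmetric]) measurable
  also have "\<dots> \<le> (\<integral>\<^sup>+t. ennreal ((1 - r\<^sup>2) powr (- g\<^sup>2)) * indicator {0..2 * pi} t \<partial>lborel)"
  proof (rule nn_integral_mono)
    fix t :: real
    have "(\<integral>\<^sup>+\<omega>. ?f \<omega> t \<partial>M) \<le> ennreal ((1 - r\<^sup>2) powr (- g\<^sup>2))"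
      using nn_integral_chaos_le[of "of_real r * cis t" g] assms by (simp add: norm_mult)
    then show "(\<integral>\<^sup>+\<omega>. ?f \<omega> t * indicator {0..2 * pi} t \<partial>M) \<le> ennreal ((1 - r\<^sup>2) powr (- g\<^sup>2)) * indicator {0..2 * pi} t"
      by (cases "t \<in> {0..2 * pi}") auto
  qed
  also have "\<dots> = ennreal ((1 - r\<^sup>2) powr (- g\<^sup>2)) * emeasure lborel {0..2 * pi}"
    by (rule nn_integral_cmult_indicator) simp
  also have "\<dots> = ennreal (2 * pi * (1 - r\<^sup>2) powr (- g\<^sup>2))"
    by (simp add: ennreal_mult[symmetric] mult_ac)
  finally show ?thesis .
qed

lemma AE_growth:
  assumes e: "e > 0"
  shows "AE \<omega> in M. growth g (g\<^sup>2 + e) (Xs \<omega>)"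
proof -
  \<comment> \<open>The mean of the \<open>j\<close>-th term is at most
    \<open>2 * pi * ?q ^ j\<close>: the loss \<open>e\<close> supplies the geometric decay.\<close>
  let ?f = "\<lambda>j \<omega>. nenergy g (Xs \<omega>) (rad j) * ennreal (2 powr (- (g\<^sup>2 + e) * real j))"
  let ?q = "2 powr (- e) :: real"
  note measurable_nenergy[where Y = X, OF measurable_X, measurable]
  have "AE \<omega> in M. \<exists>C::real. 0 \<le> C \<and> (\<forall>j. ?f j \<omega> \<le> ennreal C)"
  proof (rule AE_bounded_of_summable_nn_integral)
    fix j
    show "?f j \<in> borel_measurable M"
      by measurable
    have "(\<integral>\<^sup>+\<omega>. ?f j \<omega> \<partial>M) = (\<integral>\<^sup>+\<omega>. nenergy g (Xs \<omega>) (rad j) \<partial>M) * ennreal (2 powr (- (g\<^sup>2 + e) * real j))"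
      by (rule nn_integral_multc) measurable
    also have "\<dots> \<le> ennreal (2 * pi * (1 - (rad j)\<^sup>2) powr (- g\<^sup>2)) * ennreal (2 powr (- (g\<^sup>2 + e) * real j))"
      by (intro mult_right_mono nn_integral_nenergy_le) auto
    also have "\<dots> = ennreal (2 * pi * ((1 - (rad j)\<^sup>2) powr (- g\<^sup>2) * 2 powr (- (g\<^sup>2 + e) * real j)))"
      by (simp add: ennreal_mult[symmetric] mult_ac)
    also have "(1 - (rad j)\<^sup>2) powr (- g\<^sup>2) = 2 powr (g\<^sup>2 * real j)"
      by (simp add: rad_power2 powr_divide powr_minus powr_realpow[symmetric] powr_powr mult.commute)
    also have "2 powr (g\<^sup>2 * real j) * 2 powr (- (g\<^sup>2 + e) * real j) = ?q ^ j"
      by (simp add: powr_add[symmetric] powr_realpow[symmetric] powr_powr algebra_simps)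
    finally show "(\<integral>\<^sup>+\<omega>. ?f j \<omega> \<partial>M) \<le> ennreal (2 * pi * ?q ^ j)" .
  next
    have "?q < 1"
      using e by (simp add: powr_less_one)
    then show "summable (\<lambda>j. 2 * pi * ?q ^ j)"
      by (intro summable_mult summable_geometric) auto
  qed auto
  with AE_tame show ?thesis
  proof eventually_elim
    case (elim \<omega>)
    then obtain C where C: "0 \<le> C" "\<And>j. ?f j \<omega> \<le> ennreal C"
      by blast
    have "energy g (Xs \<omega>) (rad j) \<le> C / (2 * pi) * 2 powr ((g\<^sup>2 + e) * real j)" for j
    proof -
      have "ennreal (2 * pi * energy g (Xs \<omega>) (rad j) * 2 powr (- (g\<^sup>2 + e) * real j)) \<le> ennreal C"
        using C(2)[of j] nenergy_eq[OF elim(1), of "rad j" g]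
        by (simp add: ennreal_mult[symmetric] energy_nonneg)
      then have "2 * pi * energy g (Xs \<omega>) (rad j) * 2 powr (- (g\<^sup>2 + e) * real j) \<le> C"
        using C(1) by simp
      then show ?thesis
        unfolding mult_minus_left powr_minus by (simp add: field_simps)
    qed
    then show ?case
      unfolding growth_def by blast
  qed
qed

text \<open>Finitely many coefficients do not influence \<open>growth\<close>, so Kolmogorov's law
  applies. Tameness, which is almost sure, is added to the event to make it measurable.\<close>

lemma growth_zero_one:
  assumes "\<not> (AE \<omega> in M. growth g b (Xs \<omega>))"
  shows "AE \<omega> in M. \<not> growth g b (Xs \<omega>)"
proof -
  define B where "B = {\<omega> \<in> space M. tame (Xs \<omega>) \<and> growth g b (Xs \<omega>)}"
  \<comment> \<open>Kolmogorov's law is indexed from \<open>0\<close> and the independent family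
    from \<open>1\<close>; hence the shift. \<open>A i\<close> with \<open>i \<ge> n\<close> carries
    exactly the coefficients that \<open>tail n\<close> keeps.\<close>
  define A where "A i = sigma_sets (space M) {X (Suc i) -` S \<inter> space M | S. S \<in> sets borel}" for i
  have B: "B \<in> events"
    unfolding B_def by (rule sets_tame_growth[where Y = X, OF measurable_X])
  have "B \<in> tail_events A"
    unfolding tail_events_def
  proof
    fix n
    define N where "N = sigma (space M) (\<Union>i\<in>{n..}. A i)"
    have sub: "(\<Union>i\<in>{n..}. A i) \<subseteq> Pow (space M)"
      unfolding A_def by (auto dest: sigma_sets_into_sp[rotated])
    have sp: "space N = space M" and st: "sets N = sigma_sets (space M) (\<Union>i\<in>{n..}. A i)"
      using sub by (auto simp: N_def)
    have meas: "(\<lambda>\<omega>. tail n (Xs \<omega>) k) \<in> borel_measurable N" for k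
    proof (cases "k \<le> n")
      case False
      then obtain i where i: "k = Suc i" "i \<ge> n"
        by (cases k) auto
      have "X k \<in> borel_measurable N"
      proof (rule measurableI)
        fix S :: "complex set"
        assume "S \<in> sets borel"
        then have "X k -` S \<inter> space M \<in> A i"
          unfolding A_def i(1) by (intro sigma_sets.Basic) auto
        then show "X k -` S \<inter> space N \<in> sets N"
          unfolding sp st using i(2) by (intro sigma_sets.Basic) auto
      qed auto
      then show ?thesis
        using False by (simp add: tail_def)
    qed (simp add: tail_def)
    \<comment> \<open>Invariance under \<open>tail n\<close> describes \<open>B\<close> by
      coefficients that are measurable for \<open>N\<close>.\<close>
    have "B = {\<omega> \<in> space N. tame (tail n (Xs \<omega>)) \<and> growth g b (tail n (Xs \<omega>))}"
      unfolding B_def sp using tame_tail_iff growth_tail_iff by blast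
    also have "\<dots> \<in> sets N"
      using sets_tame_growth[where Y = "\<lambda>k \<omega>. tail n (Xs \<omega>) k" and N = N, OF meas] .
    finally show "B \<in> sigma_sets (space M) (\<Union>i\<in>{n..}. A i)"
      unfolding st .
  qed
  moreover have "sigma_algebra (space M) (A i)" for i
    unfolding A_def by (rule sigma_algebra_sigma_sets) auto
  moreover have "indep_sets A UNIV"
  proof -
    define F where "F k = sigma_sets (space M) {X k -` S \<inter> space M | S. S \<in> sets borel}" for k
    have F: "indep_sets F {1..}"
      using indep unfolding indep_vars_def F_def by blast
    have "prob (\<Inter>j\<in>J. D j) = (\<Prod>j\<in>J. prob (D j))"
      if J: "J \<noteq> {}" "finite J" "D \<in> Pi J A" for J D
    proof -
      have "prob (\<Inter>k\<in>Suc ` J. D (k - 1)) = (\<Prod>k\<in>Suc ` J. prob (D (k - 1)))"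
        by (rule indep_setsD[OF F]) (use J in \<open>auto simp: A_def F_def\<close>)
      then show ?thesis
        by (simp add: prod.reindex)
    qed
    moreover have "A i \<subseteq> events" for i
      using F unfolding indep_sets_def A_def F_def by auto
    ultimately show ?thesis
      unfolding indep_sets_def by blast
  qed
  ultimately have "prob B = 0 \<or> prob B = 1"
    by (intro kolmogorov_0_1_law[of A]) auto
  moreover have "prob B \<noteq> 1"
  proof
    assume "prob B = 1"
    then have "AE \<omega> in M. \<omega> \<in> B"
      using B by (simp add: prob_eq_1)
    then have "AE \<omega> in M. growth g b (Xs \<omega>)"
      by eventually_elim (simp add: B_def)
    with assms show False ..
  qed
  ultimately have "AE \<omega> in M. \<omega> \<notin> B"
    using B by (simp add: prob_eq_0)
  with AE_tame AE_space show ?thesis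
    by eventually_elim (simp add: B_def)
qed

end

section \<open>The truncated second moment\<close>

lemma abel_sum_bound:
  fixes b f :: "nat \<Rightarrow> real"
  assumes b: "decseq b" "\<And>i. 0 \<le> b i" and f: "\<And>k. \<bar>\<Sum>i<k. f i\<bar> \<le> B"
  shows "\<bar>\<Sum>i<n. b i * f i\<bar> \<le> b 0 * B"
proof -
  have parts: "(\<Sum>i<n. b i * f i) = b n * (\<Sum>i<n. f i) + (\<Sum>i<n. (b i - b (Suc i)) * (\<Sum>l<Suc i. f l))"
    by (induction n) (simp_all add: algebra_simps)
  have "\<bar>\<Sum>i<n. b i * f i\<bar> \<le> \<bar>b n * (\<Sum>i<n. f i)\<bar> + \<bar>\<Sum>i<n. (b i - b (Suc i)) * (\<Sum>l<Suc i. f l)\<bar>"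
    unfolding parts by (rule abs_triangle_ineq)
  also have "\<dots> \<le> b n * B + (\<Sum>i<n. (b i - b (Suc i)) * B)"
  proof (rule add_mono)
    show "\<bar>b n * (\<Sum>i<n. f i)\<bar> \<le> b n * B"
      using b f by (simp add: abs_mult mult_left_mono)
    show "\<bar>\<Sum>i<n. (b i - b (Suc i)) * (\<Sum>l<Suc i. f l)\<bar> \<le> (\<Sum>i<n. (b i - b (Suc i)) * B)"
    proof (intro order_trans[OF sum_abs] sum_mono)
      fix i
      have "b (Suc i) \<le> b i"
        using b(1) by (simp add: decseq_Suc_iff)
      then show "\<bar>(b i - b (Suc i)) * (\<Sum>l<Suc i. f l)\<bar> \<le> (b i - b (Suc i)) * B"
        using f[of "Suc i"] by (simp add: abs_mult mult_left_mono del: sum.lessThan_Suc)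
    qed
  qed
  also have "\<dots> = b 0 * B"
    unfolding sum_distrib_right[symmetric] sum_lessThan_telescope' by (simp add: algebra_simps)
  finally show ?thesis .
qed

text \<open>Mean value theorem: since \<open>1 < pi / 3\<close>, the cosine is at least
  \<open>cos (pi / 3) = 1 / 2\<close> on the unit interval.\<close>

lemma abs_sin_ge_half:
  fixes d :: real
  assumes "\<bar>d\<bar> \<le> 1"
  shows "\<bar>d\<bar> / 2 \<le> \<bar>sin d\<bar>"
proof -
  have pos: "y / 2 \<le> sin y" if y: "0 < y" "y \<le> 1" for y :: real
  proof -
    obtain c where c: "0 < c" "c < y" "sin y - sin 0 = (y - 0) * cos c"
      using MVT2[of 0 y sin cos] y by (auto simp: DERIV_sin)
    have "c \<le> pi / 3"
      using c y pi_gt3 by linarith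
    then have "cos (pi / 3) \<le> cos c"
      using c by (intro cos_monotone_0_pi_le) auto
    then have "y * (1 / 2) \<le> y * cos c"
      using y by (intro mult_left_mono) (auto simp: cos_60)
    then show ?thesis
      using c by simp
  qed
  show ?thesis
    using pos[of d] pos[of "- d"] assms by (cases d "0::real" rule: linorder_cases) auto
qed

text \<open>A geometric series with numerator at most \<open>2\<close> and denominator
  \<open>cis d - 1\<close> of modulus at least \<open>|d| / 2\<close>. The offset \<open>l\<close>
  lets the sum start at any frequency.\<close>

lemma cos_sum_bound:
  assumes d: "d \<noteq> 0" "\<bar>d\<bar> \<le> 1"
  shows "\<bar>\<Sum>i<k. cos (real (l + i) * d)\<bar> \<le> 4 / \<bar>d\<bar>"
proof -
  have ne: "\<bar>d\<bar> / 2 \<le> cmod (cis d - 1)"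
    using abs_sin_ge_half[OF d(2)] abs_Im_le_cmod[of "cis d - 1"] by simp
  have "(\<Sum>i<k. cos (real (l + i) * d)) = Re (\<Sum>i<k. cis (real (l + i) * d))"
    by simp
  also have "(\<Sum>i<k. cis (real (l + i) * d)) = cis (real l * d) * (\<Sum>i<k. cis d ^ i)"
    by (simp add: sum_distrib_left Complex.DeMoivre cis_mult distrib_right)
  also have "(\<Sum>i<k. cis d ^ i) = (cis d ^ k - 1) / (cis d - 1)"
    using ne d by (intro geometric_sum) auto
  finally have "\<bar>\<Sum>i<k. cos (real (l + i) * d)\<bar> \<le> cmod (cis (real l * d) * ((cis d ^ k - 1) / (cis d - 1)))"
    using abs_Re_le_cmod by simp
  also have "\<dots> = cmod (cis d ^ k - 1) / cmod (cis d - 1)"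
    by (simp add: norm_mult norm_divide)
  also have "\<dots> \<le> 2 / (\<bar>d\<bar> / 2)"
  proof (rule frac_le)
    show "cmod (cis d ^ k - 1) \<le> 2"
      using norm_triangle_ineq4[of "cis d ^ k" 1] by (simp add: norm_power)
  qed (use ne d in auto)
  finally show ?thesis
    by simp
qed

text \<open>Decorrelation: beyond frequency \<open>1 / |d|\<close> the phases at two points at
  distance \<open>|d|\<close> oscillate against each other, and summation by parts bounds their
  covariance uniformly in \<open>\<rho>\<close> and \<open>n\<close>.\<close>

lemma cos_series_tail_bound:
  fixes \<rho> :: real
  assumes \<rho>: "0 \<le> \<rho>" "\<rho> \<le> 1" and d: "\<bar>d\<bar> \<le> 1" "1 \<le> real m * \<bar>d\<bar>"
  shows "\<bar>\<Sum>k\<in>{m<..n}. \<rho> ^ k / real k * cos (real k * d)\<bar> \<le> 4"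
proof -
  have d0: "d \<noteq> 0"
    using d by auto
  let ?b = "\<lambda>i. \<rho> ^ (Suc m + i) / real (Suc m + i)"
  have "(\<Sum>k\<in>{m<..n}. \<rho> ^ k / real k * cos (real k * d)) = (\<Sum>i<n - m. ?b i * cos (real (Suc m + i) * d))"
    by (rule sum.reindex_bij_witness[of _ "\<lambda>i. Suc m + i" "\<lambda>k. k - Suc m"]) auto
  also have "\<bar>\<dots>\<bar> \<le> ?b 0 * (4 / \<bar>d\<bar>)"
  proof (rule abel_sum_bound)
    show "decseq ?b"
      using \<rho> by (intro decseq_SucI frac_le power_decreasing) auto
  next
    show "\<bar>\<Sum>i<k. cos (real (Suc m + i) * d)\<bar> \<le> 4 / \<bar>d\<bar>" for k
      by (rule cos_sum_bound[OF d0 d(1)])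
  qed (use \<rho> in auto)
  also have "\<dots> \<le> 1 / real (Suc m) * (4 / \<bar>d\<bar>)"
    using \<rho> power_le_one[of \<rho> "Suc m"] by (intro mult_right_mono) (simp_all add: divide_right_mono)
  also have "\<dots> \<le> 4"
  proof -
    have "1 \<le> real (Suc m) * \<bar>d\<bar>"
      using d by (simp add: distrib_right)
    then show ?thesis
      using d0 by (simp add: divide_simps)
  qed
  finally show ?thesis .
qed

lemma logsum_nonneg: "0 \<le> \<rho> \<Longrightarrow> 0 \<le> logsum \<rho> n"
  unfolding logsum_def by (intro sum_nonneg) auto

text \<open>The variance up to frequency \<open>2 ^ j\<close> is at most a harmonic number, and
  harmonic numbers minus logarithms decrease from the value \<open>1\<close>. The bound is uniform
  in the radius.\<close>

lemma logsum_le_ln: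
  assumes \<rho>: "0 \<le> \<rho>" "\<rho> \<le> 1"
  shows "logsum \<rho> (min (2 ^ j) n) \<le> 1 + real j * ln 2"
proof -
  have "logsum \<rho> (min (2 ^ j) n) \<le> logsum \<rho> (2 ^ j)"
    unfolding logsum_def using \<rho> by (intro sum_mono2) auto
  also have "\<dots> \<le> (\<Sum>k=1..2 ^ j. 1 / real k)"
    unfolding logsum_def using \<rho> by (intro sum_mono divide_right_mono power_le_one) auto
  also have "\<dots> = harm (2 ^ j)"
    by (simp add: harm_def inverse_eq_divide)
  also have "\<dots> \<le> 1 + ln (real (2 ^ j))"
  proof -
    have "harm (Suc (2 ^ j - 1)) - ln (real (Suc (2 ^ j - 1))) \<le> harm (Suc 0) - ln (real (Suc 0))"
      using decseqD[OF decseq_harm_diff_ln, of 0 "2 ^ j - 1"] by simp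
    then show ?thesis
      by (simp add: harm_def)
  qed
  finally show ?thesis
    by (simp add: ln_realpow)
qed

lemma ex_dyadic_scale:
  fixes d :: real
  assumes "0 < d" "d \<le> 1"
  obtains j :: nat where "1 \<le> 2 ^ j * d" "2 ^ j * d \<le> 2"
proof -
  define l where "l = log 2 (1 / d)"
  have l: "0 \<le> l" "2 powr l = 1 / d"
    using assms by (auto simp: l_def)
  define j where "j = nat \<lceil>l\<rceil>"
  have j: "l \<le> real j" "real j \<le> l + 1"
    using l(1) unfolding j_def by linarith+
  have "1 / d \<le> 2 ^ j"
    unfolding l(2)[symmetric] using j(1) by (simp add: powr_realpow[symmetric])
  moreover have "2 powr real j \<le> 2 powr (l + 1)"
    using j(2) by simp
  then have "2 ^ j \<le> 1 / d * 2"
    by (simp add: powr_add l(2) powr_realpow)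
  ultimately show ?thesis
    using assms by (intro that[of j]) (simp_all add: field_simps)
qed

text \<open>Two one-sided copies of the integral over the unit interval cover both sides of
  \<open>t\<close>. The condition \<open>\<beta> < 1\<close> is where subcriticality is eventually
  spent.\<close>

lemma nn_integral_powr_distance:
  fixes t \<beta> :: real
  assumes t: "t \<in> {0..1}" and \<beta>: "0 \<le> \<beta>" "\<beta> < 1"
  shows "(\<integral>\<^sup>+u. ennreal (\<bar>t - u\<bar> powr (- \<beta>)) * indicator {0..1} u \<partial>lborel) \<le> ennreal (2 / (1 - \<beta>))"
proof -
  let ?p = "\<lambda>s::real. ennreal (s powr (- \<beta>)) * indicator {0..1} s"
  have p: "(\<integral>\<^sup>+s. ?p s \<partial>lborel) = ennreal (1 / (1 - \<beta>))"
    using nn_integral_has_integral_lebesgue'[OF _ has_integral_powr_from_0[of "- \<beta>" 1]] \<beta> by simp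
  have "(\<integral>\<^sup>+u. ennreal (\<bar>t - u\<bar> powr (- \<beta>)) * indicator {0..1} u \<partial>lborel) \<le>
      (\<integral>\<^sup>+u. ?p (t + (-1) * u) + ?p (- t + 1 * u) \<partial>lborel)"
    using t by (intro nn_integral_mono) (auto simp: indicator_def abs_if)
  also have "\<dots> = (\<integral>\<^sup>+u. ?p (t + (-1) * u) \<partial>lborel) + (\<integral>\<^sup>+u. ?p (- t + 1 * u) \<partial>lborel)"
    by (rule nn_integral_add) measurable
  also have "(\<integral>\<^sup>+u. ?p (t + (-1) * u) \<partial>lborel) = (\<integral>\<^sup>+s. ?p s \<partial>lborel)"
    using nn_integral_real_affine[of ?p "-1" t] by simp
  also have "(\<integral>\<^sup>+u. ?p (- t + 1 * u) \<partial>lborel) = (\<integral>\<^sup>+s. ?p s \<partial>lborel)"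
    using nn_integral_real_affine[of ?p 1 "- t"] by simp
  also have "(\<integral>\<^sup>+s. ?p s \<partial>lborel) + (\<integral>\<^sup>+s. ?p s \<partial>lborel) = ennreal (2 / (1 - \<beta>))"
    unfolding p using \<beta> by (simp add: ennreal_plus[symmetric] del: ennreal_plus)
  finally show ?thesis .
qed

lemma cmod_sq_cis_add: "(cmod (cis a + cis b))\<^sup>2 = 2 + 2 * cos (a - b)"
  by (simp add: cmod_power2 power2_sum cos_diff sin_squared_eq algebra_simps)

section \<open>Exponential moments with two truncations and at two points\<close>

context gaussian_coefficients
begin

text \<open>Frequencies up to \<open>p\<close> carry the factor \<open>c + d\<close> and the others
  \<open>c\<close>; the extra variance is
  \<open>((c + d)^2 - c^2) / 4 = c * d / 2 + d^2 / 4\<close>.\<close>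

lemma nn_integral_exp_gpart_pair:
  assumes p: "p \<le> n"
  shows "(\<integral>\<^sup>+\<omega>. ennreal (exp (c * Re (gpart n (Xs \<omega>) z) + d * Re (gpart p (Xs \<omega>) z))) \<partial>M) =
    ennreal (exp (c\<^sup>2 / 4 * logsum ((cmod z)\<^sup>2) n + (c * d / 2 + d\<^sup>2 / 4) * logsum ((cmod z)\<^sup>2) p))"
proof -
  define a where "a k = of_real (c + (if k \<le> p then d else 0)) * (z ^ k / of_real (sqrt (real k)))" for k
  have split: "(\<Sum>k=1..n. f k) = (\<Sum>k=1..p. f k) + (\<Sum>k=Suc p..n. f k)" for f :: "nat \<Rightarrow> real"
    using p by (subst sum.union_disjoint[symmetric]) (auto intro!: sum.cong)
  have "c * Re (gpart n (Xs \<omega>) z) + d * Re (gpart p (Xs \<omega>) z) = (\<Sum>k\<in>{1..n}. Re (a k * X k \<omega>))" for \<omega>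
  proof -
    let ?f = "\<lambda>k. Re (z ^ k / of_real (sqrt (real k)) * X k \<omega>)"
    have "(\<Sum>k\<in>{1..n}. Re (a k * X k \<omega>)) = (\<Sum>k=1..n. (c + (if k \<le> p then d else 0)) * ?f k)"
    proof (rule sum.cong[OF refl])
      have re: "Re (of_real y * w) = y * Re w" for y w
        by simp
      show "Re (a k * X k \<omega>) = (c + (if k \<le> p then d else 0)) * ?f k" for k
        unfolding a_def mult.assoc re ..
    qed
    also have "\<dots> = c * (\<Sum>k=1..n. ?f k) + (\<Sum>k=1..n. if k \<le> p then d * ?f k else 0)"
    proof -
      have "(c + (if k \<le> p then d else 0)) * y = c * y + (if k \<le> p then d * y else 0)" for k y
        by (simp add: distrib_right)
      then show ?thesis
        by (simp only: sum.distrib sum_distrib_left)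
    qed
    also have "(\<Sum>k=1..n. if k \<le> p then d * ?f k else 0) = d * (\<Sum>k=1..p. ?f k)"
      unfolding split sum_distrib_left by simp
    finally show ?thesis
      by (simp only: gpart_def Re_sum)
  qed
  moreover have "(\<Sum>k\<in>{1..n}. (cmod (a k))\<^sup>2 / 4) =
      c\<^sup>2 / 4 * logsum ((cmod z)\<^sup>2) n + (c * d / 2 + d\<^sup>2 / 4) * logsum ((cmod z)\<^sup>2) p"
  proof -
    let ?l = "\<lambda>k. ((cmod z)\<^sup>2) ^ k / real k"
    have "(cmod (a k))\<^sup>2 / 4 = (c + (if k \<le> p then d else 0))\<^sup>2 / 4 * ?l k" for k
      unfolding a_def norm_mult power_mult_distrib
      by (simp add: norm_divide norm_power power_divide power_mult[symmetric] mult.commute del: of_real_add)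
    then have "(\<Sum>k\<in>{1..n}. (cmod (a k))\<^sup>2 / 4) = (\<Sum>k=1..n. (c + (if k \<le> p then d else 0))\<^sup>2 / 4 * ?l k)"
      by (simp only:)
    also have "\<dots> = c\<^sup>2 / 4 * (\<Sum>k=1..n. ?l k) + (\<Sum>k=1..n. if k \<le> p then (c * d / 2 + d\<^sup>2 / 4) * ?l k else 0)"
      unfolding sum_distrib_left sum.distrib[symmetric]
      by (rule sum.cong) (auto simp: power2_sum add_divide_distrib distrib_right)
    also have "(\<Sum>k=1..n. if k \<le> p then (c * d / 2 + d\<^sup>2 / 4) * ?l k else 0) = (c * d / 2 + d\<^sup>2 / 4) * (\<Sum>k=1..p. ?l k)"
      unfolding split sum_distrib_left by simp
    finally show ?thesis
      by (simp only: logsum_def)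
  qed
  ultimately show ?thesis
    using nn_integral_exp_linear[of "{1..n}" a] by simp
qed

text \<open>With the low frequencies at \<open>t\<close> subtracted, those at \<open>u\<close> stand
  alone and add a single \<open>logsum (r^2) p\<close>. Above \<open>p\<close> both points
  contribute, and \<open>(cmod (cis a + cis b))^2 = 2 + 2 * cos (a - b)\<close> produces the
  covariance sum.\<close>

lemma nn_integral_exp_gpart_two_points:
  assumes p: "p \<le> n" and r: "0 \<le> r"
  shows "(\<integral>\<^sup>+\<omega>. ennreal (exp (2 * g * (Re (gpart n (Xs \<omega>) (of_real r * cis t)) +
        Re (gpart n (Xs \<omega>) (of_real r * cis u)) - Re (gpart p (Xs \<omega>) (of_real r * cis t))))) \<partial>M) =
    ennreal (exp (g\<^sup>2 * (2 * logsum (r\<^sup>2) n - logsum (r\<^sup>2) p +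
        2 * (\<Sum>k\<in>{p<..n}. (r\<^sup>2) ^ k / real k * cos (real k * (t - u))))))"
proof -
  define a where "a k = of_real (2 * g * r ^ k / sqrt (real k)) *
      ((if k \<le> p then 0 else cis (real k * t)) + cis (real k * u))" for k
  have split: "(\<Sum>k=1..n. f k) = (\<Sum>k=1..p. f k) + (\<Sum>k\<in>{p<..n}. f k)" for f :: "nat \<Rightarrow> real"
    using p by (subst sum.union_disjoint[symmetric]) (auto intro!: sum.cong)
  have "2 * g * (Re (gpart n (Xs \<omega>) (of_real r * cis t)) +
        Re (gpart n (Xs \<omega>) (of_real r * cis u)) - Re (gpart p (Xs \<omega>) (of_real r * cis t))) =
      (\<Sum>k\<in>{1..n}. Re (a k * X k \<omega>))" for \<omega>
  proof -
    let ?f = "\<lambda>v k. Re ((of_real r * cis v) ^ k / of_real (sqrt (real k)) * X k \<omega>)"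
    have f: "2 * g * ?f v k = Re (of_real (2 * g * r ^ k / sqrt (real k)) * cis (real k * v) * X k \<omega>)" for v k
    proof -
      have "of_real (2 * g * r ^ k / sqrt (real k)) * cis (real k * v) * X k \<omega> =
          of_real (2 * g) * ((of_real r * cis v) ^ k / of_real (sqrt (real k)) * X k \<omega>)"
        by (simp add: power_mult_distrib Complex.DeMoivre)
      moreover have "2 * g * Re w = Re (of_real (2 * g) * w)" for w
        by simp
      ultimately show ?thesis
        by (simp only:)
    qed
    have "(\<Sum>k\<in>{1..n}. Re (a k * X k \<omega>)) = (\<Sum>k=1..n. (if k \<le> p then 0 else 2 * g * ?f t k) + 2 * g * ?f u k)"
      unfolding a_def f by (rule sum.cong) (auto simp: distrib_left distrib_right)
    also have "\<dots> = (\<Sum>k\<in>{p<..n}. 2 * g * ?f t k) + (\<Sum>k=1..n. 2 * g * ?f u k)"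
      unfolding sum.distrib split[of "\<lambda>k. if k \<le> p then 0 else 2 * g * ?f t k"] by simp
    also have "(\<Sum>k\<in>{p<..n}. 2 * g * ?f t k) = 2 * g * ((\<Sum>k=1..n. ?f t k) - (\<Sum>k=1..p. ?f t k))"
      unfolding split[of "?f t"] by (simp add: sum_distrib_left)
    also have "(\<Sum>k=1..n. 2 * g * ?f u k) = 2 * g * (\<Sum>k=1..n. ?f u k)"
      by (simp only: sum_distrib_left)
    finally show ?thesis
      unfolding gpart_def Re_sum by (simp only: algebra_simps)
  qed
  moreover have "(\<Sum>k\<in>{1..n}. (cmod (a k))\<^sup>2 / 4) =
      g\<^sup>2 * (2 * logsum (r\<^sup>2) n - logsum (r\<^sup>2) p +
        2 * (\<Sum>k\<in>{p<..n}. (r\<^sup>2) ^ k / real k * cos (real k * (t - u))))"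
  proof -
    let ?l = "\<lambda>k. (r\<^sup>2) ^ k / real k"
    have "(cmod (a k))\<^sup>2 / 4 = g\<^sup>2 * (?l k * (if k \<le> p then 1 else 2 + 2 * cos (real k * (t - u))))" for k
    proof -
      have 1: "(cmod ((if k \<le> p then 0 else cis (real k * t)) + cis (real k * u)))\<^sup>2 =
          (if k \<le> p then 1 else 2 + 2 * cos (real k * (t - u)))"
        by (simp add: cmod_sq_cis_add right_diff_distrib)
      have 2: "(cmod (complex_of_real (2 * g * r ^ k / sqrt (real k))))\<^sup>2 = 4 * g\<^sup>2 * ?l k"
        unfolding norm_of_real power2_abs
        by (simp add: power_mult_distrib power_divide power_mult[symmetric] mult.commute)
      show ?thesis
        unfolding a_def norm_mult power_mult_distrib 1 2 by simp
    qed
    then have "(\<Sum>k\<in>{1..n}. (cmod (a k))\<^sup>2 / 4) =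
        (\<Sum>k=1..n. g\<^sup>2 * (?l k * (if k \<le> p then 1 else 2 + 2 * cos (real k * (t - u)))))"
      by simp
    also have "\<dots> = g\<^sup>2 * ((\<Sum>k=1..p. ?l k) + (\<Sum>k\<in>{p<..n}. ?l k * (2 + 2 * cos (real k * (t - u)))))"
      unfolding sum_distrib_left[symmetric] split by simp
    also have "(\<Sum>k\<in>{p<..n}. ?l k * (2 + 2 * cos (real k * (t - u)))) =
        2 * (\<Sum>k\<in>{p<..n}. ?l k) + 2 * (\<Sum>k\<in>{p<..n}. ?l k * cos (real k * (t - u)))"
      unfolding sum_distrib_left sum.distrib[symmetric] by (rule sum.cong) (auto simp: algebra_simps)
    also have "(\<Sum>k\<in>{p<..n}. ?l k) = logsum (r\<^sup>2) n - logsum (r\<^sup>2) p"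
      unfolding logsum_def split[of ?l] by simp
    also have "(\<Sum>k=1..p. ?l k) = logsum (r\<^sup>2) p"
      by (simp only: logsum_def)
    finally show ?thesis
      by (simp add: algebra_simps)
  qed
  ultimately show ?thesis
    using nn_integral_exp_linear[of "{1..n}" a] by simp
qed

end

text \<open>From \<open>(a - 2 * K)^2 \<ge> 0\<close>. It replaces the Paley-Zygmund inequality:
  mean at least \<open>1 / 2\<close> and second moment at most \<open>K\<close> force the mean of
  \<open>min y K\<close> to be at least \<open>1 / 4\<close>, a statement that survives dominated
  limits.\<close>

lemma ennreal_le_min_plus_square:
  fixes y :: ennreal and K :: real
  assumes K: "K > 0"
  shows "y \<le> min y (ennreal K) + y * y * ennreal (1 / (4 * K))"
proof (cases y)
  case (real a)
  have "a \<le> min a K + a * a * (1 / (4 * K))"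
  proof (cases "a \<le> K")
    case False
    have "0 \<le> (a - 2 * K)\<^sup>2"
      by simp
    then have "4 * K * a \<le> 4 * K * K + a * a"
      by (simp add: power2_eq_square algebra_simps)
    then have "a \<le> K + a * a * (1 / (4 * K))"
      using K by (simp add: field_simps)
    then show ?thesis
      using False by simp
  qed (use K real in simp)
  then have "ennreal a \<le> ennreal (min a K + a * a * (1 / (4 * K)))"
    by (rule ennreal_leI)
  also have "\<dots> = ennreal (min a K) + ennreal (a * a * (1 / (4 * K)))"
    using K real by (intro ennreal_plus) auto
  also have "ennreal (a * a * (1 / (4 * K))) = ennreal (a * a) * ennreal (1 / (4 * K))"
    using K real by (intro ennreal_mult) auto
  also have "ennreal (a * a) = ennreal a * ennreal a"
    using real by (intro ennreal_mult) auto
  also have "ennreal (min a K) = min (ennreal a) (ennreal K)"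
    using K real by (auto simp: min_def ennreal_le_iff)
  finally show ?thesis
    by (simp only: real)
next
  case top
  then show ?thesis
    using K by (simp add: ennreal_top_mult)
qed

text \<open>The squared modulus of the chaos of the field truncated at frequency \<open>n\<close>,
  divided by its expectation.\<close>

definition weight :: "real \<Rightarrow> real \<Rightarrow> nat \<Rightarrow> (nat \<Rightarrow> complex) \<Rightarrow> real \<Rightarrow> real" where
  "weight g r n x t = exp (2 * g * Re (gpart n x (of_real r * cis t)) - g\<^sup>2 * logsum (r\<^sup>2) n)"

text \<open>Under the law tilted by \<open>weight\<close>, the field truncated at frequency \<open>2 ^ j\<close> has mean
  \<open>g * logsum (r\<^sup>2) (min (2 ^ j) n)\<close>; \<open>barrier\<close> bounds its deviations on all dyadic scales.\<close>

definition excess :: "real \<Rightarrow> real \<Rightarrow> real \<Rightarrow> nat \<Rightarrow> (nat \<Rightarrow> complex) \<Rightarrow> real \<Rightarrow> nat \<Rightarrow> real" where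
  "excess g e r n x t j = Re (gpart (min (2 ^ j) n) x (of_real r * cis t)) -
    g * logsum (r\<^sup>2) (min (2 ^ j) n) - e * real j * ln 2"

definition barrier :: "real \<Rightarrow> real \<Rightarrow> real \<Rightarrow> real \<Rightarrow> nat \<Rightarrow> (nat \<Rightarrow> complex) \<Rightarrow> real \<Rightarrow> bool" where
  "barrier g e B r n x t \<longleftrightarrow> (\<forall>j. exp (2 * e * excess g e r n x t j) \<le> B)"

definition barrier_weight :: "real \<Rightarrow> real \<Rightarrow> real \<Rightarrow> real \<Rightarrow> nat \<Rightarrow> (nat \<Rightarrow> complex) \<Rightarrow> real \<Rightarrow> ennreal" where
  "barrier_weight g e B r n x t = (if barrier g e B r n x t then ennreal (weight g r n x t) else 0)"

text \<open>An arc of length \<open>1\<close> instead of the whole circle keeps angle differences at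
  most \<open>1\<close>, as the oscillation bound requires; for a lower bound nothing is
  lost.\<close>

definition barrier_mass :: "real \<Rightarrow> real \<Rightarrow> real \<Rightarrow> real \<Rightarrow> nat \<Rightarrow> (nat \<Rightarrow> complex) \<Rightarrow> ennreal" where
  "barrier_mass g e B r n x = (\<integral>\<^sup>+t. barrier_weight g e B r n x t * indicator {0..1} t \<partial>lborel)"

text \<open>Twice the sum over all scales \<open>j\<close> of the bounds
  \<open>exp (e^2) * (2 powr (- (e^2))) ^ j\<close>, so that the union bound fails with weight at
  most \<open>1 / 2\<close>.\<close>

definition barrier_const :: "real \<Rightarrow> real" where
  "barrier_const e = 2 * (exp (e\<^sup>2) / (1 - 2 powr (- (e\<^sup>2))))"

lemma barrier_const_pos: "e \<noteq> 0 \<Longrightarrow> barrier_const e > 0"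
  unfolding barrier_const_def by (auto intro!: mult_pos_pos divide_pos_pos powr_less_one)

section \<open>First moment and two-point bound under the barrier\<close>

context gaussian_coefficients
begin

lemma measurable_gpart_circle [measurable]:
  "(\<lambda>p. gpart m (Xs (fst p)) (of_real r * cis (snd p))) \<in> borel_measurable (M \<Otimes>\<^sub>M lborel)"
proof (rule measurable_gpart[where Y = "\<lambda>k p. X k (fst p)"])
  show "(\<lambda>p. X k (fst p)) \<in> borel_measurable (M \<Otimes>\<^sub>M lborel)" if "k \<ge> 1" for k
    using measurable_X[OF that] by measurable
  have [measurable]: "cis \<in> borel_measurable borel"
    by (intro borel_measurable_continuous_onI continuous_intros)
  show "(\<lambda>p. of_real r * cis (snd p)) \<in> borel_measurable (M \<Otimes>\<^sub>M lborel)"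
    by measurable
qed

lemma measurable_gpart_point [measurable]: "(\<lambda>\<omega>. gpart m (Xs \<omega>) z) \<in> borel_measurable M"
  by (rule measurable_gpart[where Y = X, OF measurable_X]) auto

lemma measurable_barrier_weight [measurable]:
  "(\<lambda>(\<omega>, t). barrier_weight g e B r n (Xs \<omega>) t) \<in> borel_measurable (M \<Otimes>\<^sub>M lborel)"
  unfolding barrier_weight_def barrier_def excess_def weight_def split_beta by measurable

lemma measurable_barrier_weight_point [measurable]:
  "(\<lambda>\<omega>. barrier_weight g e B r n (Xs \<omega>) t) \<in> borel_measurable M"
  unfolding barrier_weight_def barrier_def excess_def weight_def by measurable

lemma measurable_barrier_mass [measurable]:
  "(\<lambda>\<omega>. barrier_mass g e B r n (Xs \<omega>)) \<in> borel_measurable M"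
  unfolding barrier_mass_def by measurable

lemma nn_integral_weight: "(\<integral>\<^sup>+\<omega>. ennreal (weight g r n (Xs \<omega>) t) \<partial>M) = 1"
proof -
  let ?z = "of_real r * cis t"
  have "(\<integral>\<^sup>+\<omega>. ennreal (weight g r n (Xs \<omega>) t) \<partial>M) =
      (\<integral>\<^sup>+\<omega>. ennreal (exp (2 * g * Re (gpart n (Xs \<omega>) ?z))) * ennreal (exp (- (g\<^sup>2 * logsum (r\<^sup>2) n))) \<partial>M)"
    by (simp add: weight_def exp_diff ennreal_mult[symmetric] exp_minus divide_inverse)
  also have "\<dots> = ennreal (exp ((2 * g)\<^sup>2 / 4 * logsum ((cmod ?z)\<^sup>2) n)) * ennreal (exp (- (g\<^sup>2 * logsum (r\<^sup>2) n)))"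
    by (subst nn_integral_multc) (simp_all add: nn_integral_exp_gpart)
  also have "\<dots> = 1"
    by (simp add: norm_mult power_mult_distrib ennreal_mult[symmetric] exp_add[symmetric])
  finally show ?thesis .
qed

text \<open>Chernoff bound under the tilted law, where the field at scale \<open>j\<close> has mean
  \<open>g * V\<close> and variance \<open>V / 2\<close> with \<open>V \<le> 1 + j * ln 2\<close>.
  The factor \<open>2 * e\<close> minimises \<open>l^2 * V / 4 - l * e * j * ln 2\<close> over
  \<open>l\<close> for \<open>V = j * ln 2\<close>.\<close>

lemma nn_integral_weight_excess:
  assumes r: "0 \<le> r" "r < 1"
  shows "(\<integral>\<^sup>+\<omega>. ennreal (weight g r n (Xs \<omega>) t * exp (2 * e * excess g e r n (Xs \<omega>) t j)) \<partial>M) \<le>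
    ennreal (exp (e\<^sup>2) * (2 powr (- (e\<^sup>2))) ^ j)"
proof -
  let ?z = "of_real r * cis t"
  let ?p = "min (2 ^ j) n"
  let ?V = "logsum (r\<^sup>2)"
  define c where "c = - (g\<^sup>2 * ?V n) - 2 * e * g * ?V ?p - 2 * e\<^sup>2 * real j * ln 2"
  have "(\<integral>\<^sup>+\<omega>. ennreal (weight g r n (Xs \<omega>) t * exp (2 * e * excess g e r n (Xs \<omega>) t j)) \<partial>M) =
      (\<integral>\<^sup>+\<omega>. ennreal (exp (2 * g * Re (gpart n (Xs \<omega>) ?z) + 2 * e * Re (gpart ?p (Xs \<omega>) ?z))) * ennreal (exp c) \<partial>M)"
    by (rule nn_integral_cong)
       (simp add: weight_def excess_def c_def exp_add[symmetric] ennreal_mult[symmetric] algebra_simps power2_eq_square)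
  also have "\<dots> = ennreal (exp ((2 * g)\<^sup>2 / 4 * ?V n + (2 * g * (2 * e) / 2 + (2 * e)\<^sup>2 / 4) * ?V ?p)) * ennreal (exp c)"
    using r by (subst nn_integral_multc) (simp_all add: nn_integral_exp_gpart_pair norm_mult)
  also have "\<dots> = ennreal (exp (e\<^sup>2 * ?V ?p - 2 * e\<^sup>2 * real j * ln 2))"
    by (simp add: ennreal_mult[symmetric] exp_add[symmetric] c_def algebra_simps power2_eq_square)
  also have "\<dots> \<le> ennreal (exp (e\<^sup>2 * (1 + real j * ln 2) - 2 * e\<^sup>2 * real j * ln 2))"
    using r by (intro ennreal_leI) (simp add: mult_left_mono logsum_le_ln power_le_one)
  also have "e\<^sup>2 * (1 + real j * ln 2) - 2 * e\<^sup>2 * real j * ln 2 = e\<^sup>2 + - (e\<^sup>2) * real j * ln 2"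
    by (simp add: algebra_simps)
  also have "exp (e\<^sup>2 + - (e\<^sup>2) * real j * ln 2) = exp (e\<^sup>2) * (2 powr (- (e\<^sup>2))) ^ j"
    unfolding exp_add by (simp add: powr_def exp_of_nat_mult[symmetric] mult_ac)
  finally show ?thesis .
qed

text \<open>Markov's inequality and a union bound over the scales: the weight lost outside the
  barrier has mean at most \<open>1 / 2\<close> out of \<open>1\<close>, by the choice of
  \<open>barrier_const\<close>.\<close>

lemma nn_integral_barrier_weight_ge:
  assumes r: "0 \<le> r" "r < 1" and e: "e \<noteq> 0"
  shows "ennreal (1 / 2) \<le> (\<integral>\<^sup>+\<omega>. barrier_weight g e (barrier_const e) r n (Xs \<omega>) t \<partial>M)"
proof -
  let ?B = "barrier_const e"
  let ?A = "\<integral>\<^sup>+\<omega>. barrier_weight g e ?B r n (Xs \<omega>) t \<partial>M"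
  let ?q = "2 powr (- (e\<^sup>2)) :: real"
  let ?Z = "\<lambda>j \<omega>. ennreal (weight g r n (Xs \<omega>) t * exp (2 * e * excess g e r n (Xs \<omega>) t j))"
  note B = barrier_const_pos[OF e]
  have q: "?q < 1"
    using e by (intro powr_less_one) auto
  have [measurable]: "?Z j \<in> borel_measurable M" for j
    unfolding weight_def excess_def by measurable
  have "1 = (\<integral>\<^sup>+\<omega>. ennreal (weight g r n (Xs \<omega>) t) \<partial>M)"
    by (simp add: nn_integral_weight)
  also have "\<dots> \<le> (\<integral>\<^sup>+\<omega>. barrier_weight g e ?B r n (Xs \<omega>) t + (\<Sum>j. ?Z j \<omega> * ennreal (1 / ?B)) \<partial>M)"
  proof (rule nn_integral_mono)
    fix \<omega>
    show "ennreal (weight g r n (Xs \<omega>) t) \<le> barrier_weight g e ?B r n (Xs \<omega>) t + (\<Sum>j. ?Z j \<omega> * ennreal (1 / ?B))"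
    proof (cases "barrier g e ?B r n (Xs \<omega>) t")
      case False
      then obtain j where j: "?B < exp (2 * e * excess g e r n (Xs \<omega>) t j)"
        by (auto simp: barrier_def not_le)
      have "weight g r n (Xs \<omega>) t * 1 \<le> weight g r n (Xs \<omega>) t * (exp (2 * e * excess g e r n (Xs \<omega>) t j) * (1 / ?B))"
        using j B by (intro mult_left_mono) (auto simp: weight_def field_simps)
      then have "ennreal (weight g r n (Xs \<omega>) t) \<le> ?Z j \<omega> * ennreal (1 / ?B)"
        using B by (simp add: ennreal_mult'[symmetric] weight_def mult.assoc)
      also have "\<dots> \<le> (\<Sum>j. ?Z j \<omega> * ennreal (1 / ?B))"
        using sum_le_suminf[of "\<lambda>j. ?Z j \<omega> * ennreal (1 / ?B)" "{j}"] by simp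
      finally show ?thesis
        by (simp add: barrier_weight_def False)
    qed (simp add: barrier_weight_def)
  qed
  also have "\<dots> = ?A + (\<Sum>j. \<integral>\<^sup>+\<omega>. ?Z j \<omega> * ennreal (1 / ?B) \<partial>M)"
  proof -
    have "(\<integral>\<^sup>+\<omega>. (\<Sum>j. ?Z j \<omega> * ennreal (1 / ?B)) \<partial>M) = (\<Sum>j. \<integral>\<^sup>+\<omega>. ?Z j \<omega> * ennreal (1 / ?B) \<partial>M)"
      by (rule nn_integral_suminf) measurable
    then show ?thesis
      by (subst nn_integral_add) measurable
  qed
  also have "\<dots> \<le> ?A + (\<Sum>j. ennreal (exp (e\<^sup>2) / ?B * ?q ^ j))"
  proof (intro add_left_mono suminf_le)
    fix j
    have "(\<integral>\<^sup>+\<omega>. ?Z j \<omega> * ennreal (1 / ?B) \<partial>M) = (\<integral>\<^sup>+\<omega>. ?Z j \<omega> \<partial>M) * ennreal (1 / ?B)"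
      by (rule nn_integral_multc) measurable
    also have "\<dots> \<le> ennreal (exp (e\<^sup>2) * ?q ^ j) * ennreal (1 / ?B)"
      by (intro mult_right_mono nn_integral_weight_excess r) auto
    also have "\<dots> = ennreal (exp (e\<^sup>2) / ?B * ?q ^ j)"
      using B by (simp add: ennreal_mult'[symmetric] mult_ac)
    finally show "(\<integral>\<^sup>+\<omega>. ?Z j \<omega> * ennreal (1 / ?B) \<partial>M) \<le> ennreal (exp (e\<^sup>2) / ?B * ?q ^ j)" .
  qed auto
  also have "(\<Sum>j. ennreal (exp (e\<^sup>2) / ?B * ?q ^ j)) = ennreal (\<Sum>j. exp (e\<^sup>2) / ?B * ?q ^ j)"
    using q B by (intro suminf_ennreal2 summable_mult summable_geometric) auto
  also have "(\<Sum>j. exp (e\<^sup>2) / ?B * ?q ^ j) = exp (e\<^sup>2) / ?B * (1 / (1 - ?q))"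
    using q by (subst suminf_mult) (auto simp: suminf_geometric intro!: summable_geometric)
  also have "\<dots> = 1 / 2"
    using q e by (simp add: barrier_const_def)
  finally have "1 \<le> ?A + ennreal (1 / 2)" .
  then show ?thesis
  proof (cases ?A)
    case (real a)
    then have "ennreal 1 \<le> ennreal (a + 1 / 2)"
      using \<open>1 \<le> ?A + ennreal (1 / 2)\<close> by simp
    then have "1 \<le> a + 1 / 2"
      using real(1) by (subst (asm) ennreal_le_iff) auto
    then show ?thesis
      unfolding real(2) by (intro ennreal_leI) linarith
  qed simp
qed

text \<open>At the scale \<open>2 ^ j\<close> comparable to \<open>1 / |t - u|\<close>, the barrier
  at \<open>t\<close> lets the low-frequency factor there be replaced by its upper bound. The shared
  frequencies then cost \<open>g^2 * j * ln 2\<close> from \<open>u\<close> plus the slack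
  \<open>2 * g * e * j * ln 2\<close>, instead of \<open>2 * g^2 * j * ln 2\<close>.\<close>

lemma nn_integral_barrier_weight_pair_le:
  assumes r: "0 \<le> r" "r < 1" and e: "e > 0" and g: "g > 0" and B: "B > 0"
    and tu: "t \<noteq> u" "\<bar>t - u\<bar> \<le> 1"
  shows "(\<integral>\<^sup>+\<omega>. barrier_weight g e B r n (Xs \<omega>) t * barrier_weight g e B r n (Xs \<omega>) u \<partial>M) \<le>
    ennreal (B powr (g / e) * exp (9 * g\<^sup>2) * 2 powr (g\<^sup>2 + 2 * g * e) * \<bar>t - u\<bar> powr (- (g\<^sup>2 + 2 * g * e)))"
proof -
  define \<beta> where "\<beta> = g\<^sup>2 + 2 * g * e"
  have \<beta>: "\<beta> \<ge> 0"
    using g e by (simp add: \<beta>_def)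
  obtain j :: nat where j: "1 \<le> 2 ^ j * \<bar>t - u\<bar>" "2 ^ j * \<bar>t - u\<bar> \<le> 2"
    using ex_dyadic_scale[of "\<bar>t - u\<bar>"] tu by auto
  let ?p = "min (2 ^ j) n"
  let ?V = "logsum (r\<^sup>2)"
  let ?K = "\<Sum>k\<in>{?p<..n}. (r\<^sup>2) ^ k / real k * cos (real k * (t - u))"
  let ?h = "\<lambda>m v \<omega>. Re (gpart m (Xs \<omega>) (of_real r * cis v))"
  define c where "c = - 2 * g\<^sup>2 * ?V n + 2 * g\<^sup>2 * ?V ?p + 2 * g * e * real j * ln 2"
  \<comment> \<open>If \<open>2 ^ j > n\<close>, then \<open>?p = n\<close> and the sum is
    empty.\<close>
  have K: "?K \<le> 4"
  proof (cases "2 ^ j \<le> n")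
    case True
    then have p: "?p = 2 ^ j"
      by simp
    show ?thesis
      unfolding p
      by (rule order_trans[OF abs_ge_self cos_series_tail_bound]) (use r tu j in \<open>auto simp: power_le_one\<close>)
  qed simp
  have V: "?V ?p \<le> 1 + real j * ln 2"
    using r by (intro logsum_le_ln) (auto simp: power_le_one)
  have "(\<integral>\<^sup>+\<omega>. barrier_weight g e B r n (Xs \<omega>) t * barrier_weight g e B r n (Xs \<omega>) u \<partial>M) \<le>
      (\<integral>\<^sup>+\<omega>. ennreal (exp (2 * g * (?h n t \<omega> + ?h n u \<omega> - ?h ?p t \<omega>))) * ennreal (B powr (g / e) * exp c) \<partial>M)"
  proof (rule nn_integral_mono)
    fix \<omega>
    show "barrier_weight g e B r n (Xs \<omega>) t * barrier_weight g e B r n (Xs \<omega>) u \<le>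
        ennreal (exp (2 * g * (?h n t \<omega> + ?h n u \<omega> - ?h ?p t \<omega>))) * ennreal (B powr (g / e) * exp c)"
    proof (cases "barrier g e B r n (Xs \<omega>) t")
      case True
      let ?x = "excess g e r n (Xs \<omega>) t j"
      have "exp (2 * e * ?x) powr (g / e) \<le> B powr (g / e)"
        using True e g by (intro powr_mono2) (auto simp: barrier_def)
      then have "exp (2 * g * ?x) \<le> B powr (g / e)"
        using e by (simp add: exp_powr_real mult_ac)
      \<comment> \<open>A factor that is at least \<open>1\<close> on the barrier; inserting it
        cancels the low frequencies at \<open>t\<close> in the product of the weights.\<close>
      then have "1 \<le> B powr (g / e) * exp (- (2 * g * ?x))"
        by (simp add: exp_minus field_simps)
      then have "weight g r n (Xs \<omega>) t * weight g r n (Xs \<omega>) u * 1 \<le>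
          weight g r n (Xs \<omega>) t * weight g r n (Xs \<omega>) u * (B powr (g / e) * exp (- (2 * g * ?x)))"
        by (intro mult_left_mono) (auto simp: weight_def)
      also have "\<dots> = B powr (g / e) * (weight g r n (Xs \<omega>) t * weight g r n (Xs \<omega>) u * exp (- (2 * g * ?x)))"
        by (simp only: mult_ac)
      also have "weight g r n (Xs \<omega>) t * weight g r n (Xs \<omega>) u * exp (- (2 * g * ?x)) =
          exp (2 * g * (?h n t \<omega> + ?h n u \<omega> - ?h ?p t \<omega>)) * exp c"
        unfolding weight_def exp_add[symmetric] excess_def c_def by (simp add: algebra_simps power2_eq_square)
      finally have le: "weight g r n (Xs \<omega>) t * weight g r n (Xs \<omega>) u \<le>
          exp (2 * g * (?h n t \<omega> + ?h n u \<omega> - ?h ?p t \<omega>)) * (B powr (g / e) * exp c)"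
        by (simp only: mult_ac mult_1_right)
      have "barrier_weight g e B r n (Xs \<omega>) t * barrier_weight g e B r n (Xs \<omega>) u \<le>
          ennreal (weight g r n (Xs \<omega>) t) * ennreal (weight g r n (Xs \<omega>) u)"
        by (intro mult_mono) (auto simp: barrier_weight_def)
      also have "\<dots> = ennreal (weight g r n (Xs \<omega>) t * weight g r n (Xs \<omega>) u)"
        by (simp add: ennreal_mult weight_def)
      also have "\<dots> \<le> ennreal (exp (2 * g * (?h n t \<omega> + ?h n u \<omega> - ?h ?p t \<omega>)) * (B powr (g / e) * exp c))"
        by (rule ennreal_leI[OF le])
      finally show ?thesis
        by (subst (asm) ennreal_mult) auto
    qed (simp add: barrier_weight_def)
  qed
  also have "\<dots> = (\<integral>\<^sup>+\<omega>. ennreal (exp (2 * g * (?h n t \<omega> + ?h n u \<omega> - ?h ?p t \<omega>))) \<partial>M) * ennreal (B powr (g / e) * exp c)"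
    by (rule nn_integral_multc) measurable
  also have "\<dots> = ennreal (exp (g\<^sup>2 * (2 * ?V n - ?V ?p + 2 * ?K))) * ennreal (B powr (g / e) * exp c)"
    by (subst nn_integral_exp_gpart_two_points) (use r in auto)
  also have "\<dots> = ennreal (B powr (g / e) * exp (g\<^sup>2 * (2 * ?V n - ?V ?p + 2 * ?K) + c))"
    by (simp add: ennreal_mult[symmetric] exp_add mult_ac)
  also have "\<dots> \<le> ennreal (B powr (g / e) * (exp (9 * g\<^sup>2) * (2 powr \<beta> * \<bar>t - u\<bar> powr (- \<beta>))))"
  proof (intro ennreal_leI mult_left_mono)
    have "g\<^sup>2 * (2 * ?V n - ?V ?p + 2 * ?K) + c = g\<^sup>2 * (?V ?p + 2 * ?K) + 2 * g * e * real j * ln 2"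
      by (simp add: c_def algebra_simps)
    \<comment> \<open>The constant \<open>9\<close> is \<open>1\<close> from the variance bound plus
      \<open>2 * 4\<close> from the oscillating covariance.\<close>
    also have "\<dots> \<le> g\<^sup>2 * (1 + real j * ln 2 + 2 * 4) + 2 * g * e * real j * ln 2"
      using K V by (intro add_right_mono mult_left_mono add_mono) auto
    also have "\<dots> = 9 * g\<^sup>2 + \<beta> * (real j * ln 2)"
      by (simp add: \<beta>_def algebra_simps)
    finally have "exp (g\<^sup>2 * (2 * ?V n - ?V ?p + 2 * ?K) + c) \<le> exp (9 * g\<^sup>2) * exp (\<beta> * (real j * ln 2))"
      by (simp add: exp_add[symmetric])
    also have "exp (\<beta> * (real j * ln 2)) = (2 ^ j) powr \<beta>"
      by (simp add: powr_def ln_realpow)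
    also have "\<dots> \<le> (2 / \<bar>t - u\<bar>) powr \<beta>"
      using j tu \<beta> by (intro powr_mono2) (auto simp: field_simps)
    also have "\<dots> = 2 powr \<beta> * \<bar>t - u\<bar> powr (- \<beta>)"
      by (subst powr_divide) (simp_all add: powr_minus divide_inverse)
    finally show "exp (g\<^sup>2 * (2 * ?V n - ?V ?p + 2 * ?K) + c) \<le> exp (9 * g\<^sup>2) * (2 powr \<beta> * \<bar>t - u\<bar> powr (- \<beta>))"
      by simp
  qed auto
  finally show ?thesis
    by (simp only: \<beta>_def mult.assoc)
qed

end

section \<open>From the two moments to a lower bound on truncated means\<close>

context gaussian_coefficients
begin

lemma nn_integral_barrier_mass_ge:
  assumes r: "0 \<le> r" "r < 1" and e: "e \<noteq> 0"
  shows "ennreal (1 / 2) \<le> (\<integral>\<^sup>+\<omega>. barrier_mass g e (barrier_const e) r n (Xs \<omega>) \<partial>M)"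
proof -
  interpret P: pair_sigma_finite M lborel ..
  let ?w = "\<lambda>\<omega> t. barrier_weight g e (barrier_const e) r n (Xs \<omega>) t"
  have "ennreal (1 / 2) = (\<integral>\<^sup>+t. ennreal (1 / 2) * indicator {0..1::real} t \<partial>lborel)"
    by (subst nn_integral_cmult_indicator) auto
  also have "\<dots> \<le> (\<integral>\<^sup>+t. \<integral>\<^sup>+\<omega>. ?w \<omega> t * indicator {0..1} t \<partial>M \<partial>lborel)"
  proof (rule nn_integral_mono)
    fix t :: real
    show "ennreal (1 / 2) * indicator {0..1} t \<le> (\<integral>\<^sup>+\<omega>. ?w \<omega> t * indicator {0..1} t \<partial>M)"
      using nn_integral_barrier_weight_ge[OF r e, of g n t] by (cases "t \<in> {0..1}") auto
  qed
  also have "\<dots> = (\<integral>\<^sup>+\<omega>. barrier_mass g e (barrier_const e) r n (Xs \<omega>) \<partial>M)"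
    unfolding barrier_mass_def by (rule P.Fubini') measurable
  finally show ?thesis .
qed

lemma nn_integral_barrier_mass_square_le:
  assumes r: "0 \<le> r" "r < 1" and e: "e > 0" and g: "g > 0" and B: "B > 0"
    and \<beta>: "g\<^sup>2 + 2 * g * e < 1"
  shows "(\<integral>\<^sup>+\<omega>. barrier_mass g e B r n (Xs \<omega>) * barrier_mass g e B r n (Xs \<omega>) \<partial>M) \<le>
    ennreal (B powr (g / e) * exp (9 * g\<^sup>2) * 2 powr (g\<^sup>2 + 2 * g * e) * (2 / (1 - (g\<^sup>2 + 2 * g * e))))"
proof -
  interpret P: pair_sigma_finite M lborel ..
  define b where "b = g\<^sup>2 + 2 * g * e"
  define C where "C = B powr (g / e) * exp (9 * g\<^sup>2) * 2 powr b"
  have b: "0 \<le> b" "b < 1"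
    using e g \<beta> by (auto simp: b_def)
  have C: "0 \<le> C"
    by (simp add: C_def)
  let ?I = "indicator {0..1::real} :: real \<Rightarrow> ennreal"
  let ?w = "\<lambda>\<omega> t. barrier_weight g e B r n (Xs \<omega>) t"
  have point: "(\<lambda>t. barrier_weight g e B r n (Xs \<omega>) t) \<in> borel_measurable lborel" if "\<omega> \<in> space M" for \<omega>
    using measurable_compose_Pair1[OF that measurable_barrier_weight[of g e B r n]] by simp
  have "(\<integral>\<^sup>+\<omega>. barrier_mass g e B r n (Xs \<omega>) * barrier_mass g e B r n (Xs \<omega>) \<partial>M) =
      (\<integral>\<^sup>+\<omega>. \<integral>\<^sup>+t. (?w \<omega> t * ?I t) * barrier_mass g e B r n (Xs \<omega>) \<partial>lborel \<partial>M)"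
  proof (rule nn_integral_cong)
    fix \<omega>
    assume "\<omega> \<in> space M"
    note [measurable] = point[OF this]
    show "barrier_mass g e B r n (Xs \<omega>) * barrier_mass g e B r n (Xs \<omega>) =
        (\<integral>\<^sup>+t. (?w \<omega> t * ?I t) * barrier_mass g e B r n (Xs \<omega>) \<partial>lborel)"
      by (subst nn_integral_multc) (measurable, simp only: barrier_mass_def)
  qed
  also have "\<dots> = (\<integral>\<^sup>+t. \<integral>\<^sup>+\<omega>. (?w \<omega> t * ?I t) * barrier_mass g e B r n (Xs \<omega>) \<partial>M \<partial>lborel)"
    by (rule P.Fubini'[symmetric]) measurable
  also have "\<dots> \<le> (\<integral>\<^sup>+t. ennreal (C * (2 / (1 - b))) * ?I t \<partial>lborel)"
  proof (rule nn_integral_mono)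
    fix t :: real
    show "(\<integral>\<^sup>+\<omega>. (?w \<omega> t * ?I t) * barrier_mass g e B r n (Xs \<omega>) \<partial>M) \<le> ennreal (C * (2 / (1 - b))) * ?I t"
    proof (cases "t \<in> {0..1}")
      case True
      have "(\<integral>\<^sup>+\<omega>. (?w \<omega> t * ?I t) * barrier_mass g e B r n (Xs \<omega>) \<partial>M) =
          (\<integral>\<^sup>+\<omega>. \<integral>\<^sup>+u. ?w \<omega> t * ?w \<omega> u * ?I u \<partial>lborel \<partial>M)"
      proof (rule nn_integral_cong)
        fix \<omega>
        assume "\<omega> \<in> space M"
        note [measurable] = point[OF this]
        show "(?w \<omega> t * ?I t) * barrier_mass g e B r n (Xs \<omega>) = (\<integral>\<^sup>+u. ?w \<omega> t * ?w \<omega> u * ?I u \<partial>lborel)"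
          unfolding mult.assoc using True by (subst nn_integral_cmult) (measurable, simp add: barrier_mass_def)
      qed
      also have "\<dots> = (\<integral>\<^sup>+u. \<integral>\<^sup>+\<omega>. ?w \<omega> t * ?w \<omega> u * ?I u \<partial>M \<partial>lborel)"
        by (rule P.Fubini'[symmetric]) measurable
      also have "\<dots> \<le> (\<integral>\<^sup>+u. ennreal C * (ennreal (\<bar>t - u\<bar> powr (- b)) * ?I u) \<partial>lborel)"
      \<comment> \<open>The pair bound needs \<open>t \<noteq> u\<close>; the diagonal is a null
        set.\<close>
      proof (rule nn_integral_mono_AE)
        show "AE u in lborel. (\<integral>\<^sup>+\<omega>. ?w \<omega> t * ?w \<omega> u * ?I u \<partial>M) \<le> ennreal C * (ennreal (\<bar>t - u\<bar> powr (- b)) * ?I u)"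
          using AE_lborel_singleton[of t]
        proof eventually_elim
          case (elim u)
          show ?case
          proof (cases "u \<in> {0..1}")
            case u: True
            have "(\<integral>\<^sup>+\<omega>. ?w \<omega> t * ?w \<omega> u \<partial>M) \<le> ennreal (C * \<bar>t - u\<bar> powr (- b))"
              unfolding C_def b_def
              by (rule nn_integral_barrier_weight_pair_le[OF r e g B]) (use elim True u in auto)
            then show ?thesis
              using u C by (simp add: ennreal_mult)
          qed simp
        qed
      qed
      also have "\<dots> = ennreal C * (\<integral>\<^sup>+u. ennreal (\<bar>t - u\<bar> powr (- b)) * ?I u \<partial>lborel)"
        by (rule nn_integral_cmult) measurable
      also have "\<dots> \<le> ennreal C * ennreal (2 / (1 - b))"
        by (intro mult_left_mono nn_integral_powr_distance True b) auto
      also have "\<dots> = ennreal (C * (2 / (1 - b))) * ?I t"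
        using True C b by (simp add: ennreal_mult[symmetric])
      finally show ?thesis .
    qed simp
  qed
  also have "\<dots> = ennreal (C * (2 / (1 - b)))"
    by (subst nn_integral_cmult_indicator) auto
  finally show ?thesis
    by (simp only: C_def b_def)
qed

text \<open>The order of quantifiers matters: \<open>K\<close> depends on \<open>g\<close> alone, so
  first \<open>n\<close> and later \<open>r\<close> can be sent to their limits.\<close>

lemma nn_integral_min_weight_mass_ge:
  assumes g: "0 < g" "g < 1"
  obtains K :: real where "K > 0"
    "\<And>r n. 0 \<le> r \<Longrightarrow> r < 1 \<Longrightarrow> ennreal (1 / 4) \<le>
      (\<integral>\<^sup>+\<omega>. min (\<integral>\<^sup>+t. ennreal (weight g r n (Xs \<omega>) t) * indicator {0..2 * pi} t \<partial>lborel) (ennreal K) \<partial>M)"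
proof -
  \<comment> \<open>This makes \<open>2 * g * e\<close> half of the room \<open>1 - g^2\<close>, so
    the exponent is \<open>(1 + g^2) / 2 < 1\<close>.\<close>
  define e where "e = (1 - g\<^sup>2) / (4 * g)"
  have g2: "g\<^sup>2 < 1"
    using g by (simp add: power_less_one_iff)
  have e: "e > 0"
    using g g2 by (simp add: e_def)
  have \<beta>: "g\<^sup>2 + 2 * g * e < 1"
    using g g2 by (simp add: e_def field_simps)
  let ?B = "barrier_const e"
  note B = barrier_const_pos[of e]
  define K where "K = ?B powr (g / e) * exp (9 * g\<^sup>2) * 2 powr (g\<^sup>2 + 2 * g * e) * (2 / (1 - (g\<^sup>2 + 2 * g * e)))"
  have K: "K > 0"
    unfolding K_def using B e \<beta> by (auto intro!: mult_pos_pos divide_pos_pos)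
  have "ennreal (1 / 4) \<le>
      (\<integral>\<^sup>+\<omega>. min (\<integral>\<^sup>+t. ennreal (weight g r n (Xs \<omega>) t) * indicator {0..2 * pi} t \<partial>lborel) (ennreal K) \<partial>M)"
    if r: "0 \<le> r" "r < 1" for r n
  proof -
    let ?m = "\<lambda>\<omega>. barrier_mass g e ?B r n (Xs \<omega>)"
    let ?A = "\<integral>\<^sup>+\<omega>. min (?m \<omega>) (ennreal K) \<partial>M"
    have "ennreal (1 / 2) \<le> (\<integral>\<^sup>+\<omega>. ?m \<omega> \<partial>M)"
      using e by (intro nn_integral_barrier_mass_ge r) auto
    also have "\<dots> \<le> (\<integral>\<^sup>+\<omega>. min (?m \<omega>) (ennreal K) + ?m \<omega> * ?m \<omega> * ennreal (1 / (4 * K)) \<partial>M)"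
      by (intro nn_integral_mono ennreal_le_min_plus_square K)
    also have "\<dots> = ?A + (\<integral>\<^sup>+\<omega>. ?m \<omega> * ?m \<omega> * ennreal (1 / (4 * K)) \<partial>M)"
      by (rule nn_integral_add) measurable
    also have "(\<integral>\<^sup>+\<omega>. ?m \<omega> * ?m \<omega> * ennreal (1 / (4 * K)) \<partial>M) = (\<integral>\<^sup>+\<omega>. ?m \<omega> * ?m \<omega> \<partial>M) * ennreal (1 / (4 * K))"
      by (rule nn_integral_multc) measurable
    also have "?A + \<dots> \<le> ?A + ennreal K * ennreal (1 / (4 * K))"
      unfolding K_def using e g \<beta> B
      by (intro add_left_mono mult_right_mono nn_integral_barrier_mass_square_le r) auto
    also have "ennreal K * ennreal (1 / (4 * K)) = ennreal (1 / 4)"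
      using K by (simp add: ennreal_mult[symmetric])
    finally have A: "ennreal (1 / 2) \<le> ?A + ennreal (1 / 4)" .
    have "ennreal (1 / 4) \<le> ?A"
    proof (cases ?A)
      case (real a)
      then have "ennreal (1 / 2) \<le> ennreal (a + 1 / 4)"
        using A by simp
      then have "1 / 2 \<le> a + 1 / 4"
        using real(1) by (subst (asm) ennreal_le_iff) auto
      then show ?thesis
        unfolding real(2) by (intro ennreal_leI) linarith
    qed simp
    also have "?A \<le> (\<integral>\<^sup>+\<omega>. min (\<integral>\<^sup>+t. ennreal (weight g r n (Xs \<omega>) t) * indicator {0..2 * pi} t \<partial>lborel) (ennreal K) \<partial>M)"
    proof (intro nn_integral_mono min.mono order_refl)
      fix \<omega>
      show "?m \<omega> \<le> (\<integral>\<^sup>+t. ennreal (weight g r n (Xs \<omega>) t) * indicator {0..2 * pi} t \<partial>lborel)"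
        unfolding barrier_mass_def
        using pi_gt3 by (intro nn_integral_mono) (auto simp: barrier_weight_def indicator_def)
    qed
    finally show ?thesis .
  qed
  then show ?thesis
    using that K by blast
qed

end

section \<open>The critical regularity\<close>

lemma logsum_tendsto:
  assumes "0 \<le> \<rho>" "\<rho> < 1"
  shows "logsum \<rho> \<longlonglongrightarrow> - ln (1 - \<rho>)"
proof -
  have "(\<lambda>k. \<rho> ^ k / real k) sums (- ln (1 - \<rho>))"
    by (rule neg_ln_one_minus_sums[OF assms])
  then have "(\<lambda>k. \<rho> ^ Suc k / real (Suc k)) sums (- ln (1 - \<rho>))"
    by (subst sums_Suc_iff) simp
  then show ?thesis
    unfolding sums_def logsum_def[abs_def] by (simp add: sum.atLeast1_atMost_eq lessThan_Suc_atMost)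
qed

text \<open>At a fixed radius the series converges absolutely, which bounds the weights uniformly in
  \<open>n\<close> and \<open>t\<close>. The normalisation
  \<open>exp (- (g^2 * logsum (r^2) n))\<close> tends to \<open>(1 - r^2) powr g^2\<close>.\<close>

lemma weight_mass_tendsto:
  assumes x: "tame x" and r: "0 \<le> r" "r < 1" and g: "0 \<le> g"
  shows "(\<lambda>n. \<integral>\<^sup>+t. ennreal (weight g r n x t) * indicator {0..2 * pi} t \<partial>lborel) \<longlonglongrightarrow>
    ennreal ((1 - r\<^sup>2) powr g\<^sup>2) * nenergy g x r"
proof -
  let ?I = "indicator {0..2 * pi} :: real \<Rightarrow> ennreal"
  define S where "S = (\<Sum>k. cmod (of_real r ^ Suc k / of_real (sqrt (real (Suc k))) * x (Suc k)))"
  have sm: "summable (\<lambda>k. cmod (of_real r ^ Suc k / of_real (sqrt (real (Suc k))) * x (Suc k)))"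
    using r by (intro gser_summable_norm x) auto
  have r2: "0 \<le> r\<^sup>2" "r\<^sup>2 < 1"
    using r by (auto simp: power_less_one_iff)
  have [measurable]: "cis \<in> borel_measurable borel"
    by (intro borel_measurable_continuous_onI continuous_intros)
  have [measurable]: "(\<lambda>t. gpart n x (of_real r * cis t)) \<in> borel_measurable borel" for n
    unfolding gpart_def by measurable
  have [measurable]: "(\<lambda>t. gser x (of_real r * cis t)) \<in> borel_measurable borel"
    unfolding gser_def by measurable
  have [measurable]: "(\<lambda>t. chaos g x (of_real r * cis t)) \<in> borel_measurable borel"
    unfolding chaos_def by measurable
  have bound: "weight g r n x t \<le> exp (2 * g * S)" for n t
  proof -
    have "Re (gpart n x (of_real r * cis t)) \<le> cmod (gpart n x (of_real r * cis t))"
      by (rule complex_Re_le_cmod)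
    also have "\<dots> \<le> (\<Sum>k=1..n. cmod (of_real r ^ k / of_real (sqrt (real k)) * x k))"
      unfolding gpart_def by (intro order_trans[OF norm_sum] sum_mono) (simp add: norm_mult norm_divide norm_power)
    also have "\<dots> = (\<Sum>k<n. cmod (of_real r ^ Suc k / of_real (sqrt (real (Suc k))) * x (Suc k)))"
      by (simp add: sum.atLeast1_atMost_eq lessThan_Suc_atMost)
    also have "\<dots> \<le> S"
      unfolding S_def by (intro sum_le_suminf sm) auto
    finally have "2 * g * Re (gpart n x (of_real r * cis t)) \<le> 2 * g * S"
      using g by (intro mult_left_mono) auto
    moreover have "0 \<le> g\<^sup>2 * logsum (r\<^sup>2) n"
      using r2 by (intro mult_nonneg_nonneg logsum_nonneg) auto
    ultimately show ?thesis
      by (simp add: weight_def)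
  qed
  have lim: "(\<lambda>n. weight g r n x t) \<longlonglongrightarrow> (1 - r\<^sup>2) powr g\<^sup>2 * (cmod (chaos g x (of_real r * cis t)))\<^sup>2" for t
  proof -
    have "(\<lambda>n. weight g r n x t) \<longlonglongrightarrow> exp (2 * g * Re (gser x (of_real r * cis t)) - g\<^sup>2 * - ln (1 - r\<^sup>2))"
      unfolding weight_def using r
      by (intro tendsto_intros gpart_tendsto[OF x] logsum_tendsto r2) (auto simp: norm_mult)
    also have "exp (2 * g * Re (gser x (of_real r * cis t)) - g\<^sup>2 * - ln (1 - r\<^sup>2)) =
        (1 - r\<^sup>2) powr g\<^sup>2 * (cmod (chaos g x (of_real r * cis t)))\<^sup>2"
      using r2 by (simp add: cmod_chaos exp_double[symmetric] powr_def exp_add[symmetric] algebra_simps)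
    finally show ?thesis .
  qed
  have "(\<lambda>n. \<integral>\<^sup>+t. ennreal (weight g r n x t) * ?I t \<partial>lborel) \<longlonglongrightarrow>
      (\<integral>\<^sup>+t. ennreal ((1 - r\<^sup>2) powr g\<^sup>2 * (cmod (chaos g x (of_real r * cis t)))\<^sup>2) * ?I t \<partial>lborel)"
  proof (rule nn_integral_dominated_convergence)
    show "AE t in lborel. ennreal (weight g r n x t) * ?I t \<le> ennreal (exp (2 * g * S)) * ?I t" for n
      by (intro AE_I2 mult_right_mono ennreal_leI bound) auto
    show "(\<integral>\<^sup>+t. ennreal (exp (2 * g * S)) * ?I t \<partial>lborel) < \<infinity>"
      by (subst nn_integral_cmult_indicator) (auto simp: ennreal_mult_less_top)
    show "AE t in lborel. (\<lambda>n. ennreal (weight g r n x t) * ?I t) \<longlonglongrightarrow>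
        ennreal ((1 - r\<^sup>2) powr g\<^sup>2 * (cmod (chaos g x (of_real r * cis t)))\<^sup>2) * ?I t"
    proof (rule AE_I2)
      fix t
      show "(\<lambda>n. ennreal (weight g r n x t) * ?I t) \<longlonglongrightarrow>
        ennreal ((1 - r\<^sup>2) powr g\<^sup>2 * (cmod (chaos g x (of_real r * cis t)))\<^sup>2) * ?I t"
        using tendsto_ennrealI[OF lim[of t]] by (cases "t \<in> {0..2 * pi}") auto
    qed
    show "(\<lambda>t. ennreal (weight g r n x t) * ?I t) \<in> borel_measurable lborel" for n
      unfolding weight_def by measurable
  qed measurable
  also have "(\<integral>\<^sup>+t. ennreal ((1 - r\<^sup>2) powr g\<^sup>2 * (cmod (chaos g x (of_real r * cis t)))\<^sup>2) * ?I t \<partial>lborel) =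
      (\<integral>\<^sup>+t. ennreal ((1 - r\<^sup>2) powr g\<^sup>2) * (ennreal ((cmod (chaos g x (of_real r * cis t)))\<^sup>2) * ?I t) \<partial>lborel)"
    by (simp add: ennreal_mult mult.assoc)
  also have "\<dots> = ennreal ((1 - r\<^sup>2) powr g\<^sup>2) * nenergy g x r"
    unfolding nenergy_def by (rule nn_integral_cmult) measurable
  finally show ?thesis .
qed

lemma s_crit_neg:
  assumes "\<theta> > 0"
  shows "s_crit \<theta> < 0"
proof (cases "\<theta> \<le> 1")
  case False
  then have "1 < sqrt \<theta>"
    by simp
  then have "1 / 2 - sqrt \<theta> < 0"
    by linarith
  then show ?thesis
    using False by (simp add: s_crit_def)
qed (use assms in \<open>simp add: s_crit_def\<close>)

section \<open>Almost sure lower growth and the two halves of the theorem\<close>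

context gaussian_coefficients
begin

lemma measurable_nenergy_X [measurable]: "(\<lambda>\<omega>. nenergy g (Xs \<omega>) r) \<in> borel_measurable M"
  by (rule measurable_nenergy[where Y = X, OF measurable_X])

lemma measurable_weight [measurable]:
  "(\<lambda>(\<omega>, t). ennreal (weight g r n (Xs \<omega>) t)) \<in> borel_measurable (M \<Otimes>\<^sub>M lborel)"
  unfolding weight_def split_beta by measurable

text \<open>The cap \<open>K\<close> serves as the dominating function when \<open>n\<close> tends
  to infinity, so no uniform integrability of the masses has to be shown.\<close>

lemma nn_integral_min_nenergy_ge:
  assumes g: "0 < g" "g < 1"
  obtains K :: real where "K > 0"
    "\<And>r. 0 \<le> r \<Longrightarrow> r < 1 \<Longrightarrow> ennreal (1 / 4) \<le>
      (\<integral>\<^sup>+\<omega>. min (ennreal ((1 - r\<^sup>2) powr g\<^sup>2) * nenergy g (Xs \<omega>) r) (ennreal K) \<partial>M)"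
proof -
  obtain K where K: "K > 0" "\<And>r n. 0 \<le> r \<Longrightarrow> r < 1 \<Longrightarrow> ennreal (1 / 4) \<le>
      (\<integral>\<^sup>+\<omega>. min (\<integral>\<^sup>+t. ennreal (weight g r n (Xs \<omega>) t) * indicator {0..2 * pi} t \<partial>lborel) (ennreal K) \<partial>M)"
    using nn_integral_min_weight_mass_ge[OF g] by blast
  have "ennreal (1 / 4) \<le>
      (\<integral>\<^sup>+\<omega>. min (ennreal ((1 - r\<^sup>2) powr g\<^sup>2) * nenergy g (Xs \<omega>) r) (ennreal K) \<partial>M)"
    if r: "0 \<le> r" "r < 1" for r
  proof (rule LIMSEQ_le_const)
    show "(\<lambda>n. \<integral>\<^sup>+\<omega>. min (\<integral>\<^sup>+t. ennreal (weight g r n (Xs \<omega>) t) * indicator {0..2 * pi} t \<partial>lborel) (ennreal K) \<partial>M)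
      \<longlonglongrightarrow> (\<integral>\<^sup>+\<omega>. min (ennreal ((1 - r\<^sup>2) powr g\<^sup>2) * nenergy g (Xs \<omega>) r) (ennreal K) \<partial>M)"
    proof (rule nn_integral_dominated_convergence[where w = "\<lambda>_. ennreal K"])
      show "AE \<omega> in M. (\<lambda>n. min (\<integral>\<^sup>+t. ennreal (weight g r n (Xs \<omega>) t) * indicator {0..2 * pi} t \<partial>lborel) (ennreal K))
          \<longlonglongrightarrow> min (ennreal ((1 - r\<^sup>2) powr g\<^sup>2) * nenergy g (Xs \<omega>) r) (ennreal K)"
        using AE_tame
      proof eventually_elim
        case (elim \<omega>)
        show ?case
          using g by (intro tendsto_min tendsto_const weight_mass_tendsto elim r) auto
      qed
      show "(\<integral>\<^sup>+\<omega>. ennreal K \<partial>M) < \<infinity>"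
        by (simp add: emeasure_space_1)
    qed (measurable, auto)
  qed (use K(2)[OF r] in blast)
  then show ?thesis
    using that K(1) by blast
qed

text \<open>The zero-one law leaves only the case of almost sure growth to refute. There the
  normalised energies decay like \<open>(2 powr (b - g^2)) ^ j\<close>, so their capped means tend
  to \<open>0\<close>, against the uniform lower bound \<open>1 / 4\<close>.\<close>

lemma AE_not_growth:
  assumes g: "0 < g" "g < 1" and b: "b < g\<^sup>2"
  shows "AE \<omega> in M. \<not> growth g b (Xs \<omega>)"
proof (rule growth_zero_one, rule notI)
  assume gr: "AE \<omega> in M. growth g b (Xs \<omega>)"
  obtain K where K: "K > 0" "\<And>r. 0 \<le> r \<Longrightarrow> r < 1 \<Longrightarrow> ennreal (1 / 4) \<le>
      (\<integral>\<^sup>+\<omega>. min (ennreal ((1 - r\<^sup>2) powr g\<^sup>2) * nenergy g (Xs \<omega>) r) (ennreal K) \<partial>M)"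
    using nn_integral_min_nenergy_ge[OF g] by blast
  let ?Y = "\<lambda>j \<omega>. ennreal ((1 - (rad j)\<^sup>2) powr g\<^sup>2) * nenergy g (Xs \<omega>) (rad j)"
  have "(\<lambda>j. \<integral>\<^sup>+\<omega>. min (?Y j \<omega>) (ennreal K) \<partial>M) \<longlonglongrightarrow> (\<integral>\<^sup>+\<omega>. 0 \<partial>M)"
  proof (rule nn_integral_dominated_convergence[where w = "\<lambda>_. ennreal K"])
    show "AE \<omega> in M. (\<lambda>j. min (?Y j \<omega>) (ennreal K)) \<longlonglongrightarrow> 0"
      using AE_tame gr
    proof eventually_elim
      case (elim \<omega>)
      then obtain C where C: "\<And>j. energy g (Xs \<omega>) (rad j) \<le> C * 2 powr (b * real j)"
        by (auto simp: growth_def)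
      define q :: real where "q = 2 powr (b - g\<^sup>2)"
      have q: "0 \<le> q" "q < 1"
        using b by (auto simp: q_def intro!: powr_less_one)
      have le: "?Y j \<omega> \<le> ennreal (2 * pi * C * q ^ j)" for j
      proof -
        have "?Y j \<omega> = ennreal ((1 - (rad j)\<^sup>2) powr g\<^sup>2 * (2 * pi * energy g (Xs \<omega>) (rad j)))"
          unfolding nenergy_eq[OF elim(1) rad_nonneg rad_less_1]
          by (rule ennreal_mult[symmetric]) (auto simp: energy_nonneg)
        also have "\<dots> \<le> ennreal ((1 - (rad j)\<^sup>2) powr g\<^sup>2 * (2 * pi * (C * 2 powr (b * real j))))"
          by (intro ennreal_leI mult_left_mono C) auto
        also have "(1 - (rad j)\<^sup>2) powr g\<^sup>2 * (2 * pi * (C * 2 powr (b * real j))) = 2 * pi * C * q ^ j"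
        proof -
          have "1 - (rad j)\<^sup>2 = 2 powr (- real j)"
            by (simp add: rad_power2 powr_minus powr_realpow divide_inverse)
          then have "(1 - (rad j)\<^sup>2) powr g\<^sup>2 = 2 powr (- (real j * g\<^sup>2))"
            by (simp only: powr_powr) simp
          then have "(1 - (rad j)\<^sup>2) powr g\<^sup>2 * 2 powr (b * real j) = q ^ j"
            by (simp add: q_def powr_add[symmetric] powr_realpow[symmetric] powr_powr algebra_simps)
          then show ?thesis
            by (simp only: mult_ac)
        qed
        finally show ?thesis .
      qed
      have "(\<lambda>j. ennreal (2 * pi * C * q ^ j)) \<longlonglongrightarrow> ennreal (2 * pi * C * 0)"
        by (intro tendsto_ennrealI tendsto_mult tendsto_const LIMSEQ_realpow_zero q)
      then have lim: "(\<lambda>j. ennreal (2 * pi * C * q ^ j)) \<longlonglongrightarrow> 0"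
        by simp
      show ?case
      proof (rule tendsto_sandwich[OF _ _ tendsto_const lim])
        show "\<forall>\<^sub>F j in sequentially. min (?Y j \<omega>) (ennreal K) \<le> ennreal (2 * pi * C * q ^ j)"
          using le by (intro always_eventually allI) (rule min.coboundedI1)
      qed simp
    qed
    show "(\<integral>\<^sup>+\<omega>. ennreal K \<partial>M) < \<infinity>"
      by (simp add: emeasure_space_1)
  qed (measurable, auto)
  then have "ennreal (1 / 4) \<le> (\<integral>\<^sup>+\<omega>. 0 \<partial>M)"
    by (rule LIMSEQ_le_const) (use K(2)[OF rad_nonneg rad_less_1] in blast)
  then show False
    by simp
qed

lemma HMC_regularity:
  assumes \<theta>: "\<theta> > 0" and s: "s < s_crit \<theta>"
  shows "AE \<omega> in M. HMC \<theta> X \<omega> \<in> sobolev s"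
proof -
  define g where "g = sqrt \<theta>"
  have g: "g > 0" "\<theta> = g\<^sup>2"
    using \<theta> by (auto simp: g_def)
  have s0: "s < 0"
    using s s_crit_neg[OF \<theta>] by simp
  have "\<exists>b < - 2 * s. AE \<omega> in M. growth g b (Xs \<omega>)"
  proof (cases "\<theta> \<le> 1")
    case True
    then have "g\<^sup>2 < - 2 * s"
      using s by (simp add: s_crit_def g)
    then have "0 < (- 2 * s - g\<^sup>2) / 2" "g\<^sup>2 + (- 2 * s - g\<^sup>2) / 2 < - 2 * s"
      by (simp_all add: field_simps)
    then show ?thesis
      using AE_growth by blast
  next
    case False
    then have g1: "1 < g"
      by (simp add: g_def)
    have "2 * g - 1 < - 2 * s"
      using False s by (simp add: s_crit_def g_def)
    \<comment> \<open>Interpolation from parameter \<open>1\<close> gives the exponent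
      \<open>2 * g - 1 + g * e\<close>; with this \<open>e\<close> half of the gap to
      \<open>- 2 * s\<close> is spent.\<close>
    define e where "e = (- 2 * s - (2 * g - 1)) / (2 * g)"
    have e: "e > 0"
      using \<open>2 * g - 1 < - 2 * s\<close> g1 by (simp add: e_def)
    have "AE \<omega> in M. growth 1 (1\<^sup>2 + e) (Xs \<omega>)"
      by (rule AE_growth[OF e])
    with AE_tame have "AE \<omega> in M. growth g ((1\<^sup>2 + e) + (g - 1) * ((1\<^sup>2 + e) + 1) / 1) (Xs \<omega>)"
    proof eventually_elim
      case (elim \<omega>)
      then show ?case
        using g1 by (intro growth_interpolate) auto
    qed
    moreover have "(1\<^sup>2 + e) + (g - 1) * ((1\<^sup>2 + e) + 1) / 1 < - 2 * s"
    proof -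
      have "g * e < - 2 * s - (2 * g - 1)"
        using \<open>2 * g - 1 < - 2 * s\<close> g1 by (simp add: e_def)
      then show ?thesis
        by (simp add: algebra_simps)
    qed
    ultimately show ?thesis
      by blast
  qed
  then obtain b where b: "b < - 2 * s" "AE \<omega> in M. growth g b (Xs \<omega>)"
    by blast
  from AE_tame b(2) show ?thesis
  proof eventually_elim
    case (elim \<omega>)
    then show ?case
      using summable_of_growth[OF elim(1) elim(2) b(1) s0]
      by (subst HMC_in_sobolev_iff) (auto simp: g_def)
  qed
qed

lemma HMC_irregularity_neg:
  assumes \<theta>: "\<theta> > 0" and s: "s > s_crit \<theta>" "s < 0"
  shows "AE \<omega> in M. HMC \<theta> X \<omega> \<notin> sobolev s"
proof -
  define g where "g = sqrt \<theta>"
  have g: "g > 0" "\<theta> = g\<^sup>2"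
    using \<theta> by (auto simp: g_def)
  have gr: "growth g (- 2 * s) (Xs \<omega>)" if "tame (Xs \<omega>)" "HMC \<theta> X \<omega> \<in> sobolev s" for \<omega>
    using that s(2) HMC_in_sobolev_iff[where X = X and \<omega> = \<omega> and \<theta> = \<theta> and s = s, OF that(1)]
    by (intro growth_of_summable) (auto simp: g_def)
  show ?thesis
  proof (cases "\<theta> < 1")
    case True
    then have "g < 1"
      by (simp add: g_def)
    have "- 2 * s < g\<^sup>2"
      using s True by (simp add: s_crit_def g)
    from AE_tame AE_not_growth[OF g(1) \<open>g < 1\<close> this] show ?thesis
      by eventually_elim (use gr in blast)
  next
    case False
    then have g1: "1 \<le> g"
      by (simp add: g_def)
    have "1 / 2 - g < s"
      using False s by (cases "\<theta> = 1") (auto simp: s_crit_def g_def)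
    \<comment> \<open>Growth with exponent \<open>- 2 * s\<close> bounds the modulus by a constant
      times \<open>2 powr (j * (1 / 2 - s))\<close>, that is, \<open>Re (gser x z)\<close> by
      \<open>k * j * ln 2\<close> plus a constant. Supercriticality of \<open>s\<close> is exactly
      \<open>k < 1\<close>.\<close>
    define k where "k = (1 / 2 - s) / g"
    have k: "0 < k" "k < 1"
      using \<open>1 / 2 - g < s\<close> s g by (auto simp: k_def field_simps)
    obtain g0 where g0: "k < g0" "g0 < 1"
      using dense[OF k(2)] by blast
    obtain g1 where g1: "g0 < g1" "g1 < 1"
      using dense[OF g0(2)] by blast
    have "0 < (g1 - g0) * (g1 + g0 - 2 * k)"
      using g0 g1 by (intro mult_pos_pos) auto
    \<comment> \<open>The margin \<open>g1^2 - g0^2 - 2 * k * (g1 - g0)\<close> factors as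
      \<open>(g1 - g0) * (g1 + g0 - 2 * k)\<close>, positive as both parameters exceed
      \<open>k\<close>; \<open>e\<close> is half of it.\<close>
    define e where "e = (g1 - g0) * (g1 + g0 - 2 * k) / 2"
    have e: "e > 0"
      using \<open>0 < (g1 - g0) * (g1 + g0 - 2 * k)\<close> by (simp add: e_def)
    have kk: "(- 2 * s + 1) / g = 2 * k"
      using g by (simp add: k_def field_simps)
    have lt: "(g0\<^sup>2 + e) + (g1 - g0) * (- 2 * s + 1) / g < g1\<^sup>2"
    proof -
      have "(g0\<^sup>2 + e) + (g1 - g0) * (- 2 * s + 1) / g = g0\<^sup>2 + e + (g1 - g0) * (2 * k)"
        unfolding kk[symmetric] by simp
      also have "\<dots> = g1\<^sup>2 - e"
        by (simp add: e_def power2_eq_square field_simps)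
      finally show ?thesis
        using e by simp
    qed
    have "0 < g1"
      using k g0 g1 by linarith
    from AE_tame AE_growth[OF e, of g0] AE_not_growth[OF \<open>0 < g1\<close> g1(2) lt] show ?thesis
    proof eventually_elim
      case (elim \<omega>)
      show ?case
      proof
        assume "HMC \<theta> X \<omega> \<in> sobolev s"
        then have "growth g1 ((g0\<^sup>2 + e) + (g1 - g0) * (- 2 * s + 1) / g) (Xs \<omega>)"
          using g g1 gr elim by (intro growth_interpolate) auto
        with elim show False
          by blast
      qed
    qed
  qed
qed

end

lemma sobolev_mono:
  assumes "s \<le> s'"
  shows "sobolev s' \<subseteq> sobolev s"
proof
  fix F
  assume F: "F \<in> sobolev s'"
  let ?t = "\<lambda>s n. (1 + (real_of_int n)\<^sup>2) powr s * (cmod (dist_fourier_coeff F n))\<^sup>2"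
  have "?t s summable_on UNIV"
  proof (rule summable_on_comparison_test)
    show "?t s' summable_on UNIV"
      using F by (simp add: sobolev_def)
    show "?t s n \<le> ?t s' n" for n
      using assms by (intro mult_right_mono powr_mono) auto
  qed auto
  then show "F \<in> sobolev s"
    using F by (simp add: sobolev_def)
qed

text \<open>The passage from summability to growth requires a negative index. A negative index below
  \<open>s\<close> is still available above \<open>s_crit \<theta>\<close>, and the Sobolev spaces
  are nested.\<close>

lemma (in gaussian_coefficients) HMC_irregularity:
  assumes \<theta>: "\<theta> > 0" and s: "s > s_crit \<theta>"
  shows "AE \<omega> in M. HMC \<theta> X \<omega> \<notin> sobolev s"
proof -
  obtain s' where s': "s_crit \<theta> < s'" "s' < min s 0"
    using dense[of "s_crit \<theta>" "min s 0"] s s_crit_neg[OF \<theta>] by auto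
  then have "AE \<omega> in M. HMC \<theta> X \<omega> \<notin> sobolev s'"
    by (intro HMC_irregularity_neg \<theta>) auto
  then show ?thesis
    by eventually_elim (use sobolev_mono[of s' s] s' in auto)
qed

theorem theorem1p4:
  fixes M :: "'a measure" and X :: "nat \<Rightarrow> 'a \<Rightarrow> complex" and \<theta> :: real
  assumes "prob_space M"
    and "prob_space.indep_vars M (\<lambda>_. borel) X {1..}"
    and "\<And>k. k \<ge> 1 \<Longrightarrow> std_complex_normal M (X k)"
    and "\<theta> > 0"
  shows "(\<forall>s < s_crit \<theta>. AE \<omega> in M. HMC \<theta> X \<omega> \<in> sobolev s) \<and>
         (\<forall>s > s_crit \<theta>. AE \<omega> in M. HMC \<theta> X \<omega> \<notin> sobolev s)"
proof -
  interpret gaussian_coefficients M X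
    using assms(1-3) by (intro gaussian_coefficients.intro gaussian_coefficients_axioms.intro)
  show ?thesis
    using HMC_regularity HMC_irregularity assms(4) by blast
qed

end
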